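(* Let $\Bbbk$ be a field. Let $P=\Bbbk\langle a,b,c,d,x,y\rangle$, augmented by sending each generator to $0$, and for $\ell\ge0$ set $e_\ell=(1+a)(1+b)^\ell(1+c)-(1+d)(1+x)^\ell(1+y)$. Let $A=P/(e_\ell\mid\ell\ge0)$ and $A_0=P/(e_0,e_1)$ with the induced augmentations. Then the canonical map $\Bbbk\langle a,b,c,d\rangle\to A_0$ (sending each generator to its class) is a para-equivalence. Moreover, $I(A_0)^\omega=\ker(A_0\twoheadrightarrow A)$, and $$H_2(A)\cong\frac{I(A_0)^\omega}{I(A_0)\cdot I(A_0)^\omega+I(A_0)^\omega\cdot I(A_0)}\cong\bigoplus_{\ell\ge2}\Bbbk .$$ A basis of $H_2(A)$ is represented (under the first isomorphism, by residue classes in the quotient) by the elements $$(1+a)b^\ell(1+c)-(1+d)x^\ell(1+y)\in I(A_0)^\omega,\qquad \ell\ge2.$$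
   Context: All algebras are associative unital $\Bbbk$-algebras and all ideals are two-sided; $(S)$ denotes the two-sided ideal generated by $S$. An augmentation of an algebra $B$ is a unital $\Bbbk$-algebra homomorphism $B\to\Bbbk$; its kernel $I(B)$ is the augmentation ideal, and $I(B)^\omega:=\bigcap_{n\ge1}I(B)^n$. A morphism $B\to C$ of augmented algebras is a para-equivalence if it induces an isomorphism $B/I(B)^n\to C/I(C)^n$ for every $n\ge1$. Free algebras $\Bbbk\langle X\rangle$ are augmented by $x\mapsto0$ for $x\in X$. $H_i(B)=\operatorname{Tor}^B_i(\Bbbk,\Bbbk)$, where both copies of $\Bbbk$ are $B$-modules via the augmentation. The map $A_0\twoheadrightarrow A$ is the canonical projection. *)

theory Defs
  imports
    "HOL-Library.Poly_Mapping"
    "HOL-Algebra.QuotRing"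
    "HOL-Algebra.Ideal_Product"
    "Jordan_Normal_Form.VS_Connect"
begin

text \<open>The ground field is the type \<^typ>\<open>'k::field\<close>, regarded as the ring record
  \<^term>\<open>class_ring\<close>.  Vector spaces, left modules and algebras are records of type
  \<^typ>\<open>('r, 'm) module\<close>; as usual in HOL-Algebra, \<open>mult\<close> and \<open>one\<close> are left undefined
  where the object is only a module.\<close>


section \<open>Linear algebra\<close>

text \<open>The vector space with basis \<open>S\<close>, that is, the direct sum of copies of the ground field
  indexed by \<open>S\<close>.\<close>

definition free_vs :: "'s set \<Rightarrow> ('k::field, 's \<Rightarrow>\<^sub>0 'k) module" where
  "free_vs S = \<lparr>carrier = {z. Poly_Mapping.keys z \<subseteq> S}, mult = undefined, one = undefined,
     zero = 0, add = (+), smult = (\<lambda>c. Poly_Mapping.map ((*) c))\<rparr>"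

text \<open>The quotient \<open>U / W\<close> of subspaces \<open>W \<subseteq> U\<close> of \<open>V\<close>, with cosets as elements.  In the scalar
  multiplication, adding \<open>W\<close> matters only for the scalar \<open>0\<close>.\<close>

definition quot_vs ::
  "('k::field, 'v, 'm) module_scheme \<Rightarrow> 'v set \<Rightarrow> 'v set \<Rightarrow> ('k, 'v set) module" where
  "quot_vs V U W = \<lparr>carrier = (\<lambda>u. W +>\<^bsub>V\<^esub> u) ` U, mult = undefined, one = undefined,
     zero = W, add = (\<lambda>X Y. X <+>\<^bsub>V\<^esub> Y),
     smult = (\<lambda>c X. W <+>\<^bsub>V\<^esub> ((\<lambda>x. c \<odot>\<^bsub>V\<^esub> x) ` X))\<rparr>"

definition vs_iso ::
  "('k::field, 'v, 'm) module_scheme \<Rightarrow> ('k, 'w, 'n) module_scheme \<Rightarrow> ('v \<Rightarrow> 'w) set" where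
  "vs_iso V W = {T. linear_map class_ring V W T \<and> bij_betw T (carrier V) (carrier W)}"


section \<open>Augmented algebras\<close>

record ('k, 'b) aug_algebra = "('k, 'b) module" +
  aug :: "'b \<Rightarrow> 'k"

locale augmented_algebra =
  ring B + Module.module "class_ring :: 'k ring" B
  for B :: "('k::field, 'b, 'm) aug_algebra_scheme" (structure) +
  assumes smult_mult_l:
      "\<lbrakk>x \<in> carrier B; y \<in> carrier B\<rbrakk> \<Longrightarrow> (c \<odot> x) \<otimes> y = c \<odot> (x \<otimes> y)"
    and smult_mult_r:
      "\<lbrakk>x \<in> carrier B; y \<in> carrier B\<rbrakk> \<Longrightarrow> x \<otimes> (c \<odot> y) = c \<odot> (x \<otimes> y)"
    and aug_ring_hom: "aug B \<in> Ring.ring_hom B (class_ring :: 'k ring)"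
    and aug_smult: "x \<in> carrier B \<Longrightarrow> aug B (c \<odot> x) = c * aug B x"

definition aug_hom ::
  "('k::field, 'b, 'm) aug_algebra_scheme \<Rightarrow> ('k, 'c, 'n) aug_algebra_scheme \<Rightarrow> ('b \<Rightarrow> 'c) set" where
  "aug_hom B C = {f \<in> Ring.ring_hom B C.
     (\<forall>c. \<forall>x\<in>carrier B. f (c \<odot>\<^bsub>B\<^esub> x) = c \<odot>\<^bsub>C\<^esub> f x) \<and> (\<forall>x\<in>carrier B. aug C (f x) = aug B x)}"

definition aug_ideal :: "('k::field, 'b, 'm) aug_algebra_scheme \<Rightarrow> 'b set" where
  "aug_ideal B = a_kernel B (class_ring :: 'k ring) (aug B)"

primrec ideal_power :: "('b, 'm) ring_scheme \<Rightarrow> 'b set \<Rightarrow> nat \<Rightarrow> 'b set" where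
  "ideal_power B I 0 = carrier B"
| "ideal_power B I (Suc n) = ideal_power B I n \<cdot>\<^bsub>B\<^esub> I"

definition aug_ideal_omega :: "('k::field, 'b, 'm) aug_algebra_scheme \<Rightarrow> 'b set" where
  "aug_ideal_omega B = (\<Inter>n\<in>{1..}. ideal_power B (aug_ideal B) n)"

definition para_equivalence ::
  "('k::field, 'b, 'm) aug_algebra_scheme \<Rightarrow> ('k, 'c, 'n) aug_algebra_scheme \<Rightarrow> ('b \<Rightarrow> 'c) \<Rightarrow> bool"
where
  "para_equivalence B C f \<longleftrightarrow> augmented_algebra B \<and> augmented_algebra C \<and> f \<in> aug_hom B C \<and>
     (\<forall>n\<ge>1. \<exists>h \<in> ring_iso (B Quot ideal_power B (aug_ideal B) n)
                            (C Quot ideal_power C (aug_ideal C) n).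
        \<forall>x\<in>carrier B. h (ideal_power B (aug_ideal B) n +>\<^bsub>B\<^esub> x)
                       = ideal_power C (aug_ideal C) n +>\<^bsub>C\<^esub> f x)"

text \<open>The quotient by a two-sided ideal \<open>J\<close> contained in the augmentation ideal, with the induced
  augmentation.\<close>

definition quot_algebra ::
  "('k::field, 'b, 'm) aug_algebra_scheme \<Rightarrow> 'b set \<Rightarrow> ('k, 'b set) aug_algebra" where
  "quot_algebra B J = \<lparr>carrier = carrier (B Quot J), mult = mult (B Quot J),
     one = one (B Quot J), zero = zero (B Quot J), add = add (B Quot J),
     smult = (\<lambda>c X. J <+>\<^bsub>B\<^esub> ((\<lambda>x. c \<odot>\<^bsub>B\<^esub> x) ` X)),
     aug = (\<lambda>X. the_elem (aug B ` X))\<rparr>"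


section \<open>Free algebras\<close>

text \<open>The free algebra on the elements of \<^typ>\<open>'x\<close> is the monoid algebra of the free monoid of
  words, whose operation is written additively so that the convolution product of
  \<^type>\<open>poly_mapping\<close> applies.\<close>

datatype 'x word = Word (letters: "'x list")

instantiation word :: (type) monoid_add
begin

definition zero_word :: "'x word" where
  "zero_word = Word []"

definition plus_word :: "'x word \<Rightarrow> 'x word \<Rightarrow> 'x word" where
  "plus_word u v = Word (letters u @ letters v)"

instance
  by standard (simp_all add: zero_word_def plus_word_def)

end

text \<open>The augmentation killing all generators is the constant coefficient.\<close>

definition free_algebra :: "('k::field, 'x word \<Rightarrow>\<^sub>0 'k) aug_algebra" where
  "free_algebra = \<lparr>carrier = UNIV, mult = (*), one = 1, zero = 0, add = (+),
     smult = (\<lambda>c. Poly_Mapping.map ((*) c)), aug = (\<lambda>p. Poly_Mapping.lookup p 0)\<rparr>"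

definition gen :: "'x \<Rightarrow> ('x word \<Rightarrow>\<^sub>0 'k::field)" where
  "gen g = Poly_Mapping.single (Word [g]) 1"

text \<open>The algebra homomorphism from the free algebra to \<open>B\<close> extending
  \<open>\<phi>\<close> on the generators.\<close>

definition free_lift ::
  "('k::field, 'b, 'm) module_scheme \<Rightarrow> ('x \<Rightarrow> 'b) \<Rightarrow> ('x word \<Rightarrow>\<^sub>0 'k) \<Rightarrow> 'b" where
  "free_lift B \<phi> p = finsum B
     (\<lambda>w. Poly_Mapping.lookup p w \<odot>\<^bsub>B\<^esub> foldr (\<lambda>g r. \<phi> g \<otimes>\<^bsub>B\<^esub> r) (letters w) \<one>\<^bsub>B\<^esub>)
     (Poly_Mapping.keys p)"


section \<open>Second homology\<close>

text \<open>Left modules over a (noncommutative) algebra \<open>B\<close> are records \<^typ>\<open>('b, 'n) module\<close>; the same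
  records serve for right modules, where \<open>b \<odot> m\<close> then stands for the action of \<open>b\<close> on \<open>m\<close> from the
  right.  The ground field is both, through the augmentation.\<close>

definition triv_module :: "('k::field, 'b, 'm) aug_algebra_scheme \<Rightarrow> ('b, 'k) module" where
  "triv_module B = \<lparr>carrier = UNIV, mult = undefined, one = undefined, zero = 0, add = (+),
     smult = (\<lambda>b t. aug B b * t)\<rparr>"

text \<open>The free left module on the set \<open>S\<close>: finitely supported functions from \<open>S\<close> to \<open>B\<close>.\<close>

definition free_lmodule :: "('b, 'm) ring_scheme \<Rightarrow> 's set \<Rightarrow> ('b, 's \<Rightarrow> 'b) module" where
  "free_lmodule B S = \<lparr>carrier = {f. (\<forall>s\<in>S. f s \<in> carrier B) \<and> (\<forall>s. s \<notin> S \<longrightarrow> f s = \<zero>\<^bsub>B\<^esub>) \<and>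
                                   finite {s. f s \<noteq> \<zero>\<^bsub>B\<^esub>}},
     mult = undefined, one = undefined, zero = (\<lambda>s. \<zero>\<^bsub>B\<^esub>), add = (\<lambda>f g s. f s \<oplus>\<^bsub>B\<^esub> g s),
     smult = (\<lambda>b f s. b \<otimes>\<^bsub>B\<^esub> f s)\<rparr>"

text \<open>The canonical free cover of \<open>N\<close>: the free module on the underlying set of \<open>N\<close>, mapped onto \<open>N\<close>
  by sending the basis element of \<open>n\<close> to \<open>n\<close>; and its kernel.  Iterating gives the canonical free
  resolution of \<open>N\<close>.\<close>

definition free_cover ::
  "('b, 'm) ring_scheme \<Rightarrow> ('b, 'n, 'l) module_scheme \<Rightarrow> ('b, 'n \<Rightarrow> 'b) module" where
  "free_cover B N = free_lmodule B (carrier N)"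

definition cover_map ::
  "('b, 'm) ring_scheme \<Rightarrow> ('b, 'n, 'l) module_scheme \<Rightarrow> ('n \<Rightarrow> 'b) \<Rightarrow> 'n" where
  "cover_map B N f = (\<Oplus>\<^bsub>N\<^esub>n\<in>{n. f n \<noteq> \<zero>\<^bsub>B\<^esub>}. f n \<odot>\<^bsub>N\<^esub> n)"

definition syzygy ::
  "('b, 'm) ring_scheme \<Rightarrow> ('b, 'n, 'l) module_scheme \<Rightarrow> ('b, 'n \<Rightarrow> 'b) module" where
  "syzygy B N =
     (free_cover B N)\<lparr>carrier := {f \<in> carrier (free_cover B N). cover_map B N f = \<zero>\<^bsub>N\<^esub>}\<rparr>"

text \<open>The tensor product over \<open>B\<close> of a right module \<open>M\<close> and a left module \<open>N\<close>, as a vector space: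
  the space with basis the pairs \<open>(m, n)\<close>, modulo the bilinear and \<open>B\<close>-balanced relations.  Scalars
  act on \<open>M\<close> through the unit of \<open>B\<close>.\<close>

definition tensor_relators ::
  "('k::field, 'b, 'm) module_scheme \<Rightarrow> ('b, 'r, 'i) module_scheme \<Rightarrow> ('b, 'n, 'j) module_scheme
    \<Rightarrow> ('r \<times> 'n \<Rightarrow>\<^sub>0 'k) set" where
  "tensor_relators B M N =
     {Poly_Mapping.single (m \<oplus>\<^bsub>M\<^esub> m', n) 1 - Poly_Mapping.single (m, n) 1
        - Poly_Mapping.single (m', n) 1
      | m m' n. m \<in> carrier M \<and> m' \<in> carrier M \<and> n \<in> carrier N} \<union>
     {Poly_Mapping.single (m, n \<oplus>\<^bsub>N\<^esub> n') 1 - Poly_Mapping.single (m, n) 1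
        - Poly_Mapping.single (m, n') 1
      | m n n'. m \<in> carrier M \<and> n \<in> carrier N \<and> n' \<in> carrier N} \<union>
     {Poly_Mapping.single (b \<odot>\<^bsub>M\<^esub> m, n) 1 - Poly_Mapping.single (m, b \<odot>\<^bsub>N\<^esub> n) 1
      | b m n. b \<in> carrier B \<and> m \<in> carrier M \<and> n \<in> carrier N} \<union>
     {Poly_Mapping.single ((c \<odot>\<^bsub>B\<^esub> \<one>\<^bsub>B\<^esub>) \<odot>\<^bsub>M\<^esub> m, n) 1 - Poly_Mapping.single (m, n) c
      | c m n. m \<in> carrier M \<and> n \<in> carrier N}"

definition tensor_rel ::
  "('k::field, 'b, 'm) module_scheme \<Rightarrow> ('b, 'r, 'i) module_scheme \<Rightarrow> ('b, 'n, 'j) module_scheme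
    \<Rightarrow> ('r \<times> 'n \<Rightarrow>\<^sub>0 'k) set" where
  "tensor_rel B M N = LinearCombinations.module.span class_ring
     (free_vs (carrier M \<times> carrier N)) (tensor_relators B M N)"

definition tensor ::
  "('k::field, 'b, 'm) module_scheme \<Rightarrow> ('b, 'r, 'i) module_scheme \<Rightarrow> ('b, 'n, 'j) module_scheme
    \<Rightarrow> ('k, ('r \<times> 'n \<Rightarrow>\<^sub>0 'k) set) module" where
  "tensor B M N = quot_vs (free_vs (carrier M \<times> carrier N))
     (carrier (free_vs (carrier M \<times> carrier N))) (tensor_rel B M N)"

text \<open>The map \<open>id \<otimes> d : M \<otimes> N \<rightarrow> M \<otimes> N'\<close> induced by a module homomorphism \<open>d : N \<rightarrow> N'\<close>.\<close>

definition tensor_map ::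
  "('k::field, 'b, 'm) module_scheme \<Rightarrow> ('b, 'r, 'i) module_scheme \<Rightarrow> ('b, 'n, 'j) module_scheme
    \<Rightarrow> ('n0 \<Rightarrow> 'n) \<Rightarrow> ('r \<times> 'n0 \<Rightarrow>\<^sub>0 'k) set \<Rightarrow> ('r \<times> 'n \<Rightarrow>\<^sub>0 'k) set" where
  "tensor_map B M N' d X = tensor_rel B M N' <+>\<^bsub>free_vs (carrier M \<times> carrier N')\<^esub>
     ((\<lambda>z. \<Sum>(m, n)\<in>Poly_Mapping.keys z.
         Poly_Mapping.single (m, d n) (Poly_Mapping.lookup z (m, n))) ` X)"

text \<open>With \<open>F\<^sub>1, F\<^sub>2, F\<^sub>3\<close> the terms of the canonical free resolution of \<open>N\<close> in degrees 1, 2, 3 and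
  differentials \<open>F\<^sub>3 \<rightarrow> F\<^sub>2 \<rightarrow> F\<^sub>1\<close>, the second \<open>Tor\<close> is the homology of the tensored complex
  in degree 2.\<close>

definition Tor2 ::
  "('k::field, 'b, 'm) module_scheme \<Rightarrow> ('b, 'r, 'i) module_scheme \<Rightarrow> ('b, 'n, 'j) module_scheme
    \<Rightarrow> ('k, ('r \<times> ((('n \<Rightarrow> 'b) \<Rightarrow> 'b) \<Rightarrow> 'b) \<Rightarrow>\<^sub>0 'k) set set) module" where
  "Tor2 B M N =
    (let K1 = syzygy B N; K2 = syzygy B K1; K3 = syzygy B K2;
         F1 = free_cover B K1; F2 = free_cover B K2; F3 = free_cover B K3;
         d2 = tensor_map B M F1 (cover_map B K2);
         d3 = tensor_map B M F2 (cover_map B K3)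
     in quot_vs (tensor B M F2)
          {X \<in> carrier (tensor B M F2). d2 X = \<zero>\<^bsub>tensor B M F1\<^esub>}
          (d3 ` carrier (tensor B M F3)))"

definition H2 ::
  "('k::field, 'b, 'm) aug_algebra_scheme
    \<Rightarrow> ('k, ('k \<times> ((('k \<Rightarrow> 'b) \<Rightarrow> 'b) \<Rightarrow> 'b) \<Rightarrow>\<^sub>0 'k) set set) module" where
  "H2 B = Tor2 B (triv_module B) (triv_module B)"


section \<open>The algebras presented by the relators\<close>

datatype gens4 = Ga | Gb | Gc | Gd
datatype gens6 = Incl gens4 | Gx | Gy

abbreviation "Pa \<equiv> gen (Incl Ga)"
abbreviation "Pb \<equiv> gen (Incl Gb)"
abbreviation "Pc \<equiv> gen (Incl Gc)"
abbreviation "Pd \<equiv> gen (Incl Gd)"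
abbreviation "Px \<equiv> gen Gx"
abbreviation "Py \<equiv> gen Gy"

type_synonym 'k P = "gens6 word \<Rightarrow>\<^sub>0 'k"

definition rel_e :: "nat \<Rightarrow> 'k::field P" where
  "rel_e l = (1 + Pa) * (1 + Pb) ^ l * (1 + Pc) - (1 + Pd) * (1 + Px) ^ l * (1 + Py)"

definition rel_w :: "nat \<Rightarrow> 'k::field P" where
  "rel_w l = (1 + Pa) * Pb ^ l * (1 + Pc) - (1 + Pd) * Px ^ l * (1 + Py)"

definition ideal_J :: "'k::field P set" where
  "ideal_J = Idl\<^bsub>free_algebra\<^esub> (range rel_e)"

definition ideal_J0 :: "'k::field P set" where
  "ideal_J0 = Idl\<^bsub>free_algebra\<^esub> {rel_e 0, rel_e 1}"

definition alg_A :: "('k::field, 'k P set) aug_algebra" where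
  "alg_A = quot_algebra free_algebra ideal_J"

definition alg_A0 :: "('k::field, 'k P set) aug_algebra" where
  "alg_A0 = quot_algebra free_algebra ideal_J0"

definition class_A0 :: "'k::field P \<Rightarrow> 'k P set" where
  "class_A0 p = ideal_J0 +>\<^bsub>free_algebra\<^esub> p"

definition canonical_map :: "(gens4 word \<Rightarrow>\<^sub>0 'k::field) \<Rightarrow> 'k P set" where
  "canonical_map = free_lift alg_A0 (\<lambda>g. class_A0 (gen (Incl g)))"

text \<open>The projection \<open>A\<^sub>0 \<rightarrow> A\<close>, sending the class of \<open>p\<close> to the class of \<open>p\<close>.\<close>

definition proj_A :: "'k::field P set \<Rightarrow> 'k P set" where
  "proj_A X = ideal_J <+>\<^bsub>free_algebra\<^esub> X"

definition omega_A0 :: "'k::field P set set" where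
  "omega_A0 = aug_ideal_omega alg_A0"

definition omega_dec :: "'k::field P set set" where
  "omega_dec = (aug_ideal alg_A0 \<cdot>\<^bsub>alg_A0\<^esub> omega_A0)
     <+>\<^bsub>alg_A0\<^esub> (omega_A0 \<cdot>\<^bsub>alg_A0\<^esub> aug_ideal alg_A0)"

definition omega_quot :: "('k::field, 'k P set set) module" where
  "omega_quot = quot_vs alg_A0 omega_A0 omega_dec"

end

theory Submission
  imports Defs
begin

text \<open>
  \<^bold>\<open>Relators.\<close> Since \<open>b\<^sup>l = ((1 + b) - 1)\<^sup>l\<close>, the elements
  \<open>w\<^sub>l = (1 + a) b\<^sup>l (1 + c) - (1 + d) x\<^sup>l (1 + y)\<close> generate the same ideal \<open>J\<close> as
  the \<open>e\<^sub>l\<close>, and \<open>w\<^sub>0\<close>, \<open>w\<^sub>1\<close> lie in the ideal \<open>J\<^sub>0\<close> of \<open>e\<^sub>0\<close>, \<open>e\<^sub>1\<close>.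
  Write \<open>I\<close> for the augmentation ideal of \<open>P\<close>.

  \<^bold>\<open>Para-equivalence.\<close> In the completion of \<open>F = k\<langle>a,b,c,d\<rangle>\<close> put
  \<open>g = (1 + d)\<^sup>-\<^sup>1 (1 + a)\<close>.  The equations \<open>e\<^sub>0 = e\<^sub>1 = 0\<close> say that
  \<open>1 + y = g (1 + c)\<close> and \<open>x = g b g\<^sup>-\<^sup>1\<close>, so they determine \<open>x\<close> and \<open>y\<close>; and then every
  \<open>e\<^sub>l\<close> vanishes.  Replacing the inverses by truncated geometric series gives homomorphisms
  \<open>rho n : P \<rightarrow> F\<close> that invert \<open>F \<rightarrow> A\<^sub>0\<close> modulo \<open>n\<close>-th powers and send \<open>J\<close> into the
  \<open>n\<close>-th power (\<open>J0_plus_iff\<close>).  In particular \<open>J\<close> lies in every \<open>J\<^sub>0 + I\<^sup>n\<close>.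

  \<^bold>\<open>The intersection of the powers.\<close> Conversely the intersection of the \<open>J\<^sub>0 + I\<^sup>n\<close> is
  contained in \<open>J\<close>, because \<open>A\<close> embeds into a free algebra, compatibly with the augmentations,
  and free algebras are residually nilpotent.  Choosing \<open>g\<close> and \<open>b g\<^sup>-\<^sup>1\<close> as coordinates in
  place of \<open>a\<close> and \<open>b\<close> removes all inverses: with \<open>1 + a = (1 + d) g\<close>, \<open>b = \<beta> g\<close>,
  \<open>x = g \<beta>\<close>, \<open>1 + y = g (1 + c)\<close> the relators become the identities
  \<open>(1 + d) g (\<beta> g)\<^sup>l (1 + c) = (1 + d) (g \<beta>)\<^sup>l g (1 + c)\<close>.  In multiplicative coordinates
  this map takes words to words, and reading a word in \<open>1 + d, g, 1 + c, \<beta>\<close> back as a word in the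
  generators of \<open>A\<close> is ambiguous only up to the relators \<open>w\<^sub>l\<close> (\<open>decode_encode\<close>).

  \<^bold>\<open>The quotient.\<close> As \<open>J\<close> is spanned by the \<open>w\<^sub>l\<close> modulo \<open>IJ + JI\<close>, the point is their
  independence there.  It is witnessed by one homomorphism from \<open>P\<close> to upper triangular
  matrices over \<open>k[z]\<close> that sends every element of \<open>J\<close> to a matrix concentrated in the upper
  right corner, where \<open>w\<^sub>l\<close> becomes \<open>z\<^sup>l\<close> (\<open>tri_rel_w\<close>).  Passing to \<open>A\<^sub>0\<close> kills exactly
  \<open>w\<^sub>0\<close> and \<open>w\<^sub>1\<close>.

  \<^bold>\<open>Homology.\<close> For an algebra \<open>P/K\<close> with \<open>P\<close> free the Hopf formula reads
  \<open>H\<^sub>2(P/K) = (K \<inter> I\<^sup>2)/(IK + KI)\<close>.  It is obtained here for the canonical free resolution: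
  dimension shifting (\<open>Tor2_iso\<close>) expresses \<open>Tor\<^sub>2\<close> through the second syzygies, and these are
  compared with \<open>K\<close> by means of Fox derivatives (\<open>H2_iso_of_functional\<close>).  The linear terms of
  \<open>w\<^sub>0\<close> and \<open>w\<^sub>1\<close> are independent, so \<open>J \<inter> I\<^sup>2\<close> is spanned by the \<open>w\<^sub>l\<close> with \<open>l \<ge> 2\<close>
  modulo \<open>IJ + JI\<close>, and both spaces have a basis indexed by \<open>l \<ge> 2\<close>.
\<close>

section \<open>Homomorphisms from free algebras and the degree filtration\<close>

abbreviation const :: "'k::zero \<Rightarrow> 'a::zero \<Rightarrow>\<^sub>0 'k" where
  "const \<equiv> Poly_Mapping.single 0"

lemma poly_mapping_keys_induct [consumes 1, case_names zero single add]:
  assumes p: "Poly_Mapping.keys p \<subseteq> S" and zero: "Q 0"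
    and single: "\<And>w c. w \<in> S \<Longrightarrow> Q (Poly_Mapping.single w c)"
    and add: "\<And>p q. Poly_Mapping.keys p \<subseteq> S \<Longrightarrow> Poly_Mapping.keys q \<subseteq> S \<Longrightarrow> Q p \<Longrightarrow> Q q \<Longrightarrow> Q (p + q)"
  shows "Q (p :: 'a \<Rightarrow>\<^sub>0 'b::comm_monoid_add)"
proof -
  let ?s = "\<lambda>W. \<Sum>w\<in>W. Poly_Mapping.single w (Poly_Mapping.lookup p w)"
  have "Q (?s W) \<and> Poly_Mapping.keys (?s W) \<subseteq> S" if "finite W" "W \<subseteq> S" for W
    using that
  proof (induction W)
    case (insert w W)
    have "Poly_Mapping.keys (Poly_Mapping.single w (Poly_Mapping.lookup p w)) \<subseteq> S"
      using insert.prems by simp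
    then show ?case
      using insert keys_add[of "Poly_Mapping.single w (Poly_Mapping.lookup p w)" "?s W"]
      by (auto intro!: add single)
  qed (simp add: zero)
  moreover have "p = ?s (Poly_Mapping.keys p)"
    by (rule poly_mapping_eqI) (simp add: lookup_sum lookup_single when_def in_keys_iff)
  ultimately show ?thesis using p by (metis finite_keys)
qed

lemma poly_mapping_single_induct [case_names single add]:
  fixes p :: "'a \<Rightarrow>\<^sub>0 'b::comm_monoid_add"
  assumes single: "\<And>w c. Q (Poly_Mapping.single w c)" and add: "\<And>p q. Q p \<Longrightarrow> Q q \<Longrightarrow> Q (p + q)"
  shows "Q p"
proof (rule poly_mapping_keys_induct[of p UNIV])
  show "Q 0" using single[of undefined 0] by simp
qed (simp_all add: single add)

lemma lookup_map_scale:
  "Poly_Mapping.lookup (Poly_Mapping.map ((*) (c::'k::field)) p) k = c * Poly_Mapping.lookup p k"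
  by (simp add: Poly_Mapping.map.rep_eq when_def)

lemma lookup_const_mult [simp]:
  "Poly_Mapping.lookup (const (c::'k::field) * p) k = c * Poly_Mapping.lookup p k"
  by (simp add: lookup_map_scale flip: mult_map_scale_conv_mult)

lemma single_Word_Cons:
  "Poly_Mapping.single (Word (g # ws)) (c::'k::field) = gen g * Poly_Mapping.single (Word ws) c"
  by (simp add: gen_def mult_single plus_word_def)

lemma single_Word_snoc:
  "Poly_Mapping.single (Word (ws @ [g])) (c::'k::field) = Poly_Mapping.single (Word ws) c * gen g"
  by (simp add: gen_def mult_single plus_word_def)

lemma single_Word_Nil: "Poly_Mapping.single (Word []) c = const c"
  by (simp add: zero_word_def)

lemma free_algebra_induct [case_names const add gen]:
  fixes p :: "'x word \<Rightarrow>\<^sub>0 'k::field"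
  assumes "\<And>c. Q (const c)" and "\<And>p q. Q p \<Longrightarrow> Q q \<Longrightarrow> Q (p + q)" and "\<And>g p. Q p \<Longrightarrow> Q (gen g * p)"
  shows "Q p"
proof (induction p rule: poly_mapping_single_induct)
  case (single w c)
  have "Q (Poly_Mapping.single (Word ws) c)" for ws
    by (induction ws) (simp_all add: single_Word_Nil single_Word_Cons assms)
  then show ?case by (cases w) simp
qed (fact assms)

lemma const_commute: "const c * p = p * (const (c::'k::field) :: 'a::monoid_add \<Rightarrow>\<^sub>0 'k)"
  by (induction p rule: poly_mapping_single_induct)
     (simp_all add: mult_single algebra_simps)

text \<open>A ring homomorphism \<open>C\<close> from the field to the centre of a ring is an algebra structure on
  the ring.  It is kept as an explicit parameter because the targets below are rings of different
  types: the field, free algebras, and triangular matrices.\<close>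

locale central_scalars =
  fixes C :: "'k::field \<Rightarrow> 'r::ring_1"
  assumes C_add: "C (c + d) = C c + C d"
    and C_mult: "C (c * d) = C c * C d"
    and C_one: "C 1 = 1"
    and C_central: "C c * r = r * C c"
begin

lemma C_zero: "C 0 = 0"
  using C_add[of 0 0] by simp

definition lin_ext :: "('w \<Rightarrow> 'r) \<Rightarrow> ('w \<Rightarrow>\<^sub>0 'k) \<Rightarrow> 'r" where
  "lin_ext f p = (\<Sum>w\<in>Poly_Mapping.keys p. C (Poly_Mapping.lookup p w) * f w)"

lemma lin_ext_superset:
  assumes "finite W" "Poly_Mapping.keys p \<subseteq> W"
  shows "lin_ext f p = (\<Sum>w\<in>W. C (Poly_Mapping.lookup p w) * f w)"
  unfolding lin_ext_def using assms
  by (intro sum.mono_neutral_left) (auto simp: in_keys_iff C_zero)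

lemma lin_ext_add: "lin_ext f (p + q) = lin_ext f p + lin_ext f q"
proof -
  let ?W = "Poly_Mapping.keys p \<union> Poly_Mapping.keys q"
  have "Poly_Mapping.keys (p + q) \<subseteq> ?W" by (rule keys_add)
  then show ?thesis
    by (simp add: lin_ext_superset[of ?W] lookup_add C_add distrib_right sum.distrib)
qed

lemma lin_ext_single: "lin_ext f (Poly_Mapping.single w c) = C c * f w"
  by (subst lin_ext_superset[of "{w}"]) (auto simp: C_zero)

lemma lin_ext_zero: "lin_ext f 0 = 0"
  by (simp add: lin_ext_def)

lemma lin_ext_uminus: "lin_ext f (- p) = - lin_ext f p"
  using lin_ext_add[of f p "- p"] by (simp add: lin_ext_zero eq_neg_iff_add_eq_0 add.commute)

lemma lin_ext_diff: "lin_ext f (p - q) = lin_ext f p - lin_ext f q"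
  using lin_ext_add[of f p "- q"] by (simp add: lin_ext_uminus)

lemma lin_ext_smult: "lin_ext f (Poly_Mapping.map ((*) c) p) = C c * lin_ext f p"
proof (induction p rule: poly_mapping_single_induct)
  case (single w d)
  show ?case by (simp add: lin_ext_single C_mult mult.assoc)
next
  case (add p q)
  have "Poly_Mapping.map ((*) c) (p + q) = Poly_Mapping.map ((*) c) p + Poly_Mapping.map ((*) c) q"
    by (rule poly_mapping_eqI) (simp add: lookup_map_scale lookup_add distrib_left)
  with add show ?case by (simp add: lin_ext_add distrib_left)
qed

definition hom_ext :: "('x \<Rightarrow> 'r) \<Rightarrow> ('x word \<Rightarrow>\<^sub>0 'k) \<Rightarrow> 'r" where
  "hom_ext \<phi> = lin_ext (\<lambda>w. prod_list (map \<phi> (letters w)))"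

lemma hom_ext_single: "hom_ext \<phi> (Poly_Mapping.single w c) = C c * prod_list (map \<phi> (letters w))"
  by (simp add: hom_ext_def lin_ext_single)

lemma hom_ext_add: "hom_ext \<phi> (p + q) = hom_ext \<phi> p + hom_ext \<phi> q"
  by (simp add: hom_ext_def lin_ext_add)

lemma hom_ext_const: "hom_ext \<phi> (const c) = C c"
  by (simp add: hom_ext_single zero_word_def)

lemma hom_ext_gen: "hom_ext \<phi> (gen g) = \<phi> g"
  by (simp add: hom_ext_single gen_def C_one)

lemma hom_ext_zero: "hom_ext \<phi> 0 = 0"
  by (simp add: hom_ext_def lin_ext_zero)

lemma hom_ext_one: "hom_ext \<phi> 1 = 1"
  using hom_ext_const[of \<phi> 1] by (simp add: C_one)

lemma hom_ext_uminus: "hom_ext \<phi> (- p) = - hom_ext \<phi> p"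
  using hom_ext_add[of \<phi> p "- p"] by (simp add: hom_ext_zero eq_neg_iff_add_eq_0 add.commute)

lemma hom_ext_diff: "hom_ext \<phi> (p - q) = hom_ext \<phi> p - hom_ext \<phi> q"
  using hom_ext_add[of \<phi> p "- q"] by (simp add: hom_ext_uminus)

lemma hom_ext_mult: "hom_ext \<phi> (p * q) = hom_ext \<phi> p * hom_ext \<phi> q"
proof (induction p rule: poly_mapping_single_induct)
  case (single w c)
  show ?case
  proof (induction q rule: poly_mapping_single_induct)
    case (single v d)
    have "C c * C d * (x * y) = C c * x * (C d * y)" for x y
    proof -
      have "C c * C d * (x * y) = C c * (C d * x) * y" by (simp only: mult.assoc)
      also have "\<dots> = C c * (x * C d) * y" by (simp only: C_central[of d x])
      finally show ?thesis by (simp only: mult.assoc)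
    qed
    then show ?case
      by (simp add: mult_single hom_ext_single plus_word_def C_mult)
  qed (simp add: hom_ext_add algebra_simps)
qed (simp add: hom_ext_add algebra_simps)

lemma hom_ext_power: "hom_ext \<phi> (p ^ n) = hom_ext \<phi> p ^ n"
  by (induction n) (simp_all add: hom_ext_one hom_ext_mult)

lemma hom_ext_sum: "hom_ext \<phi> (sum f X) = (\<Sum>x\<in>X. hom_ext \<phi> (f x))"
  by (induction X rule: infinite_finite_induct) (simp_all add: hom_ext_zero hom_ext_add)

lemmas hom_ext_simps = hom_ext_add hom_ext_const hom_ext_gen hom_ext_zero hom_ext_one
  hom_ext_uminus hom_ext_diff hom_ext_mult hom_ext_power

lemmas lin_ext_simps = lin_ext_add lin_ext_single lin_ext_zero lin_ext_uminus lin_ext_diff lin_ext_smult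

end

text \<open>The field is an algebra over itself, which serves for the augmentation; monoid algebras comprise
  the free algebras and the polynomial ring \<open>nat \<Rightarrow>\<^sub>0 'k\<close>.\<close>

interpretation aug: central_scalars "\<lambda>c. c :: 'k::field"
  by standard auto

interpretation free: central_scalars "const :: 'k::field \<Rightarrow> 'a::monoid_add \<Rightarrow>\<^sub>0 'k"
  by standard (auto simp: single_add mult_single const_commute)

abbreviation counit :: "('x word \<Rightarrow>\<^sub>0 'k::field) \<Rightarrow> 'k" where
  "counit p \<equiv> Poly_Mapping.lookup p 0"

lemma counit_eq_hom_ext:
  fixes p :: "'x word \<Rightarrow>\<^sub>0 'k::field"
  shows "counit p = aug.hom_ext (\<lambda>_. 0) p"
proof (induction p rule: poly_mapping_single_induct)
  case (single w c)
  obtain ws where w: "w = Word ws" by (cases w)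
  have "prod_list (map (\<lambda>_. 0) ws) = (if ws = [] then 1 else (0::'k))"
    by (cases ws) simp_all
  then show ?case
    by (simp add: w aug.hom_ext_single lookup_single zero_word_def when_def)
qed (simp add: lookup_add aug.hom_ext_add)

lemma counit_mult: "counit (p * q) = counit p * counit q"
  by (simp add: counit_eq_hom_ext aug.hom_ext_mult)

lemma counit_gen [simp]: "counit (gen g) = 0"
  by (simp add: counit_eq_hom_ext aug.hom_ext_gen)

lemma counit_one [simp]: "counit 1 = 1"
  by (simp add: counit_eq_hom_ext aug.hom_ext_one)

lemma counit_power: "counit (p ^ n) = counit p ^ n"
  by (simp add: counit_eq_hom_ext aug.hom_ext_power)

text \<open>The elements of \<open>min_length n\<close> form the \<open>n\<close>-th power of the augmentation ideal (see
  \<open>ideal_power_free_algebra\<close>); in this form residual nilpotence of a free algebra is evident.\<close>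

definition min_length :: "nat \<Rightarrow> ('x word \<Rightarrow>\<^sub>0 'k::field) set" where
  "min_length n = {p. \<forall>w\<in>Poly_Mapping.keys p. n \<le> length (letters w)}"

lemma min_length_0 [simp]: "p \<in> min_length 0"
  by (simp add: min_length_def)

lemma min_length_zero [simp]: "0 \<in> min_length n"
  by (simp add: min_length_def)

lemma min_length_add: "p \<in> min_length n \<Longrightarrow> q \<in> min_length n \<Longrightarrow> p + q \<in> min_length n"
  using keys_add[of p q] by (auto simp: min_length_def)

lemma min_length_uminus: "p \<in> min_length n \<Longrightarrow> - p \<in> min_length n"
  by (auto simp: min_length_def in_keys_iff)

lemma min_length_diff: "p \<in> min_length n \<Longrightarrow> q \<in> min_length n \<Longrightarrow> p - q \<in> min_length n"
  using min_length_add[of p n "- q"] by (simp add: min_length_uminus)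

lemma min_length_mult: "p \<in> min_length m \<Longrightarrow> q \<in> min_length n \<Longrightarrow> p * q \<in> min_length (m + n)"
proof -
  assume p: "p \<in> min_length m" and q: "q \<in> min_length n"
  have "m + n \<le> length (letters w)" if w: "w \<in> Poly_Mapping.keys (p * q)" for w
  proof -
    from w keys_mult[of p q] obtain u v where "u \<in> Poly_Mapping.keys p" "v \<in> Poly_Mapping.keys q"
      "w = u + v" by auto
    then show ?thesis using p q by (auto simp: min_length_def plus_word_def intro: add_mono)
  qed
  then show ?thesis by (simp add: min_length_def)
qed

lemma min_length_lmult: "q \<in> min_length n \<Longrightarrow> p * q \<in> min_length n"
  using min_length_mult[of p 0 q n] by simp

lemma min_length_rmult: "q \<in> min_length n \<Longrightarrow> q * p \<in> min_length n"
  using min_length_mult[of q n p 0] by simp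

lemma min_length_gen [simp]: "gen g \<in> min_length 1"
  by (simp add: min_length_def gen_def)

lemma min_length_mono: "p \<in> min_length n \<Longrightarrow> m \<le> n \<Longrightarrow> p \<in> min_length m"
  by (auto simp: min_length_def)

lemma min_length_1_iff: "p \<in> min_length 1 \<longleftrightarrow> counit p = 0"
proof -
  have "1 \<le> length (letters w) \<longleftrightarrow> w \<noteq> 0" for w :: "'a word"
    by (cases w) (simp add: zero_word_def Suc_le_eq)
  then show ?thesis by (auto simp: min_length_def in_keys_iff)
qed

lemma min_length_power: "p \<in> min_length 1 \<Longrightarrow> p ^ n \<in> min_length n"
proof (induction n)
  case (Suc n)
  then show ?case using min_length_mult[of p 1 "p ^ n" n] by simp
qed simp

lemma min_length_Inter: "(\<And>n. p \<in> min_length n) \<Longrightarrow> p = 0"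
proof (rule ccontr)
  assume all: "\<And>n. p \<in> min_length n" and "p \<noteq> 0"
  then obtain w where "w \<in> Poly_Mapping.keys p" by fastforce
  with all[of "Suc (length (letters w))"] show False by (auto simp: min_length_def)
qed

lemma min_length_induct [consumes 1, case_names single add]:
  assumes p: "p \<in> min_length n"
    and single: "\<And>w c. n \<le> length (letters w) \<Longrightarrow> Q (Poly_Mapping.single w c)"
    and add: "\<And>p q. Q p \<Longrightarrow> Q q \<Longrightarrow> Q (p + q)"
  shows "Q p"
proof (rule poly_mapping_keys_induct[of p "{w. n \<le> length (letters w)}"])
  show "Poly_Mapping.keys p \<subseteq> {w. n \<le> length (letters w)}"
    using p by (auto simp: min_length_def)
  show "Q 0" using single[of "Word (replicate n undefined)" 0] by simp
qed (simp_all add: single add)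

lemma hom_ext_min_length:
  assumes \<phi>: "\<And>g. \<phi> g \<in> min_length 1" and p: "p \<in> min_length n"
  shows "free.hom_ext \<phi> p \<in> min_length n"
  using p
proof (induction rule: min_length_induct)
  case (single w c)
  have "prod_list (map \<phi> ws) \<in> min_length (length ws)" for ws
  proof (induction ws)
    case (Cons g ws)
    then show ?case using min_length_mult[OF \<phi>[of g] Cons.IH] by simp
  qed simp
  then show ?case using single
    by (auto simp: free.hom_ext_single intro!: min_length_lmult intro: min_length_mono)
qed (simp add: free.hom_ext_add min_length_add)

lemma hom_ext_unique:
  assumes add: "\<And>p q. f (p + q) = f p + f q" and mult: "\<And>p q. f (p * q) = f p * f q"
    and const: "\<And>c. f (const c) = const c"
  shows "f p = free.hom_ext (\<lambda>g. f (gen g)) p"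
  by (induction p rule: free_algebra_induct) (simp_all add: assms free.hom_ext_simps)

lemma hom_ext_gen_id: "free.hom_ext gen p = p"
  by (induction p rule: free_algebra_induct) (simp_all add: free.hom_ext_simps)


section \<open>Two-sided ideals of a free algebra\<close>

lemma free_algebra_simps [simp]:
  "carrier free_algebra = UNIV" "mult free_algebra = (*)" "one free_algebra = 1"
  "zero free_algebra = 0" "add free_algebra = (+)"
  "module.smult free_algebra c p = const c * p"
  "aug free_algebra = counit"
  by (simp_all add: free_algebra_def mult_map_scale_conv_mult fun_eq_iff)

lemma ring_free_algebra: "ring (free_algebra :: ('k::field, 'x word \<Rightarrow>\<^sub>0 'k) aug_algebra)"
proof (rule ringI)
  show "abelian_group (free_algebra :: ('k::field, 'x word \<Rightarrow>\<^sub>0 'k) aug_algebra)"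
    by (rule abelian_groupI) (auto simp: algebra_simps intro: exI[of _ "- _"])
  show "Group.monoid (free_algebra :: ('k::field, 'x word \<Rightarrow>\<^sub>0 'k) aug_algebra)"
    by (rule monoidI) (auto simp: algebra_simps)
qed (auto simp: algebra_simps)

lemma a_inv_free_algebra [simp]: "a_inv free_algebra p = - p"
proof -
  interpret ring free_algebra by (rule ring_free_algebra)
  show ?thesis by (rule minus_equality) auto
qed

lemma a_r_coset_free_algebra: "K +>\<^bsub>free_algebra\<^esub> p = (\<lambda>j. j + p) ` K"
  by (auto simp: a_r_coset_def' )

lemma ideal_free_algebra_iff:
  "ideal K (free_algebra :: ('k::field, 'x word \<Rightarrow>\<^sub>0 'k) aug_algebra) \<longleftrightarrow>
    0 \<in> K \<and> (\<forall>p\<in>K. \<forall>q\<in>K. p + q \<in> K) \<and> (\<forall>p\<in>K. \<forall>q. q * p \<in> K \<and> p * q \<in> K)"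
proof
  assume "ideal K (free_algebra :: ('k, 'x word \<Rightarrow>\<^sub>0 'k) aug_algebra)"
  then interpret ideal K "free_algebra :: ('k, 'x word \<Rightarrow>\<^sub>0 'k) aug_algebra" .
  show "0 \<in> K \<and> (\<forall>p\<in>K. \<forall>q\<in>K. p + q \<in> K) \<and> (\<forall>p\<in>K. \<forall>q. q * p \<in> K \<and> p * q \<in> K)"
    using additive_subgroup.zero_closed[OF is_additive_subgroup]
      additive_subgroup.a_closed[OF is_additive_subgroup] I_l_closed I_r_closed by auto
next
  assume K: "0 \<in> K \<and> (\<forall>p\<in>K. \<forall>q\<in>K. p + q \<in> K) \<and> (\<forall>p\<in>K. \<forall>q. q * p \<in> K \<and> p * q \<in> K)"
  interpret ring "free_algebra :: ('k, 'x word \<Rightarrow>\<^sub>0 'k) aug_algebra" by (rule ring_free_algebra)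
  have uminus: "- p \<in> K" if "p \<in> K" for p
    using K that by (metis mult_minus1)
  show "ideal K (free_algebra :: ('k, 'x word \<Rightarrow>\<^sub>0 'k) aug_algebra)"
  proof (rule idealI[OF ring_free_algebra])
    show "subgroup K (add_monoid (free_algebra :: ('k, 'x word \<Rightarrow>\<^sub>0 'k) aug_algebra))"
      using K uminus by (intro add.subgroupI) (auto simp: a_inv_def[symmetric])
  qed (use K in auto)
qed

lemma ideal_genideal: "ideal (Idl\<^bsub>free_algebra\<^esub> S) (free_algebra :: ('k::field, 'x word \<Rightarrow>\<^sub>0 'k) aug_algebra)"
  by (rule ring.genideal_ideal[OF ring_free_algebra]) simp

lemma genideal_base: "s \<in> S \<Longrightarrow> s \<in> Idl\<^bsub>free_algebra\<^esub> S"
  using ring.genideal_self[OF ring_free_algebra, of S] by auto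

lemma genideal_least:
  assumes "ideal K (free_algebra :: ('k::field, 'x word \<Rightarrow>\<^sub>0 'k) aug_algebra)" "S \<subseteq> K"
  shows "Idl\<^bsub>free_algebra\<^esub> S \<subseteq> K"
  by (rule ring.genideal_minimal[OF ring_free_algebra assms])

lemma genideal_induct [consumes 1, case_names zero base add lmult rmult]:
  fixes S :: "('x word \<Rightarrow>\<^sub>0 'k::field) set"
  assumes "p \<in> Idl\<^bsub>free_algebra\<^esub> S"
    and "Q 0" and "\<And>s. s \<in> S \<Longrightarrow> Q s"
    and "\<And>p q. p \<in> Idl\<^bsub>free_algebra\<^esub> S \<Longrightarrow> q \<in> Idl\<^bsub>free_algebra\<^esub> S \<Longrightarrow> Q p \<Longrightarrow> Q q \<Longrightarrow> Q (p + q)"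
    and "\<And>p q. p \<in> Idl\<^bsub>free_algebra\<^esub> S \<Longrightarrow> Q p \<Longrightarrow> Q (q * p)"
    and "\<And>p q. p \<in> Idl\<^bsub>free_algebra\<^esub> S \<Longrightarrow> Q p \<Longrightarrow> Q (p * q)"
  shows "Q p"
proof -
  let ?I = "Idl\<^bsub>free_algebra\<^esub> S"
  have "ideal {p \<in> ?I. Q p} (free_algebra :: ('k, 'x word \<Rightarrow>\<^sub>0 'k) aug_algebra)"
    using ideal_genideal[of S] assms(2-) unfolding ideal_free_algebra_iff by blast
  then have "?I \<subseteq> {p \<in> ?I. Q p}"
    by (rule genideal_least) (use assms genideal_base in auto)
  with assms(1) show ?thesis by blast
qed

lemma ideal_uminus:
  assumes "ideal K (free_algebra :: ('k::field, 'x word \<Rightarrow>\<^sub>0 'k) aug_algebra)" "p \<in> K"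
  shows "- p \<in> K"
  using assms unfolding ideal_free_algebra_iff by (metis mult_minus1)

lemma ideal_diff:
  assumes "ideal K (free_algebra :: ('k::field, 'x word \<Rightarrow>\<^sub>0 'k) aug_algebra)" "p \<in> K" "q \<in> K"
  shows "p - q \<in> K"
  using assms ideal_uminus[OF assms(1,3)] unfolding ideal_free_algebra_iff by (metis diff_conv_add_uminus)

lemma ideal_min_length: "ideal (min_length n) free_algebra"
  by (simp add: ideal_free_algebra_iff min_length_add min_length_lmult min_length_rmult)

lemma aug_ideal_free_algebra: "aug_ideal free_algebra = min_length 1"
  by (auto simp: aug_ideal_def a_kernel_def' min_length_1_iff simp del: One_nat_def)

lemma ideal_prod_free_algebra_sum:
  "p \<in> I \<cdot>\<^bsub>free_algebra\<^esub> K \<Longrightarrow> q \<in> I \<cdot>\<^bsub>free_algebra\<^esub> K \<Longrightarrow> p + q \<in> I \<cdot>\<^bsub>free_algebra\<^esub> K"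
  using ideal_prod.sum[of p free_algebra I K q] by simp

lemma ideal_prod_free_algebra_prod:
  "p \<in> I \<Longrightarrow> q \<in> K \<Longrightarrow> p * q \<in> I \<cdot>\<^bsub>free_algebra\<^esub> K"
  using ideal_prod.prod[of p I q K free_algebra] by simp

text \<open>A word of length at least \<open>n + 1\<close> is a word of length at least \<open>n\<close> times its last letter.\<close>

lemma ideal_power_free_algebra:
  "ideal_power free_algebra (aug_ideal free_algebra) n =
    (min_length n :: ('x word \<Rightarrow>\<^sub>0 'k::field) set)"
proof (induction n)
  case (Suc n)
  have "p \<in> min_length (Suc n)" if "p \<in> min_length n \<cdot>\<^bsub>free_algebra\<^esub> min_length 1"
    for p :: "'x word \<Rightarrow>\<^sub>0 'k"
    using that
  proof (induction rule: ideal_prod.induct)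
    case (prod i j)
    then show ?case using min_length_mult[of i n j 1] by simp
  qed (simp add: min_length_add)
  moreover have "p \<in> min_length n \<cdot>\<^bsub>free_algebra\<^esub> min_length 1" if "p \<in> min_length (Suc n)"
    for p :: "'x word \<Rightarrow>\<^sub>0 'k"
    using that
  proof (induction rule: min_length_induct)
    case (single w c)
    have "letters w \<noteq> []"
      using single by auto
    then obtain ws g where ws: "letters w = ws @ [g]"
      by (meson rev_exhaust)
    then have w: "w = Word (ws @ [g])"
      by (cases w) simp
    have "Poly_Mapping.single (Word ws) c \<in> min_length n"
      using single ws by (auto simp: min_length_def)
    then show ?case
      unfolding w single_Word_snoc by (rule ideal_prod_free_algebra_prod[OF _ min_length_gen])
  qed (rule ideal_prod_free_algebra_sum)
  ultimately show ?case
    unfolding ideal_power.simps Suc unfolding aug_ideal_free_algebra by blast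
qed (simp add: min_length_def)

lemma ideal_vimage_hom_ext:
  assumes "ideal K (free_algebra :: ('k::field, 'y word \<Rightarrow>\<^sub>0 'k) aug_algebra)"
  shows "ideal {p. free.hom_ext \<phi> p \<in> K} (free_algebra :: ('k, 'x word \<Rightarrow>\<^sub>0 'k) aug_algebra)"
  using assms by (simp add: ideal_free_algebra_iff free.hom_ext_simps)

text \<open>Congruence modulo an ideal, so that computations in a quotient can be written as calculations
  with elements of the free algebra.\<close>

definition cong_ideal :: "('x word \<Rightarrow>\<^sub>0 'k::field) set \<Rightarrow> ('x word \<Rightarrow>\<^sub>0 'k) \<Rightarrow> ('x word \<Rightarrow>\<^sub>0 'k) \<Rightarrow> bool"
  where "cong_ideal K p q \<longleftrightarrow> p - q \<in> K"

locale free_ideal =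
  fixes K :: "('x word \<Rightarrow>\<^sub>0 'k::field) set"
  assumes ideal: "ideal K (free_algebra :: ('k, 'x word \<Rightarrow>\<^sub>0 'k) aug_algebra)"
begin

lemma zero: "0 \<in> K" and add: "p \<in> K \<Longrightarrow> q \<in> K \<Longrightarrow> p + q \<in> K"
  and lmult: "p \<in> K \<Longrightarrow> q * p \<in> K" and rmult: "p \<in> K \<Longrightarrow> p * q \<in> K"
  using ideal by (auto simp: ideal_free_algebra_iff)

lemmas uminus = ideal_uminus[OF ideal] and diff = ideal_diff[OF ideal]

lemma sum: "(\<And>x. x \<in> X \<Longrightarrow> f x \<in> K) \<Longrightarrow> sum f X \<in> K"
  by (induction X rule: infinite_finite_induct) (auto intro: zero add)

lemma cong_refl [simp]: "cong_ideal K p p"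
  by (simp add: cong_ideal_def zero)

lemma cong_sym: "cong_ideal K p q \<Longrightarrow> cong_ideal K q p"
  unfolding cong_ideal_def using uminus by fastforce

lemma cong_trans [trans]: "cong_ideal K p q \<Longrightarrow> cong_ideal K q r \<Longrightarrow> cong_ideal K p r"
  unfolding cong_ideal_def using add by fastforce

lemma cong_add: "cong_ideal K p p' \<Longrightarrow> cong_ideal K q q' \<Longrightarrow> cong_ideal K (p + q) (p' + q')"
  unfolding cong_ideal_def using add[of "p - p'" "q - q'"] by (simp add: algebra_simps)

lemma cong_diff: "cong_ideal K p p' \<Longrightarrow> cong_ideal K q q' \<Longrightarrow> cong_ideal K (p - q) (p' - q')"
  unfolding cong_ideal_def using diff[of "p - p'" "q - q'"] by (simp add: algebra_simps)

lemma cong_mult: "cong_ideal K p p' \<Longrightarrow> cong_ideal K q q' \<Longrightarrow> cong_ideal K (p * q) (p' * q')"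
  unfolding cong_ideal_def using add[OF rmult[of "p - p'" q] lmult[of "q - q'" p']]
  by (simp add: algebra_simps)

lemma cong_lmult: "cong_ideal K q q' \<Longrightarrow> cong_ideal K (p * q) (p * q')"
  by (rule cong_mult) simp_all

lemma cong_rmult: "cong_ideal K p p' \<Longrightarrow> cong_ideal K (p * q) (p' * q)"
  by (rule cong_mult) simp_all

lemma cong_hom_ext:
  assumes "\<And>g. cong_ideal K (free.hom_ext \<phi> (gen g)) (free.hom_ext \<psi> (gen g))"
  shows "cong_ideal K (free.hom_ext \<phi> p) (free.hom_ext \<psi> p)"
  using assms
  by (induction p rule: free_algebra_induct) (auto simp: free.hom_ext_simps intro: cong_add cong_mult)

end

definition ideal_sum ::
  "('x word \<Rightarrow>\<^sub>0 'k::field) set \<Rightarrow> ('x word \<Rightarrow>\<^sub>0 'k) set \<Rightarrow> ('x word \<Rightarrow>\<^sub>0 'k) set" where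
  "ideal_sum I L = {p + q | p q. p \<in> I \<and> q \<in> L}"

lemma ideal_ideal_sum:
  fixes I L :: "('x word \<Rightarrow>\<^sub>0 'k::field) set"
  assumes "ideal I free_algebra" "ideal L free_algebra"
  shows "ideal (ideal_sum I L) free_algebra"
proof -
  interpret I: free_ideal I by (rule free_ideal.intro[OF assms(1)])
  interpret L: free_ideal L by (rule free_ideal.intro[OF assms(2)])
  show ?thesis
    unfolding ideal_free_algebra_iff
  proof (intro conjI ballI allI)
    show "0 \<in> ideal_sum I L" unfolding ideal_sum_def using I.zero L.zero by force
  next
    fix x y :: "'x word \<Rightarrow>\<^sub>0 'k" assume "x \<in> ideal_sum I L" "y \<in> ideal_sum I L"
    then obtain p q p' q' where "x = p + q" "y = p' + q'" "p \<in> I" "p' \<in> I" "q \<in> L" "q' \<in> L"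
      unfolding ideal_sum_def by blast
    moreover from this have "x + y = (p + p') + (q + q')" by simp
    ultimately show "x + y \<in> ideal_sum I L" unfolding ideal_sum_def using I.add L.add by blast
  next
    fix x r :: "'x word \<Rightarrow>\<^sub>0 'k" assume "x \<in> ideal_sum I L"
    then obtain p q where "x = p + q" "p \<in> I" "q \<in> L" unfolding ideal_sum_def by blast
    then show "r * x \<in> ideal_sum I L" "x * r \<in> ideal_sum I L" unfolding ideal_sum_def
      using I.lmult L.lmult I.rmult L.rmult by (force simp: distrib_left distrib_right)+
  qed
qed

section \<open>A triangular representation detecting the relators\<close>

text \<open>Upper triangular matrices of size three whose first and last diagonal entries agree:
  rows \<open>(e, u, l)\<close>, \<open>(0, t, v)\<close>, \<open>(0, 0, e)\<close>.\<close>

datatype 'r tri = Tri (tri_e: 'r) (tri_u: 'r) (tri_l: 'r) (tri_t: 'r) (tri_v: 'r)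

instantiation tri :: (comm_ring_1) ring_1
begin

definition "0 = Tri 0 0 0 0 0"
definition "1 = Tri 1 0 0 1 0"
definition "M + N = Tri (tri_e M + tri_e N) (tri_u M + tri_u N) (tri_l M + tri_l N)
  (tri_t M + tri_t N) (tri_v M + tri_v N)"
definition "M - N = Tri (tri_e M - tri_e N) (tri_u M - tri_u N) (tri_l M - tri_l N)
  (tri_t M - tri_t N) (tri_v M - tri_v N)"
definition "- M = Tri (- tri_e M) (- tri_u M) (- tri_l M) (- tri_t M) (- tri_v M)"
definition "M * N = Tri (tri_e M * tri_e N) (tri_e M * tri_u N + tri_u M * tri_t N)
  (tri_e M * tri_l N + tri_u M * tri_v N + tri_l M * tri_e N)
  (tri_t M * tri_t N) (tri_t M * tri_v N + tri_v M * tri_e N)"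

instance
  by standard
    (simp_all add: zero_tri_def one_tri_def plus_tri_def minus_tri_def uminus_tri_def
      times_tri_def algebra_simps)

end

definition tri_scalar :: "'k::field \<Rightarrow> (nat \<Rightarrow>\<^sub>0 'k) tri" where
  "tri_scalar c = Tri (const c) 0 0 (const c) 0"

interpretation tri: central_scalars "tri_scalar :: 'k::field \<Rightarrow> _"
  by standard
    (simp_all add: tri_scalar_def plus_tri_def times_tri_def one_tri_def single_add mult_single
      mult.commute)

text \<open>The representation can be read as an automaton that processes a word from left to right.  It
  waits in the first state, where every generator acts as by the augmentation; the factor \<open>1 + d\<close>
  may start a relator and move to the second state; there only \<open>x\<close> survives and is counted by
  \<open>z\<close>; finally \<open>1 + y\<close> moves to the third state, where again everything acts as by the
  augmentation.  In the second state the factors \<open>1 + a\<close>, \<open>1 + c\<close>, \<open>1 + d\<close> act as zero.  So the corner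
  entry collects the subwords \<open>(1 + d) x\<^sup>l (1 + y)\<close>, up to sign.\<close>

fun tri_gen :: "gens6 \<Rightarrow> (nat \<Rightarrow>\<^sub>0 'k::field) tri" where
  "tri_gen (Incl Ga) = Tri 0 0 0 (-1) 0"
| "tri_gen (Incl Gb) = 0"
| "tri_gen (Incl Gc) = Tri 0 0 0 (-1) 0"
| "tri_gen (Incl Gd) = Tri 0 (-1) 0 (-1) 0"
| "tri_gen Gx = Tri 0 0 0 (Poly_Mapping.single 1 1) 0"
| "tri_gen Gy = Tri 0 0 0 (-1) 1"

text \<open>On the relation ideal this is the functional dual to the relators: the coefficient of \<open>z\<^sup>l\<close> is
  the coordinate at \<open>w\<^sub>l\<close>.\<close>

definition relator_coord :: "'k::field P \<Rightarrow> nat \<Rightarrow>\<^sub>0 'k" where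
  "relator_coord p = tri_l (tri.hom_ext tri_gen p)"

lemma tri_sel:
  "tri_e (M + N) = tri_e M + tri_e N" "tri_l (M + N) = tri_l M + tri_l N"
  "tri_e (M * N) = tri_e M * tri_e N"
  "tri_l (M * N) = tri_e M * tri_l N + tri_u M * tri_v N + tri_l M * tri_e N"
  "tri_e (tri_scalar c) = const c" "tri_u (tri_scalar c) = 0" "tri_l (tri_scalar c) = 0"
  by (simp_all add: plus_tri_def times_tri_def tri_scalar_def)

lemma relator_coord_add: "relator_coord (p + q) = relator_coord p + relator_coord q"
  by (simp add: relator_coord_def tri.hom_ext_add tri_sel)

lemma relator_coord_const: "relator_coord (const c * p) = const c * relator_coord p"
  by (simp add: relator_coord_def tri.hom_ext_simps tri_sel)

lemma tri_e_hom_ext: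
  fixes p :: "'k::field P"
  shows "tri_e (tri.hom_ext tri_gen p) = const (counit p)"
proof (induction p rule: free_algebra_induct)
  case (gen g p)
  have "tri_e (tri_gen g :: (nat \<Rightarrow>\<^sub>0 'k) tri) = 0"
    by (cases g rule: tri_gen.cases) (simp_all add: zero_tri_def)
  then show ?case by (simp add: tri.hom_ext_simps tri_sel counit_mult)
qed (simp_all add: tri.hom_ext_simps tri_sel lookup_add single_add)

text \<open>Multiplying a corner matrix by any matrix only multiplies the corner by the diagonal entry \<open>e\<close>.
  For the representation above that entry is the augmentation, and this is why
  \<open>relator_coord\<close> vanishes on products of the relation ideal with the augmentation ideal.\<close>

definition corner :: "(nat \<Rightarrow>\<^sub>0 'k::field) tri set" where
  "corner = {Tri 0 0 r 0 0 | r. True}"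

text \<open>\<open>(1 + d) x\<^sup>l (1 + y)\<close> has diagonal \<open>(0\<^sup>l, 0, 0\<^sup>l)\<close> and corner \<open>-z\<^sup>l\<close>, while
  \<open>(1 + a) b\<^sup>l (1 + c)\<close> has the same diagonal and corner \<open>0\<close>.\<close>

lemma tri_rel_w: "tri.hom_ext tri_gen (rel_w l :: 'k::field P) = Tri 0 0 (Poly_Mapping.single l 1) 0 0"
proof -
  let ?z = "Poly_Mapping.single 1 1 :: nat \<Rightarrow>\<^sub>0 'k"
  have pow: "(Tri 0 0 0 r 0) ^ l = Tri (0 ^ l) 0 0 (r ^ l) 0" for r :: "nat \<Rightarrow>\<^sub>0 'k"
    by (induction l) (simp_all add: one_tri_def times_tri_def)
  have z: "?z ^ l = Poly_Mapping.single l 1"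
    by (induction l) (simp_all add: mult_single)
  have b: "(tri_gen (Incl Gb) :: (nat \<Rightarrow>\<^sub>0 'k) tri) ^ l = Tri (0 ^ l) 0 0 (0 ^ l) 0"
    using pow[of 0] by (simp add: zero_tri_def)
  show ?thesis
    unfolding rel_w_def tri.hom_ext_simps b unfolding tri_gen.simps pow z
    by (simp add: one_tri_def plus_tri_def times_tri_def minus_tri_def)
qed

lemma relator_coord_rel_w: "relator_coord (rel_w l) = Poly_Mapping.single l 1"
  by (simp add: relator_coord_def tri_rel_w)

lemma tri_ideal_J_w:
  assumes "p \<in> Idl\<^bsub>free_algebra\<^esub> (range rel_w)"
  shows "tri.hom_ext tri_gen p \<in> corner"
  using assms
proof (induction rule: genideal_induct)
  case (base s)
  then show ?case by (auto simp: tri_rel_w corner_def)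
qed (auto simp: corner_def tri.hom_ext_simps plus_tri_def times_tri_def zero_tri_def)

text \<open>These interpolate between \<open>e\<^sub>l\<close> and \<open>w\<^sub>l\<close> and satisfy a recursion of Pascal type, so that the
  two families generate the same ideal.\<close>

definition rel_mixed :: "nat \<Rightarrow> nat \<Rightarrow> 'k::field P" where
  "rel_mixed i j = (1 + Pa) * ((1 + Pb) ^ i * Pb ^ j) * (1 + Pc) - (1 + Pd) * ((1 + Px) ^ i * Px ^ j) * (1 + Py)"

lemma rel_mixed_Suc: "rel_mixed i (Suc j) = rel_mixed (Suc i) j - rel_mixed i j"
proof -
  have *: "(1 + p) ^ i * p ^ Suc j = (1 + p) ^ Suc i * p ^ j - (1 + p) ^ i * p ^ j" for p :: "'a P"
  proof -
    have "(1 + p) ^ Suc i * p ^ j = (1 + p) ^ i * ((1 + p) * p ^ j)"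
      by (simp only: power_Suc2 mult.assoc)
    then show ?thesis by (simp add: distrib_right distrib_left)
  qed
  show ?thesis unfolding rel_mixed_def * by (simp add: algebra_simps)
qed

lemma rel_mixed_0: "rel_mixed i 0 = rel_e i" "rel_mixed 0 j = rel_w j"
  by (simp_all add: rel_mixed_def rel_e_def rel_w_def mult.assoc)

lemma rel_w_0: "rel_w 0 = rel_e 0"
  by (simp add: rel_w_def rel_e_def)

lemma rel_w_1: "rel_w 1 = rel_e 1 - rel_e 0"
  using rel_mixed_Suc[of 0 0] unfolding rel_mixed_0 One_nat_def .

lemma ideal_J_eq_rel_w: "ideal_J = Idl\<^bsub>free_algebra\<^esub> (range (rel_w :: nat \<Rightarrow> 'k::field P))"
proof
  interpret Je: free_ideal "ideal_J :: 'k P set"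
    unfolding ideal_J_def by (rule free_ideal.intro[OF ideal_genideal])
  let ?Jw = "Idl\<^bsub>free_algebra\<^esub> (range (rel_w :: nat \<Rightarrow> 'k P))"
  interpret Jw: free_ideal ?Jw
    by (rule free_ideal.intro[OF ideal_genideal])
  have "(rel_mixed i j :: 'k P) \<in> ?Jw" for i j
  proof (induction i arbitrary: j)
    case 0
    show ?case by (auto simp: rel_mixed_0 intro: genideal_base)
  next
    case (Suc i)
    have "rel_mixed (Suc i) j = (rel_mixed i (Suc j) + rel_mixed i j :: 'k P)"
      by (simp add: rel_mixed_Suc)
    with Suc Jw.add show ?case by simp
  qed
  from this[of _ 0] show "ideal_J \<subseteq> ?Jw"
    unfolding ideal_J_def by (intro genideal_least ideal_genideal) (auto simp: rel_mixed_0)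
  have "(rel_mixed i j :: 'k P) \<in> ideal_J" for i j
  proof (induction j arbitrary: i)
    case 0
    show ?case by (auto simp: rel_mixed_0 ideal_J_def intro: genideal_base)
  next
    case (Suc j)
    then show ?case using Je.diff by (simp add: rel_mixed_Suc)
  qed
  from this[of 0] show "?Jw \<subseteq> ideal_J"
    by (intro genideal_least Je.ideal) (auto simp: rel_mixed_0)
qed

interpretation J: free_ideal "ideal_J :: 'k::field P set"
  unfolding ideal_J_def by (rule free_ideal.intro[OF ideal_genideal])

interpretation J0: free_ideal "ideal_J0 :: 'k::field P set"
  unfolding ideal_J0_def by (rule free_ideal.intro[OF ideal_genideal])

lemma rel_w_in_J: "rel_w l \<in> ideal_J"
  by (auto simp: ideal_J_eq_rel_w intro: genideal_base)

lemma rel_w_in_J0: "rel_w 0 \<in> (ideal_J0 :: 'k::field P set)" "rel_w 1 \<in> (ideal_J0 :: 'k::field P set)"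
proof -
  have "rel_e 0 \<in> (ideal_J0 :: 'k P set)" "rel_e 1 \<in> (ideal_J0 :: 'k P set)"
    by (auto simp: ideal_J0_def intro: genideal_base)
  then show "rel_w 0 \<in> (ideal_J0 :: 'k P set)" "rel_w 1 \<in> (ideal_J0 :: 'k P set)"
    unfolding rel_w_0 rel_w_1 by (simp_all add: J0.diff del: One_nat_def)
qed

lemma J0_subset_J: "ideal_J0 \<subseteq> ideal_J"
  unfolding ideal_J0_def
  by (rule genideal_least[OF J.ideal]) (auto simp: ideal_J_def intro: genideal_base)

lemma
  assumes "j \<in> ideal_J"
  shows relator_coord_lmult: "relator_coord (p * j) = const (counit p) * relator_coord j"
    and relator_coord_rmult: "relator_coord (j * p) = const (counit p) * relator_coord j"
proof -
  obtain r where r: "tri.hom_ext tri_gen j = Tri 0 0 r 0 0"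
    using tri_ideal_J_w[of j] assms by (auto simp: ideal_J_eq_rel_w corner_def)
  show "relator_coord (p * j) = const (counit p) * relator_coord j" "relator_coord (j * p) = const (counit p) * relator_coord j"
    unfolding relator_coord_def tri.hom_ext_mult r tri_sel by (simp_all add: tri_e_hom_ext mult.commute)
qed

lemma relator_coord_J0:
  assumes "j \<in> ideal_J0" "l \<ge> 2"
  shows "Poly_Mapping.lookup (relator_coord j) l = 0"
proof -
  have w: "rel_e 0 = rel_w 0" "rel_e 1 = rel_w 1 + rel_w 0"
    by (simp_all add: rel_w_0 rel_w_1 del: One_nat_def)
  show ?thesis
    using assms(1) unfolding ideal_J0_def
  proof (induction rule: genideal_induct)
    case (base s)
    then show ?case using assms(2)
      by (auto simp: w relator_coord_add relator_coord_rel_w lookup_add lookup_single lookup_one when_def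
          simp del: One_nat_def)
  next
    case (lmult p q)
    then have "p \<in> ideal_J" using J0_subset_J unfolding ideal_J0_def by blast
    with lmult show ?case by (simp add: relator_coord_lmult)
  next
    case (rmult p q)
    then have "p \<in> ideal_J" using J0_subset_J unfolding ideal_J0_def by blast
    with rmult show ?case by (simp add: relator_coord_rmult)
  qed (simp_all add: relator_coord_def tri.hom_ext_zero zero_tri_def relator_coord_add[unfolded relator_coord_def] lookup_add)
qed

lemma counit_rel_w: "counit (rel_w l) = 0"
  by (cases l) (simp_all add: rel_w_def counit_mult lookup_add lookup_minus counit_power)

lemma J_subset_augmentation: "ideal_J \<subseteq> min_length 1"
  unfolding ideal_J_eq_rel_w
  by (rule genideal_least[OF ideal_min_length]) (auto simp: min_length_1_iff counit_rel_w simp del: One_nat_def)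

section \<open>The relation ideal modulo its decomposable elements\<close>

definition decomposables :: "('x word \<Rightarrow>\<^sub>0 'k::field) set \<Rightarrow> ('x word \<Rightarrow>\<^sub>0 'k) set" where
  "decomposables K = ideal_sum (min_length 1 \<cdot>\<^bsub>free_algebra\<^esub> K) (K \<cdot>\<^bsub>free_algebra\<^esub> min_length 1)"

lemma ideal_ideal_prod:
  assumes "ideal K free_algebra" "ideal L free_algebra"
  shows "ideal (K \<cdot>\<^bsub>free_algebra\<^esub> L) free_algebra"
  by (rule ring.ideal_prod_is_ideal[OF ring_free_algebra assms])

lemma ideal_decomposables:
  assumes "ideal K free_algebra"
  shows "ideal (decomposables K) free_algebra"
  unfolding decomposables_def
  by (intro ideal_ideal_sum ideal_ideal_prod assms ideal_min_length)

lemma decomposablesI: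
  assumes "ideal K free_algebra" "p \<in> min_length 1" "j \<in> K"
  shows "p * j \<in> decomposables K" "j * p \<in> decomposables K"
proof -
  note ids = ideal_ideal_prod[OF ideal_min_length[of 1] assms(1)] ideal_ideal_prod[OF assms(1) ideal_min_length[of 1]]
  then have "0 \<in> min_length 1 \<cdot>\<^bsub>free_algebra\<^esub> K" "0 \<in> K \<cdot>\<^bsub>free_algebra\<^esub> min_length 1"
    by (simp_all add: ideal_free_algebra_iff)
  moreover have "p * j \<in> min_length 1 \<cdot>\<^bsub>free_algebra\<^esub> K" "j * p \<in> K \<cdot>\<^bsub>free_algebra\<^esub> min_length 1"
    using assms by (auto intro: ideal_prod_free_algebra_prod)
  ultimately show "p * j \<in> decomposables K" "j * p \<in> decomposables K"
    unfolding decomposables_def ideal_sum_def by force+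
qed

lemma decomposables_induct [consumes 1, case_names lmult rmult add]:
  assumes "x \<in> decomposables K"
    and l: "\<And>p j. p \<in> min_length 1 \<Longrightarrow> j \<in> K \<Longrightarrow> Q (p * j)"
    and r: "\<And>p j. p \<in> min_length 1 \<Longrightarrow> j \<in> K \<Longrightarrow> Q (j * p)"
    and add: "\<And>p q. Q p \<Longrightarrow> Q q \<Longrightarrow> Q (p + q)"
  shows "Q x"
proof -
  have "Q p" if "p \<in> min_length 1 \<cdot>\<^bsub>free_algebra\<^esub> K" for p
    using that by (induction rule: ideal_prod.induct) (auto intro: l add)
  moreover have "Q p" if "p \<in> K \<cdot>\<^bsub>free_algebra\<^esub> min_length 1" for p
    using that by (induction rule: ideal_prod.induct) (auto intro: r add)
  ultimately show ?thesis using assms(1) add unfolding decomposables_def ideal_sum_def by blast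
qed

lemma split_augmentation:
  "p - const (counit p) \<in> min_length 1"
  by (simp add: min_length_1_iff lookup_minus del: One_nat_def)

text \<open>Modulo \<open>IK + KI\<close> the algebra acts on \<open>K\<close> from both sides through the augmentation.\<close>

lemma decomposables_cong:
  assumes K: "ideal K free_algebra" and j: "j \<in> K"
  shows "p * j - const (counit p) * j \<in> decomposables K" "j * p - const (counit p) * j \<in> decomposables K"
  using decomposablesI[OF K split_augmentation[of p] j]
  by (simp_all add: algebra_simps const_commute)

text \<open>The section of \<open>relator_coord\<close> given by the relators.\<close>

definition w_comb :: "(nat \<Rightarrow>\<^sub>0 'k) \<Rightarrow> 'k::field P" where
  "w_comb = free.lin_ext rel_w"

lemma w_comb_add: "w_comb (r + s) = w_comb r + w_comb s"
  and w_comb_single: "w_comb (Poly_Mapping.single l c) = const c * rel_w l"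
  and w_comb_const: "w_comb (const c * r) = const c * w_comb r"
  unfolding w_comb_def by (simp_all add: free.lin_ext_add free.lin_ext_single free.lin_ext_smult
    flip: mult_map_scale_conv_mult)

lemma relator_coord_zero [simp]: "relator_coord 0 = 0"
  by (simp add: relator_coord_def tri.hom_ext_zero zero_tri_def)

lemma w_comb_in_J: "w_comb r \<in> ideal_J"
  by (induction r rule: poly_mapping_single_induct)
    (auto simp: w_comb_add w_comb_single intro: J.add J.lmult rel_w_in_J)

lemma relator_coord_w_comb: "relator_coord (w_comb r) = r"
  by (induction r rule: poly_mapping_single_induct)
    (auto simp: w_comb_add w_comb_single relator_coord_add relator_coord_const relator_coord_rel_w mult_single)

text \<open>Both sides are linear and behave in the same way under multiplication by elements of the algebra,
  so it is enough to compare them on the generators \<open>w\<^sub>l\<close>.  Together with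
  \<open>relator_coord_decomposables\<close> this says that \<open>relator_coord\<close> identifies \<open>J/(IJ + JI)\<close> with the
  polynomials.\<close>

lemma J_mod_decomposables:
  assumes "j \<in> ideal_J"
  shows "j - w_comb (relator_coord j) \<in> decomposables ideal_J"
proof -
  let ?D = "decomposables ideal_J"
  interpret D: free_ideal ?D
    by (rule free_ideal.intro[OF ideal_decomposables[OF J.ideal]])
  show ?thesis
    using assms unfolding ideal_J_eq_rel_w
  proof (induction rule: genideal_induct)
    case zero
    show ?case using D.zero by (simp add: w_comb_def free.lin_ext_zero flip: ideal_J_eq_rel_w)
  next
    case (base s)
    then show ?case using D.zero by (auto simp: relator_coord_rel_w w_comb_single simp flip: ideal_J_eq_rel_w)
  next
    case (add p q)
    then show ?case using D.add[of "p - w_comb (relator_coord p)" "q - w_comb (relator_coord q)"]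
      by (simp add: relator_coord_add w_comb_add algebra_simps flip: ideal_J_eq_rel_w)
  next
    case (lmult p q)
    then have p: "p \<in> ideal_J" by (simp add: ideal_J_eq_rel_w)
    have "q * p - w_comb (relator_coord (q * p)) =
        (q * p - const (counit q) * p) + const (counit q) * (p - w_comb (relator_coord p))"
      unfolding relator_coord_lmult[OF p] w_comb_const by (simp add: right_diff_distrib)
    then show ?case
      using D.add[OF decomposables_cong(1)[OF J.ideal p, of q] D.lmult[of "p - w_comb (relator_coord p)" "const (counit q)"]]
        lmult(2) by (simp only: ideal_J_eq_rel_w[symmetric])
  next
    case (rmult p q)
    then have p: "p \<in> ideal_J" by (simp add: ideal_J_eq_rel_w)
    have "p * q - w_comb (relator_coord (p * q)) =
        (p * q - const (counit q) * p) + const (counit q) * (p - w_comb (relator_coord p))"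
      unfolding relator_coord_rmult[OF p] w_comb_const by (simp add: right_diff_distrib)
    then show ?case
      using D.add[OF decomposables_cong(2)[OF J.ideal p, of q] D.lmult[of "p - w_comb (relator_coord p)" "const (counit q)"]]
        rmult(2) by (simp only: ideal_J_eq_rel_w[symmetric])
  qed
qed

lemma relator_coord_decomposables: "x \<in> decomposables ideal_J \<Longrightarrow> relator_coord x = 0"
  by (induction rule: decomposables_induct)
    (auto simp: relator_coord_lmult relator_coord_rmult relator_coord_add min_length_1_iff simp del: One_nat_def)

lemma decomposables_min_length_2:
  assumes "K \<subseteq> min_length 1" "x \<in> decomposables K"
  shows "x \<in> min_length 2"
  using assms(2)
proof (induction rule: decomposables_induct)
  case (lmult p j)
  then show ?case using assms(1) min_length_mult[of p 1 j 1] by (auto simp: numeral_2_eq_2)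
next
  case (rmult p j)
  then show ?case using assms(1) min_length_mult[of j 1 p 1] by (auto simp: numeral_2_eq_2)
qed (simp add: min_length_add)

lemma rel_w_min_length_2:
  assumes "l \<ge> 2" shows "rel_w l \<in> min_length 2"
proof -
  have "gen g ^ l \<in> min_length 2" for g :: gens6
    using min_length_power[OF min_length_gen, of g l] assms by (auto intro: min_length_mono)
  then show ?thesis unfolding rel_w_def
    by (intro min_length_diff min_length_lmult min_length_rmult)
qed

lemma rel_w_linear_part:
  "Poly_Mapping.lookup (rel_w 0 :: 'k::field P) (Word [Incl Ga]) = 1" "Poly_Mapping.lookup (rel_w 0 :: 'k::field P) (Word [Incl Gb]) = 0"
  "Poly_Mapping.lookup (rel_w 1 :: 'k::field P) (Word [Incl Ga]) = 0" "Poly_Mapping.lookup (rel_w 1 :: 'k::field P) (Word [Incl Gb]) = 1"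
  by (simp_all add: rel_w_def algebra_simps gen_def mult_single plus_word_def lookup_add lookup_minus
      lookup_single lookup_one zero_word_def when_def)

lemma lookup_min_length: "p \<in> min_length n \<Longrightarrow> length (letters w) < n \<Longrightarrow> Poly_Mapping.lookup p w = 0"
  by (rule ccontr) (auto simp: min_length_def in_keys_iff not_less[symmetric])

text \<open>Among the relators only \<open>w\<^sub>0 = a + c - d - y + \<dots>\<close> and \<open>w\<^sub>1 = b - x + \<dots>\<close> have linear terms; the
  coefficients at \<open>a\<close> and \<open>b\<close> tell them apart.\<close>

lemma lookup_w_comb:
  fixes r :: "nat \<Rightarrow>\<^sub>0 'k::field"
  shows "Poly_Mapping.lookup (w_comb r) (Word [Incl Ga]) = Poly_Mapping.lookup r 0"
    and "Poly_Mapping.lookup (w_comb r) (Word [Incl Gb]) = Poly_Mapping.lookup r 1"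
proof -
  have 2: "Poly_Mapping.lookup (rel_w l :: 'k P) (Word [g]) = 0" if "l \<ge> 2" for l g
    using rel_w_min_length_2[OF that, where 'a='k]
    by (rule lookup_min_length) simp
  have w: "Poly_Mapping.lookup (rel_w l :: 'k P) (Word [Incl Ga]) = (if l = 0 then 1 else 0)"
    "Poly_Mapping.lookup (rel_w l :: 'k P) (Word [Incl Gb]) = (if l = 1 then 1 else 0)" for l
    using rel_w_linear_part[where 'k='k] 2[of l] by (cases "l = 0"; cases "l = 1"; simp)+
  show "Poly_Mapping.lookup (w_comb r) (Word [Incl Ga]) = Poly_Mapping.lookup r 0"
    "Poly_Mapping.lookup (w_comb r) (Word [Incl Gb]) = Poly_Mapping.lookup r 1"
    by (induction r rule: poly_mapping_single_induct)
      (auto simp: w_comb_add w_comb_single lookup_add lookup_single w when_def simp del: One_nat_def)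
qed

text \<open>This is \<open>(J \<inter> I\<^sup>2)/(IJ + JI)\<close> in coordinates: an element of \<open>J\<close> lies in \<open>I\<^sup>2\<close> exactly if
  its coordinates at \<open>w\<^sub>0\<close> and \<open>w\<^sub>1\<close> vanish.\<close>

lemma relator_coord_image_J_I2:
  "relator_coord ` (ideal_J \<inter> min_length 2) = {r. Poly_Mapping.keys r \<subseteq> {2..}}"
proof (intro equalityI subsetI)
  interpret min_length_2: free_ideal "min_length 2 :: 'a P set"
    by (rule free_ideal.intro[OF ideal_min_length])
  fix r :: "nat \<Rightarrow>\<^sub>0 'a" assume "r \<in> {r. Poly_Mapping.keys r \<subseteq> {2..}}"
  then have r: "l \<ge> 2" if "Poly_Mapping.lookup r l \<noteq> 0" for l
    using that by (auto simp: in_keys_iff subset_iff)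
  have "w_comb r \<in> min_length 2"
    unfolding w_comb_def free.lin_ext_def
    using r by (intro min_length_2.sum min_length_2.lmult rel_w_min_length_2) (simp add: in_keys_iff)
  then show "r \<in> relator_coord ` (ideal_J \<inter> min_length 2)"
    using relator_coord_w_comb w_comb_in_J by (metis IntI imageI)
next
  fix r :: "nat \<Rightarrow>\<^sub>0 'a" assume "r \<in> relator_coord ` (ideal_J \<inter> min_length 2)"
  then obtain j where j: "j \<in> ideal_J" "j \<in> min_length 2" "r = relator_coord j" by blast
  have "j - (j - w_comb r) \<in> min_length 2"
    unfolding j(3)
    by (rule min_length_diff[OF j(2) decomposables_min_length_2[OF J_subset_augmentation
        J_mod_decomposables[OF j(1)]]])
  then have "w_comb r \<in> min_length 2" by simp
  then have "Poly_Mapping.lookup (w_comb r) (Word [g]) = 0" for g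
    by (rule lookup_min_length) simp
  then have r: "Poly_Mapping.lookup r 0 = 0" "Poly_Mapping.lookup r 1 = 0"
    using lookup_w_comb[of r] by simp_all
  have "l \<ge> 2" if "Poly_Mapping.lookup r l \<noteq> 0" for l
    using r that by (cases "l = 0"; cases "l = 1"; auto)
  then show "r \<in> {r. Poly_Mapping.keys r \<subseteq> {2..}}"
    by (auto simp: in_keys_iff)
qed

section \<open>Inverting the canonical map modulo powers of the augmentation ideal\<close>

text \<open>The truncated geometric series, an inverse of \<open>1 + u\<close> up to \<open>u\<^sup>n\<close>.\<close>

definition geom :: "'a::ring_1 \<Rightarrow> nat \<Rightarrow> 'a" where
  "geom u n = (\<Sum>i<n. (- u) ^ i)"

lemma geom_mult: "(1 + u) * geom u n = 1 - (- u) ^ n" "geom u n * (1 + u) = 1 - (- u) ^ n"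
proof (induction n)
  case (Suc n)
  { case 1
    have "(1 + u) * geom u (Suc n) = (1 + u) * geom u n + (1 + u) * (- u) ^ n"
      by (simp add: geom_def distrib_left)
    also have "\<dots> = 1 - (- u) ^ Suc n"
      unfolding Suc by (simp add: distrib_right)
    finally show ?case . }
  { case 2
    have "geom u (Suc n) * (1 + u) = geom u n * (1 + u) + (- u) ^ n * (1 + u)"
      by (simp add: geom_def distrib_right)
    also have "\<dots> = 1 - (- u) ^ Suc n"
      unfolding Suc power_Suc2 by (simp add: distrib_left)
    finally show ?case . }
qed (simp_all add: geom_def)

lemma (in free_ideal) geom_inverse:
  assumes "min_length n \<subseteq> K" "u \<in> min_length 1"
  shows "cong_ideal K ((1 + u) * geom u n) 1" "cong_ideal K (geom u n * (1 + u)) 1"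
  using assms min_length_power[OF min_length_uminus[OF assms(2)], of n] uminus
  by (auto simp: cong_ideal_def geom_mult)

lemma counit_geom:
  assumes "n > 0" shows "counit (geom (gen g) n) = 1"
proof -
  have "counit ((1 + gen g) * geom (gen g) n) = 1"
    using assms by (simp add: geom_mult lookup_minus counit_power)
  then show ?thesis by (simp add: counit_mult lookup_add)
qed

abbreviation "Fa \<equiv> gen Ga"
abbreviation "Fb \<equiv> gen Gb"
abbreviation "Fc \<equiv> gen Gc"
abbreviation "Fd \<equiv> gen Gd"

text \<open>With \<open>g = (1 + d)\<^sup>-\<^sup>1 (1 + a)\<close>, the solution \<open>x = g b g\<^sup>-\<^sup>1\<close>, \<open>1 + y = g (1 + c)\<close> of
  \<open>e\<^sub>0 = e\<^sub>1 = 0\<close>, truncated.\<close>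

fun rho_gen :: "nat \<Rightarrow> gens6 \<Rightarrow> (gens4 word \<Rightarrow>\<^sub>0 'k::field)" where
  "rho_gen n (Incl g) = gen g"
| "rho_gen n Gx = geom Fd n * (1 + Fa) * Fb * (geom Fa n * (1 + Fd))"
| "rho_gen n Gy = geom Fd n * (1 + Fa) * (1 + Fc) - 1"

definition rho :: "nat \<Rightarrow> 'k::field P \<Rightarrow> (gens4 word \<Rightarrow>\<^sub>0 'k)" where
  "rho n = free.hom_ext (rho_gen n)"

definition incl :: "(gens4 word \<Rightarrow>\<^sub>0 'k::field) \<Rightarrow> 'k P" where
  "incl = free.hom_ext (\<lambda>g. gen (Incl g))"

lemma rho_gen_min_length:
  assumes "n > 0" shows "rho_gen n g \<in> min_length 1"
  using assms counit_geom[OF assms]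
  by (cases g) (auto simp: min_length_1_iff counit_mult lookup_add lookup_minus simp del: One_nat_def)

lemma rho_incl: "rho n (incl p) = p"
  unfolding rho_def incl_def by (induction p rule: free_algebra_induct) (simp_all add: free.hom_ext_simps)

text \<open>Modulo words of length \<open>n\<close>, \<open>(1 + g b g\<^sup>-\<^sup>1)\<^sup>l g = g (1 + b)\<^sup>l\<close> and \<open>(1 + d) g = 1 + a\<close>, whence
  \<open>(1 + d)(1 + x)\<^sup>l(1 + y)\<close> goes to \<open>(1 + a)(1 + b)\<^sup>l(1 + c)\<close>.\<close>

lemma rho_rel_e: "rho n (rel_e l) \<in> min_length n"
proof -
  interpret M: free_ideal "min_length n :: (gens4 word \<Rightarrow>\<^sub>0 'a) set"
    by (rule free_ideal.intro[OF ideal_min_length])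
  note ms = mult.assoc
  let ?D = "geom Fd n :: gens4 word \<Rightarrow>\<^sub>0 'a" and ?A = "geom Fa n :: gens4 word \<Rightarrow>\<^sub>0 'a"
  let ?cong = "cong_ideal (min_length n :: (gens4 word \<Rightarrow>\<^sub>0 'a) set)"
  define g where "g = ?D * (1 + Fa)"
  define g' where "g' = ?A * (1 + Fd)"
  have inv: "?cong ((1 + Fd) * ?D) 1" "?cong (?D * (1 + Fd)) 1" "?cong ((1 + Fa) * ?A) 1" "?cong (?A * (1 + Fa)) 1"
    using M.geom_inverse[OF order_refl min_length_gen] by auto
  have "?cong (?A * ((1 + Fd) * ?D) * (1 + Fa)) (?A * 1 * (1 + Fa))"
    by (intro M.cong_rmult M.cong_lmult inv)
  then have g'g: "?cong (g' * g) 1"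
    using inv(4) M.cong_trans by (fastforce simp: g_def g'_def mult.assoc)
  have pow: "?cong ((1 + g * Fb * g') ^ l * g) (g * (1 + Fb) ^ l)"
  proof (induction l)
    case (Suc l)
    have "?cong ((1 + g * Fb * g') ^ Suc l * g) ((1 + g * Fb * g') * (g * (1 + Fb) ^ l))"
      using M.cong_lmult[OF Suc, of "1 + g * Fb * g'"] by (simp add: mult.assoc)
    also have "(1 + g * Fb * g') * (g * (1 + Fb) ^ l) = g * (1 + Fb) ^ l + g * Fb * (g' * g) * (1 + Fb) ^ l"
      by (simp add: distrib_right mult.assoc)
    also have "?cong \<dots> (g * (1 + Fb) ^ l + g * Fb * 1 * (1 + Fb) ^ l)"
      by (intro M.cong_add M.cong_rmult M.cong_lmult g'g M.cong_refl)
    also have "g * (1 + Fb) ^ l + g * Fb * 1 * (1 + Fb) ^ l = g * (1 + Fb) ^ Suc l"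
      by (simp add: algebra_simps)
    finally show ?case .
  qed simp
  have "rho n (rel_e l) = (1 + Fa) * (1 + Fb) ^ l * (1 + Fc) - (1 + Fd) * ((1 + g * Fb * g') ^ l * g) * (1 + Fc)"
    by (simp add: rho_def rel_e_def free.hom_ext_simps g_def g'_def mult.assoc)
  also have "?cong \<dots> ((1 + Fa) * (1 + Fb) ^ l * (1 + Fc) - (1 + Fd) * (g * (1 + Fb) ^ l) * (1 + Fc))"
    by (intro M.cong_diff M.cong_rmult M.cong_lmult pow M.cong_refl)
  also have "\<dots> = (1 + Fa) * (1 + Fb) ^ l * (1 + Fc) - ((1 + Fd) * ?D) * ((1 + Fa) * (1 + Fb) ^ l * (1 + Fc))"
    by (simp add: g_def mult.assoc)
  also have "?cong \<dots> ((1 + Fa) * (1 + Fb) ^ l * (1 + Fc) - 1 * ((1 + Fa) * (1 + Fb) ^ l * (1 + Fc)))"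
    by (intro M.cong_diff M.cong_rmult inv M.cong_refl)
  finally show ?thesis by (simp add: cong_ideal_def)
qed

lemma rho_J: "j \<in> ideal_J \<Longrightarrow> rho n j \<in> min_length n"
proof -
  have "ideal_J \<subseteq> {p. rho n p \<in> min_length n}"
    unfolding ideal_J_def rho_def
    by (rule genideal_least[OF ideal_vimage_hom_ext[OF ideal_min_length]])
       (auto simp: rho_rel_e rho_def[symmetric])
  then show "j \<in> ideal_J \<Longrightarrow> rho n j \<in> min_length n" by blast
qed

definition ideal_J0_plus :: "nat \<Rightarrow> 'k::field P set" where
  "ideal_J0_plus n = ideal_sum ideal_J0 (min_length n)"

lemma ideal_ideal_J0_plus: "ideal (ideal_J0_plus n) free_algebra"
  unfolding ideal_J0_plus_def by (rule ideal_ideal_sum[OF J0.ideal ideal_min_length])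

lemma J0_plus: "ideal_J0 \<subseteq> ideal_J0_plus n" "min_length n \<subseteq> ideal_J0_plus n"
  using J0.zero by (force simp: ideal_J0_plus_def ideal_sum_def)+

text \<open>The equations \<open>w\<^sub>0 = w\<^sub>1 = 0\<close> can be solved for \<open>x\<close> and \<open>y\<close> modulo words of length \<open>n\<close>, where
  \<open>1 + a\<close>, \<open>1 + c\<close> and \<open>1 + d\<close> are invertible.  So \<open>incl \<circ> rho n\<close> and the identity agree on
  generators modulo \<open>J\<^sub>0 + I\<^sup>n\<close>.\<close>

lemma incl_rho: "p - incl (rho n p) \<in> ideal_J0_plus n"
proof -
  interpret K: free_ideal "ideal_J0_plus n :: 'a P set"
    by (rule free_ideal.intro[OF ideal_ideal_J0_plus])
  let ?cong = "cong_ideal (ideal_J0_plus n :: 'a P set)"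
  let ?D = "geom Pd n :: 'a P" and ?A = "geom Pa n :: 'a P" and ?C = "geom Pc n :: 'a P"
  have inv: "?cong ((1 + Pd) * ?D) 1" "?cong (?D * (1 + Pd)) 1" "?cong ((1 + Pa) * ?A) 1"
    "?cong (?A * (1 + Pa)) 1" "?cong ((1 + Pc) * ?C) 1" "?cong (?C * (1 + Pc)) 1"
    using K.geom_inverse[OF J0_plus(2) min_length_gen] by auto
  have inv': "?cong (p * ((1 + Pd) * ?D) * q) (p * q)" "?cong (p * (?D * (1 + Pd)) * q) (p * q)"
     "?cong (p * ((1 + Pa) * ?A) * q) (p * q)" "?cong (p * ((1 + Pc) * ?C) * q) (p * q)" for p q
    using K.cong_rmult[OF K.cong_lmult[OF inv(1)], of p q] K.cong_rmult[OF K.cong_lmult[OF inv(2)], of p q]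
      K.cong_rmult[OF K.cong_lmult[OF inv(3)], of p q] K.cong_rmult[OF K.cong_lmult[OF inv(5)], of p q]
    by simp_all
  have rel: "?cong ((1 + Pa) * (1 + Pc)) ((1 + Pd) * (1 + Py))"
    "?cong ((1 + Pa) * Pb * (1 + Pc)) ((1 + Pd) * Px * (1 + Py))"
    using rel_w_in_J0[where 'k='a] J0_plus(1)[where 'a='a] by (auto simp: cong_ideal_def rel_w_def)
  have y: "?cong (?D * (1 + Pa) * (1 + Pc)) (1 + Py)"
  proof -
    have "?cong (?D * ((1 + Pa) * (1 + Pc))) (?D * ((1 + Pd) * (1 + Py)))"
      by (intro K.cong_lmult rel)
    also have "\<dots> = 1 * (?D * (1 + Pd)) * (1 + Py)" by (simp add: mult.assoc)
    also have "?cong \<dots> (1 * (1 + Py))" by (rule inv')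
    finally show ?thesis by (simp add: mult.assoc)
  qed
  have x: "?cong (?D * (1 + Pa) * Pb * (?A * (1 + Pd))) Px"
  proof -
    have yC: "?cong ((1 + Py) * ?C) (?D * (1 + Pa))"
    proof -
      have "?cong ((1 + Py) * ?C) (?D * (1 + Pa) * (1 + Pc) * ?C)"
        by (intro K.cong_rmult K.cong_sym[OF y])
      also have "\<dots> = ?D * (1 + Pa) * ((1 + Pc) * ?C) * 1" by (simp add: mult.assoc)
      also have "?cong \<dots> (?D * (1 + Pa) * 1)" by (rule inv')
      finally show ?thesis by simp
    qed
    \<comment> \<open>insert \<open>(1 + c)(1 + c)\<^sup>-\<^sup>1\<close> to make the relator \<open>w\<^sub>1\<close> applicable, then cancel from the left\<close>
    have "?cong (?D * (1 + Pa) * Pb * (?A * (1 + Pd))) (?D * (1 + Pa) * Pb * ((1 + Pc) * ?C) * (?A * (1 + Pd)))"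
      by (rule K.cong_sym[OF inv'(4)])
    also have "\<dots> = ?D * ((1 + Pa) * Pb * (1 + Pc)) * (?C * (?A * (1 + Pd)))" by (simp add: mult.assoc)
    also have "?cong \<dots> (?D * ((1 + Pd) * Px * (1 + Py)) * (?C * (?A * (1 + Pd))))"
      by (intro K.cong_lmult K.cong_rmult rel)
    also have "\<dots> = 1 * (?D * (1 + Pd)) * (Px * ((1 + Py) * ?C) * (?A * (1 + Pd)))" by (simp add: mult.assoc)
    also have "?cong \<dots> (1 * (Px * ((1 + Py) * ?C) * (?A * (1 + Pd))))" by (rule inv')
    also have "\<dots> = Px * ((1 + Py) * ?C) * (?A * (1 + Pd))" by simp
    also have "?cong \<dots> (Px * (?D * (1 + Pa)) * (?A * (1 + Pd)))"
      by (intro K.cong_lmult K.cong_rmult yC)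
    also have "\<dots> = Px * ?D * ((1 + Pa) * ?A) * (1 + Pd)" by (simp add: mult.assoc)
    also have "?cong \<dots> (Px * ?D * (1 + Pd))" by (rule inv')
    also have "\<dots> = Px * (?D * (1 + Pd)) * 1" by (simp add: mult.assoc)
    also have "?cong \<dots> (Px * 1)" by (rule inv')
    finally show ?thesis by simp
  qed
  have incl_geom: "incl (geom (gen g) n) = (geom (gen (Incl g)) n :: 'a P)" for g
    by (simp add: incl_def geom_def free.hom_ext_sum free.hom_ext_simps)
  have hom: "incl (rho n q) = free.hom_ext (\<lambda>g. incl (rho n (gen g))) q" for q :: "'a P"
    by (rule hom_ext_unique) (simp_all add: incl_def rho_def free.hom_ext_simps)
  have gens: "?cong (gen g) (incl (rho n (gen g)))" for g
  proof (cases g)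
    case (Incl i)
    then show ?thesis by (simp add: incl_def rho_def free.hom_ext_simps)
  next
    case Gx
    have "incl (rho n Px) = ?D * (1 + Pa) * Pb * (?A * (1 + Pd))"
      using incl_geom by (simp add: incl_def rho_def free.hom_ext_simps)
    with Gx K.cong_sym[OF x] show ?thesis by simp
  next
    case Gy
    have "incl (rho n Py) = ?D * (1 + Pa) * (1 + Pc) - 1"
      using incl_geom by (simp add: incl_def rho_def free.hom_ext_simps)
    moreover have "?cong (1 + Py - 1) (?D * (1 + Pa) * (1 + Pc) - 1)"
      by (intro K.cong_diff K.cong_sym[OF y] K.cong_refl)
    ultimately show ?thesis using Gy by simp
  qed
  have "?cong (free.hom_ext gen p) (free.hom_ext (\<lambda>g. incl (rho n (gen g))) p)"
    by (rule K.cong_hom_ext) (simp add: free.hom_ext_gen gens)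
  then show ?thesis by (simp add: hom_ext_gen_id cong_ideal_def flip: hom)
qed

text \<open>Because \<open>rho n\<close> and \<open>incl\<close> are mutually inverse modulo \<open>J\<^sub>0 + I\<^sup>n\<close> on one side and \<open>n\<close>-th powers
  on the other.\<close>

lemma J0_plus_iff:
  assumes "n > 0" shows "p \<in> ideal_J0_plus n \<longleftrightarrow> rho n p \<in> min_length n"
proof
  assume "p \<in> ideal_J0_plus n"
  then obtain j u where "j \<in> ideal_J0" "u \<in> min_length n" "p = j + u"
    unfolding ideal_J0_plus_def ideal_sum_def by blast
  moreover have "rho n u \<in> min_length n" if "u \<in> min_length n" for u :: "'a P"
    unfolding rho_def using rho_gen_min_length[OF assms] that by (rule hom_ext_min_length)
  ultimately show "rho n p \<in> min_length n"
    using rho_J[of j n] J0_subset_J by (auto simp: rho_def free.hom_ext_add intro!: min_length_add)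
next
  interpret K: free_ideal "ideal_J0_plus n :: 'a P set"
    by (rule free_ideal.intro[OF ideal_ideal_J0_plus])
  assume "rho n p \<in> min_length n"
  then have "incl (rho n p) \<in> min_length n"
    unfolding incl_def by (rule hom_ext_min_length[OF min_length_gen])
  with K.add[OF incl_rho[of p n]] J0_plus(2) show "p \<in> ideal_J0_plus n" by fastforce
qed

lemma incl_in_J0_plus_iff:
  assumes "n > 0" shows "incl p \<in> ideal_J0_plus n \<longleftrightarrow> p \<in> min_length n"
  by (simp add: J0_plus_iff[OF assms] rho_incl)

lemma J_subset_J0_plus: "n > 0 \<Longrightarrow> ideal_J \<subseteq> ideal_J0_plus n"
  by (auto simp: J0_plus_iff rho_J)

section \<open>Residual nilpotence of the algebra with all relators\<close>

abbreviation mono_of :: "'x list \<Rightarrow> ('x word \<Rightarrow>\<^sub>0 'k::field)" where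
  "mono_of ws \<equiv> Poly_Mapping.single (Word ws) 1"

lemma mono_of_append: "mono_of (us @ vs) = mono_of us * mono_of vs"
  by (simp add: mult_single plus_word_def)

lemma mono_of_replicate: "mono_of (replicate n g) = gen g ^ n"
proof (induction n)
  case (Suc n)
  then show ?case by (simp add: single_Word_Cons)
qed (simp flip: zero_word_def)

text \<open>The embedding into a free algebra in multiplicative coordinates.  On the left \<open>Ga\<close>, \<open>Gc\<close>, \<open>Gd\<close>,
  \<open>Gy\<close> stand for \<open>1 + a\<close>, \<open>1 + c\<close>, \<open>1 + d\<close>, \<open>1 + y\<close>; on the right \<open>Ga\<close>, \<open>Gb\<close>, \<open>Gc\<close>,
  \<open>Gd\<close> stand for \<open>g\<close>, \<open>\<beta>\<close>, \<open>1 + c\<close>, \<open>1 + d\<close>.\<close>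

fun encode_letter :: "gens6 \<Rightarrow> gens4 list" where
  "encode_letter (Incl Ga) = [Gd, Ga]"
| "encode_letter (Incl Gb) = [Gb, Ga]"
| "encode_letter (Incl Gc) = [Gc]"
| "encode_letter (Incl Gd) = [Gd]"
| "encode_letter Gx = [Ga, Gb]"
| "encode_letter Gy = [Ga, Gc]"

definition encode :: "gens6 list \<Rightarrow> gens4 list" where
  "encode ws = concat (map encode_letter ws)"

lemma encode_simps [simp]: "encode [] = []" "encode (g # ws) = encode_letter g @ encode ws"
  by (simp_all add: encode_def)

text \<open>After \<open>1 + d\<close> a following \<open>g\<close> may belong to \<open>1 + a = (1 + d) g\<close> or begin the next letter \<open>x\<close> or
  \<open>1 + y\<close>.  The second reading is possible exactly if a maximal run of blocks \<open>g \<beta>\<close> is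
  followed by \<open>g (1 + c)\<close> or by no \<open>g\<close> at all.\<close>

fun no_split :: "gens4 list \<Rightarrow> bool" where
  "no_split (Ga # Gb # u) = no_split u"
| "no_split (Ga # Gc # u) = True"
| "no_split (Ga # u) = False"
| "no_split u = True"

text \<open>The parser prefers \<open>1 + d\<close> to \<open>1 + a\<close> whenever the rest can be read that way.  All other
  letters are determined by the next one or two symbols.\<close>

fun decode :: "gens4 list \<Rightarrow> gens6 list" where
  "decode (Gc # u) = Incl Gc # decode u"
| "decode (Gb # Ga # u) = Incl Gb # decode u"
| "decode (Ga # Gb # u) = Gx # decode u"
| "decode (Ga # Gc # u) = Gy # decode u"
| "decode (Gd # u) = (if no_split u then Incl Gd # decode u else Incl Ga # decode (tl u))"
| "decode _ = []"

lemma no_split_encode: "no_split (encode ws)"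
proof (induction ws)
  case (Cons g ws)
  then show ?case by (cases g rule: encode_letter.cases) simp_all
qed simp

text \<open>The words that can be read in two ways are those with \<open>(1 + a) b\<^sup>i (1 + c)\<close> in front, and the
  parser then returns \<open>(1 + d) x\<^sup>i (1 + y)\<close>: the two sides of a relator.\<close>

lemma no_split_Ga:
  assumes "no_split (Ga # encode ws)"
  obtains i vs where "ws = replicate i (Incl Gb) @ Incl Gc # vs"
    and "decode (Ga # encode ws) = replicate i Gx @ Gy # decode (encode vs)"
proof -
  have "\<exists>i vs. ws = replicate i (Incl Gb) @ Incl Gc # vs \<and>
      decode (Ga # encode ws) = replicate i Gx @ Gy # decode (encode vs)"
    using assms
  proof (induction ws)
    case (Cons g ws)
    show ?case
    proof (cases g rule: encode_letter.cases)
      case 2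
      with Cons obtain i vs where "ws = replicate i (Incl Gb) @ Incl Gc # vs"
        "decode (Ga # encode ws) = replicate i Gx @ Gy # decode (encode vs)" by auto
      with 2 show ?thesis by (intro exI[of _ "Suc i"] exI[of _ vs]) simp
    next
      case 3
      then show ?thesis by (intro exI[of _ 0] exI[of _ ws]) simp
    qed (use Cons.prems in simp_all)
  qed simp
  with that show thesis by blast
qed

definition word_relators :: "(gens6 word \<Rightarrow>\<^sub>0 'k::field) set" where
  "word_relators = range (\<lambda>l. Pa * Pb ^ l * Pc - Pd * Px ^ l * Py)"

text \<open>Whenever the parser deviates from the word that was encoded, it has replaced one side of a
  relator by the other.\<close>

lemma decode_encode:
  "mono_of (decode (encode ws)) - mono_of ws \<in> Idl\<^bsub>free_algebra\<^esub> (word_relators :: (gens6 word \<Rightarrow>\<^sub>0 'k::field) set)"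
proof (induction ws rule: length_induct)
  case (1 ws)
  let ?K = "Idl\<^bsub>free_algebra\<^esub> (word_relators :: (gens6 word \<Rightarrow>\<^sub>0 'k::field) set)"
  interpret K: free_ideal ?K
    by (rule free_ideal.intro[OF ideal_genideal])
  have IH: "mono_of (decode (encode vs)) - mono_of vs \<in> ?K" if "length vs < length ws" for vs
    using 1 that by blast
  show ?case
  proof (cases ws)
    case Nil
    then show ?thesis using K.zero by simp
  next
    case (Cons g us)
    have step: ?thesis if "decode (encode ws) = g # decode (encode us)"
      using K.lmult[OF IH[of us], of "gen g"] that Cons by (simp add: single_Word_Cons algebra_simps)
    show ?thesis
    proof (cases g rule: encode_letter.cases)
      case 1
      show ?thesis
      proof (cases "no_split (Ga # encode us)")
        case False
        with 1 Cons show ?thesis by (intro step) simp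
      next
        case True
        from no_split_Ga[OF True] obtain i vs where us: "us = replicate i (Incl Gb) @ Incl Gc # vs"
          and dec: "decode (Ga # encode us) = replicate i Gx @ Gy # decode (encode vs)" by blast
        let ?v = "mono_of (decode (encode vs)) :: 'k P"
        have "mono_of (decode (encode ws)) = Pd * Px ^ i * Py * ?v"
          using True Cons 1 by (simp add: dec single_Word_Cons mono_of_append mono_of_replicate mult.assoc)
        moreover have "mono_of ws = Pa * Pb ^ i * Pc * (mono_of vs :: 'k P)"
          using Cons 1 by (simp add: us single_Word_Cons mono_of_append mono_of_replicate mult.assoc)
        ultimately have "mono_of (decode (encode ws)) - mono_of ws =
            Pa * Pb ^ i * Pc * (?v - mono_of vs) - (Pa * Pb ^ i * Pc - Pd * Px ^ i * Py) * ?v"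
          by (simp add: algebra_simps)
        moreover have "?v - mono_of vs \<in> ?K"
          using Cons us by (intro IH) simp
        moreover have "Pa * Pb ^ i * Pc - Pd * Px ^ i * Py \<in> ?K"
          by (auto simp: word_relators_def intro!: genideal_base)
        ultimately show ?thesis using K.diff K.lmult K.rmult by presburger
      qed
    next
      case 4
      with Cons no_split_encode[of us] show ?thesis by (intro step) simp
    qed (rule step, simp add: Cons)+
  qed
qed

text \<open>The linear extension of the parser is a left inverse of the encoding modulo the relators.\<close>

lemma kernel_encode:
  fixes p :: "'k::field P"
  assumes "free.hom_ext (\<lambda>g. mono_of (encode_letter g)) p = (0 :: gens4 word \<Rightarrow>\<^sub>0 'k)"
  shows "p \<in> Idl\<^bsub>free_algebra\<^esub> word_relators"
proof -
  let ?K = "Idl\<^bsub>free_algebra\<^esub> (word_relators :: 'k P set)"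
  interpret K: free_ideal ?K
    by (rule free_ideal.intro[OF ideal_genideal])
  let ?E = "free.hom_ext (\<lambda>g. mono_of (encode_letter g)) :: 'k P \<Rightarrow> gens4 word \<Rightarrow>\<^sub>0 'k"
  define N :: "(gens4 word \<Rightarrow>\<^sub>0 'k) \<Rightarrow> 'k P" where
    "N = free.lin_ext (\<lambda>w. mono_of (decode (letters w)))"
  have "N (?E q) - q \<in> ?K" for q
  proof (induction q rule: poly_mapping_single_induct)
    case (single w c)
    have "prod_list (map (\<lambda>g. mono_of (encode_letter g)) ws) = (mono_of (encode ws) :: gens4 word \<Rightarrow>\<^sub>0 'k)" for ws
      by (induction ws) (simp_all add: mono_of_append flip: zero_word_def)
    then have "?E (Poly_Mapping.single w c) = Poly_Mapping.single (Word (encode (letters w))) c"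
      by (simp add: free.hom_ext_single mult_single)
    then have "N (?E (Poly_Mapping.single w c)) = const c * mono_of (decode (encode (letters w)))"
      by (simp add: N_def free.lin_ext_single)
    moreover have "Poly_Mapping.single w c = const c * mono_of (letters w)"
      by (simp add: mult_single)
    ultimately show ?case
      using K.lmult[OF decode_encode[of "letters w"], of "const c"] by (simp add: right_diff_distrib)
  next
    case (add p q)
    then show ?case using K.add[of "N (?E p) - p" "N (?E q) - q"]
      by (simp add: free.hom_ext_add N_def free.lin_ext_add algebra_simps)
  qed
  from this[of p] assms K.uminus show ?thesis by (fastforce simp: N_def free.lin_ext_zero)
qed

text \<open>The same embedding in augmented coordinates, so that it preserves the augmentation; here
  \<open>Fa\<close> stands for \<open>g - 1\<close> and \<open>Fb\<close> for \<open>\<beta>\<close>.\<close>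

fun sigma_gen :: "gens6 \<Rightarrow> (gens4 word \<Rightarrow>\<^sub>0 'k::field)" where
  "sigma_gen (Incl Ga) = (1 + Fd) * (1 + Fa) - 1"
| "sigma_gen (Incl Gb) = Fb * (1 + Fa)"
| "sigma_gen (Incl Gc) = Fc"
| "sigma_gen (Incl Gd) = Fd"
| "sigma_gen Gx = (1 + Fa) * Fb"
| "sigma_gen Gy = (1 + Fa) * (1 + Fc) - 1"

definition sigma :: "'k::field P \<Rightarrow> (gens4 word \<Rightarrow>\<^sub>0 'k)" where
  "sigma = free.hom_ext sigma_gen"

lemma sigma_min_length: "p \<in> min_length n \<Longrightarrow> sigma p \<in> min_length n"
  unfolding sigma_def
proof (rule hom_ext_min_length)
  show "sigma_gen g \<in> min_length 1" for g
    by (cases g rule: sigma_gen.cases)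
      (simp_all add: min_length_1_iff counit_mult lookup_add lookup_minus del: One_nat_def)
qed

lemma sigma_J: "j \<in> ideal_J \<Longrightarrow> sigma j = 0"
proof -
  have pow: "(1 + Fa) * (Fb * (1 + Fa)) ^ l = ((1 + Fa) * Fb) ^ l * ((1 + Fa) :: gens4 word \<Rightarrow>\<^sub>0 'a)" for l
  proof (induction l)
    case (Suc l)
    have "(1 + Fa) * (Fb * (1 + Fa)) ^ Suc l = ((1 + Fa) * Fb) * ((1 + Fa) * (Fb * (1 + Fa)) ^ l :: gens4 word \<Rightarrow>\<^sub>0 'a)"
      by (simp only: power_Suc mult.assoc)
    then show ?case by (simp only: Suc power_Suc mult.assoc)
  qed simp
  have "sigma (rel_w l) = (0 :: gens4 word \<Rightarrow>\<^sub>0 'a)" for l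
  proof -
    have "sigma (rel_w l) = (1 + Fd) * ((1 + Fa) * (Fb * (1 + Fa)) ^ l) * (1 + Fc)
       - (1 + Fd) * (((1 + Fa) * Fb) ^ l * ((1 + Fa) :: gens4 word \<Rightarrow>\<^sub>0 'a)) * (1 + Fc)"
      unfolding sigma_def rel_w_def free.hom_ext_simps sigma_gen.simps by (simp only: mult.assoc add_diff_cancel_left' diff_add_cancel add.commute[of _ "_ - 1"] add.commute[of 1 "_ - 1"])
    then show ?thesis by (simp only: pow diff_self)
  qed
  then have "ideal_J \<subseteq> {p. sigma p \<in> {0 :: gens4 word \<Rightarrow>\<^sub>0 'a}}"
    unfolding ideal_J_eq_rel_w sigma_def
    by (intro genideal_least ideal_vimage_hom_ext) (auto simp: ideal_free_algebra_iff)
  then show "j \<in> ideal_J \<Longrightarrow> sigma j = 0" by blast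
qed

text \<open>The changes of coordinates \<open>a \<mapsto> a + c\<close> with \<open>c = 1\<close> and \<open>c = -1\<close> for those generators that
  are shifted in passing between augmented and multiplicative coordinates.\<close>

fun shift_gen :: "'k::field \<Rightarrow> gens6 \<Rightarrow> 'k P" where
  "shift_gen c (Incl Gb) = Pb"
| "shift_gen c Gx = Px"
| "shift_gen c g = gen g + const c"

fun shift_gen4 :: "'k::field \<Rightarrow> gens4 \<Rightarrow> (gens4 word \<Rightarrow>\<^sub>0 'k)" where
  "shift_gen4 c Gb = Fb"
| "shift_gen4 c g = gen g + const c"

lemma kernel_sigma:
  fixes p :: "'k::field P"
  assumes "sigma p = 0"
  shows "p \<in> ideal_J"
proof -
  let ?E = "free.hom_ext (\<lambda>g. mono_of (encode_letter g)) :: 'k P \<Rightarrow> gens4 word \<Rightarrow>\<^sub>0 'k"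
  let ?down = "free.hom_ext (shift_gen (-1)) :: 'k P \<Rightarrow> 'k P"
  let ?up = "free.hom_ext (shift_gen 1) :: 'k P \<Rightarrow> 'k P"
  let ?down4 = "free.hom_ext (shift_gen4 (-1)) :: (gens4 word \<Rightarrow>\<^sub>0 'k) \<Rightarrow> _"
  note s = free.hom_ext_simps
  have up_down: "?up (?down q) = q" for q
  proof (induction q rule: free_algebra_induct)
    case (gen g p)
    have "?up (shift_gen (-1) g) = gen g"
      by (cases "(1::'k, g)" rule: shift_gen.cases) (simp_all add: s single_uminus)
    with gen show ?case by (simp add: s)
  qed (simp_all add: s)
  have E: "?down4 (sigma q) = ?E (?down q)" for q
  proof (induction q rule: free_algebra_induct)
    case (gen g p)
    have "?down4 (sigma_gen g) = ?E (shift_gen (-1) g)"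
      by (cases g rule: sigma_gen.cases)
        (simp_all add: s single_uminus single_Word_Cons single_Word_Nil)
    with gen show ?case by (simp add: sigma_def s)
  qed (simp_all add: sigma_def s)
  have "?E (?down p) = 0"
    using E[of p] by (simp add: assms s)
  then have "?down p \<in> Idl\<^bsub>free_algebra\<^esub> word_relators"
    by (rule kernel_encode)
  moreover have "Idl\<^bsub>free_algebra\<^esub> word_relators \<subseteq> {q. ?up q \<in> ideal_J}"
  proof (rule genideal_least[OF ideal_vimage_hom_ext[OF J.ideal]])
    have "?up (Pa * Pb ^ l * Pc - Pd * Px ^ l * Py) = rel_w l" for l
      by (simp add: s rel_w_def add.commute)
    then show "word_relators \<subseteq> {q. ?up q \<in> ideal_J}"
      by (auto simp: word_relators_def rel_w_in_J)
  qed
  ultimately show ?thesis using up_down[of p] by auto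
qed

text \<open>In one direction \<open>J\<close> lies in each \<open>J\<^sub>0 + I\<^sup>n\<close>; in the other, \<open>sigma\<close> kills \<open>J\<^sub>0\<close>, respects
  the powers of the augmentation ideals, and has kernel \<open>J\<close>.\<close>

lemma J_eq_Inter: "(\<Inter>n\<in>{1..}. ideal_J0_plus n) = ideal_J"
proof (intro equalityI subsetI)
  fix p :: "'a P" assume p: "p \<in> (\<Inter>n\<in>{1..}. ideal_J0_plus n)"
  have "sigma p \<in> min_length n" if "n \<ge> 1" for n
  proof -
    from p that obtain j u where "j \<in> ideal_J0" "u \<in> min_length n" "p = j + u"
      unfolding ideal_J0_plus_def ideal_sum_def by fastforce
    then show ?thesis
      using J0_subset_J sigma_min_length[of u n] sigma_J[of j] by (auto simp: sigma_def free.hom_ext_add)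
  qed
  then have "sigma p \<in> min_length n" for n
    by (cases "n = 0") simp_all
  then show "p \<in> ideal_J" by (intro kernel_sigma min_length_Inter)
next
  fix p :: "'a P" assume "p \<in> ideal_J"
  then show "p \<in> (\<Inter>n\<in>{1..}. ideal_J0_plus n)"
    by (intro INT_I subsetD[OF J_subset_J0_plus]) simp_all
qed

section \<open>Quotients of vector spaces and transport of bases\<close>

lemma vectorspace_classI: "Module.module (class_ring :: 'k::field ring) V \<Longrightarrow> vectorspace class_ring V"
  by (intro vectorspace.intro class_field)

lemma linear_mapI:
  assumes "vectorspace (class_ring :: 'k::field ring) V" "vectorspace class_ring N"
    and "\<And>v. v \<in> carrier V \<Longrightarrow> T v \<in> carrier N"
    and "\<And>v w. v \<in> carrier V \<Longrightarrow> w \<in> carrier V \<Longrightarrow> T (v \<oplus>\<^bsub>V\<^esub> w) = T v \<oplus>\<^bsub>N\<^esub> T w"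
    and "\<And>c v. v \<in> carrier V \<Longrightarrow> T (c \<odot>\<^bsub>V\<^esub> v) = c \<odot>\<^bsub>N\<^esub> T v"
  shows "linear_map class_ring V N T"
  using assms
  by (auto simp: linear_map_def mod_hom_def mod_hom_axioms_def LinearCombinations.module_hom_def vectorspace_def)

lemma free_vs_simps [simp]:
  "carrier (free_vs S) = {z. Poly_Mapping.keys z \<subseteq> S}" "zero (free_vs S) = 0"
  "add (free_vs S) = (+)" "module.smult (free_vs S) = (\<lambda>c. Poly_Mapping.map ((*) c))"
  by (simp_all add: free_vs_def)

lemma map_scale_simps:
  fixes z :: "'s \<Rightarrow>\<^sub>0 'k::field"
  shows "Poly_Mapping.map ((*) c) (z + z') = Poly_Mapping.map ((*) c) z + Poly_Mapping.map ((*) c) z'"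
    and "Poly_Mapping.map ((*) (c + d)) z = Poly_Mapping.map ((*) c) z + Poly_Mapping.map ((*) d) z"
    and "Poly_Mapping.map ((*) (c * d)) z = Poly_Mapping.map ((*) c) (Poly_Mapping.map ((*) d) z)"
    and "Poly_Mapping.map ((*) 1) z = z"
    and "Poly_Mapping.map ((*) 0) z = 0"
    and "Poly_Mapping.map ((*) (- 1)) z = - z"
  by (rule poly_mapping_eqI; simp add: lookup_map_scale lookup_add algebra_simps)+

lemma map_scale_single: "Poly_Mapping.map ((*) c) (Poly_Mapping.single s (d::'k::field)) = Poly_Mapping.single s (c * d)"
  by (rule poly_mapping_eqI) (simp add: lookup_map_scale lookup_single when_def)

lemma keys_map_scale: "Poly_Mapping.keys (Poly_Mapping.map ((*) (c::'k::field)) z) \<subseteq> Poly_Mapping.keys z"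
  by (auto simp: in_keys_iff lookup_map_scale)

lemma vectorspace_free_vs: "vectorspace (class_ring :: 'k::field ring) (free_vs S)"
proof (intro vectorspace_classI module_criteria)
  show "\<forall>v\<in>carrier (free_vs S). \<exists>w\<in>carrier (free_vs S). v \<oplus>\<^bsub>free_vs S\<^esub> w = \<zero>\<^bsub>free_vs S\<^esub>"
    by (intro ballI bexI[of _ "- _"]) auto
  show "\<forall>v w. v \<in> carrier (free_vs S) \<and> w \<in> carrier (free_vs S) \<longrightarrow> v \<oplus>\<^bsub>free_vs S\<^esub> w \<in> carrier (free_vs S)"
    using keys_add by fastforce
  show "\<forall>c v. c \<in> carrier class_ring \<and> v \<in> carrier (free_vs S) \<longrightarrow> c \<odot>\<^bsub>free_vs S\<^esub> v \<in> carrier (free_vs S)"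
    using keys_map_scale by fastforce
qed (simp_all add: map_scale_simps add_ac class_cring.is_cring)

locale quot_space =
  fixes V :: "('k::field, 'v, 'm) module_scheme" (structure) and U W
  assumes vs: "vectorspace (class_ring :: 'k ring) V"
    and U: "submodule class_ring U V" and W: "submodule class_ring W V" and W_U: "W \<subseteq> U"
begin

sublocale vectorspace "class_ring :: 'k ring" V by (rule vs)

lemma U_carrier: "U \<subseteq> carrier V" using U by (simp add: submodule_def)

lemma U_closed: "u \<in> U \<Longrightarrow> v \<in> U \<Longrightarrow> u \<oplus> v \<in> U" "u \<in> U \<Longrightarrow> c \<odot> u \<in> U" "\<zero> \<in> U"
  using U by (auto simp: submodule_def)

lemma W_closed: "u \<in> W \<Longrightarrow> v \<in> W \<Longrightarrow> u \<oplus> v \<in> W" "u \<in> W \<Longrightarrow> c \<odot> u \<in> W" "\<zero> \<in> W"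
  using W by (auto simp: submodule_def)

lemma minus_eq: "v \<in> carrier V \<Longrightarrow> \<ominus> v = (- 1) \<odot> v"
  using smult_minus_1[of v] by (simp add: class_ring_simps)

sublocale abelian_subgroup W V
proof (rule abelian_subgroupI3)
  show "additive_subgroup W V"
    using W_closed W_U U_carrier
    by (intro additive_subgroup.intro M.add.subgroupI)
       (auto simp: minus_eq a_inv_def[symmetric] subset_iff)
qed (rule M.abelian_group_axioms)

lemma coset_eq_iff:
  assumes "u \<in> carrier V" "v \<in> carrier V"
  shows "W +> u = W +> v \<longleftrightarrow> u \<ominus> v \<in> W"
proof
  assume "W +> u = W +> v"
  then have "u \<in> W +> v" using a_rcos_self[OF assms(1)] by simp
  then obtain w where "w \<in> W" "u = w \<oplus> v" by (auto simp: a_r_coset_def')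
  then show "u \<ominus> v \<in> W"
    using assms W_U U_carrier by (simp add: subset_iff a_minus_def M.a_assoc M.r_neg)
next
  assume w: "u \<ominus> v \<in> W"
  have "u = (u \<ominus> v) \<oplus> v" using assms by (simp add: a_minus_def M.a_assoc M.l_neg)
  with w have "u \<in> W +> v" by (auto simp: a_r_coset_def')
  then show "W +> u = W +> v" using a_repr_independence'[OF _ assms(2)] by simp
qed

lemma coset_smult:
  assumes "u \<in> carrier V"
  shows "W <+>\<^bsub>V\<^esub> (\<lambda>x. c \<odot> x) ` (W +> u) = W +> (c \<odot> u)"
proof -
  have sub: "w \<in> W \<Longrightarrow> w \<in> carrier V" for w using W_U U_carrier by blast
  show ?thesis
  proof (intro equalityI subsetI)
    fix x assume "x \<in> W <+>\<^bsub>V\<^esub> (\<lambda>x. c \<odot> x) ` (W +> u)"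
    then obtain w w' where w: "w \<in> W" "w' \<in> W" "x = w \<oplus> c \<odot> (w' \<oplus> u)"
      unfolding set_add_def' a_r_coset_def' by auto
    then have "x = (w \<oplus> c \<odot> w') \<oplus> c \<odot> u"
      using sub assms by (simp add: smult_r_distr M.a_assoc)
    moreover have "w \<oplus> c \<odot> w' \<in> W" using w W_closed by simp
    ultimately show "x \<in> W +> (c \<odot> u)" unfolding a_r_coset_def' by auto
  next
    fix x assume "x \<in> W +> (c \<odot> u)"
    then obtain w where w: "w \<in> W" "x = w \<oplus> c \<odot> (\<zero> \<oplus> u)"
      unfolding a_r_coset_def' using assms by auto
    moreover have "\<zero> \<oplus> u \<in> W +> u" using W_closed(3) unfolding a_r_coset_def' by blast
    ultimately show "x \<in> W <+>\<^bsub>V\<^esub> (\<lambda>x. c \<odot> x) ` (W +> u)"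
      unfolding set_add_def' by blast
  qed
qed

lemma quot_vs_simps:
  "carrier (quot_vs V U W) = (\<lambda>u. W +> u) ` U" "zero (quot_vs V U W) = W"
  "u \<in> carrier V \<Longrightarrow> v \<in> carrier V \<Longrightarrow> (W +> u) \<oplus>\<^bsub>quot_vs V U W\<^esub> (W +> v) = W +> (u \<oplus> v)"
  "u \<in> carrier V \<Longrightarrow> c \<odot>\<^bsub>quot_vs V U W\<^esub> (W +> u) = W +> (c \<odot> u)"
  by (simp_all add: quot_vs_def a_rcos_sum coset_smult)

lemma coset_zero: "W +> \<zero> = W"
  using W_U U_carrier by (intro M.a_coset_add_zero) blast

lemma vectorspace_quot_vs: "vectorspace class_ring (quot_vs V U W)"
proof (intro vectorspace_classI module_criteria)
  have c: "u \<in> U \<Longrightarrow> u \<in> carrier V" for u using U_carrier by blast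
  show "cring (class_ring :: 'k ring)" by (rule class_cring.is_cring)
  show "\<zero>\<^bsub>quot_vs V U W\<^esub> \<in> carrier (quot_vs V U W)"
    using U_closed(3) coset_zero by (force simp: quot_vs_simps)
  show "\<forall>v\<in>carrier (quot_vs V U W). \<exists>w\<in>carrier (quot_vs V U W). v \<oplus>\<^bsub>quot_vs V U W\<^esub> w = \<zero>\<^bsub>quot_vs V U W\<^esub>"
  proof
    fix v assume "v \<in> carrier (quot_vs V U W)"
    then obtain u where u: "u \<in> U" "v = W +> u" by (auto simp: quot_vs_simps)
    have "u \<oplus> (- 1) \<odot> u = \<zero>" using c[OF u(1)] by (simp add: minus_eq[symmetric] M.r_neg)
    then show "\<exists>w\<in>carrier (quot_vs V U W). v \<oplus>\<^bsub>quot_vs V U W\<^esub> w = \<zero>\<^bsub>quot_vs V U W\<^esub>"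
      using u U_closed(2)[OF u(1), of "-1"] c[OF u(1)]
      by (intro bexI[of _ "W +> ((- 1) \<odot> u)"]) (auto simp: quot_vs_simps coset_zero)
  qed
  have "(W +> u) \<oplus>\<^bsub>quot_vs V U W\<^esub> W = W +> u" if "u \<in> carrier V" for u
    using quot_vs_simps(3)[OF that M.zero_closed] that by (simp add: coset_zero)
  then show "\<forall>v\<in>carrier (quot_vs V U W). v \<oplus>\<^bsub>quot_vs V U W\<^esub> \<zero>\<^bsub>quot_vs V U W\<^esub> = v"
    using c by (auto simp: quot_vs_simps)
qed (use U_carrier U_closed in \<open>auto simp: quot_vs_simps subset_iff M.a_ac smult_l_distr[simplified]
    smult_r_distr smult_assoc1[simplified] smult_one[simplified]\<close>)

lemma quot_vs_iso:
  fixes L :: "'v \<Rightarrow> 'w" and N :: "('k, 'w, 'n) module_scheme"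
  assumes N: "vectorspace class_ring N"
    and onto: "L ` U = carrier N"
    and add: "\<And>u v. u \<in> U \<Longrightarrow> v \<in> U \<Longrightarrow> L (u \<oplus> v) = L u \<oplus>\<^bsub>N\<^esub> L v"
    and smult: "\<And>c u. u \<in> U \<Longrightarrow> L (c \<odot> u) = c \<odot>\<^bsub>N\<^esub> L u"
    and ker: "\<And>u. u \<in> U \<Longrightarrow> L u = \<zero>\<^bsub>N\<^esub> \<longleftrightarrow> u \<in> W"
  obtains T where "T \<in> vs_iso (quot_vs V U W) N" "\<And>u. u \<in> U \<Longrightarrow> T (W +> u) = L u"
proof -
  interpret N: vectorspace class_ring N by (rule N)
  have c: "u \<in> U \<Longrightarrow> u \<in> carrier V" for u using U_carrier by blast
  have L_in: "u \<in> U \<Longrightarrow> L u \<in> carrier N" for u using onto by blast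
  have eq: "L u = L v \<longleftrightarrow> W +> u = W +> v" if "u \<in> U" "v \<in> U" for u v
  proof -
    have m: "u \<ominus> v = u \<oplus> (- 1) \<odot> v" using that c by (simp add: a_minus_def minus_eq)
    have "L (u \<ominus> v) = L u \<oplus>\<^bsub>N\<^esub> (- 1) \<odot>\<^bsub>N\<^esub> L v" using that U_closed by (simp add: m add smult)
    also have "(- 1) \<odot>\<^bsub>N\<^esub> L v = \<ominus>\<^bsub>N\<^esub> L v"
      using N.smult_minus_1[of "L v"] L_in that by (simp add: class_ring_simps)
    finally have "L (u \<ominus> v) = L u \<ominus>\<^bsub>N\<^esub> L v" by (simp add: a_minus_def)
    moreover have "u \<ominus> v \<in> U" using that U_closed by (simp add: m)
    ultimately show ?thesis using ker[of "u \<ominus> v"] that L_in c by (simp add: coset_eq_iff)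
  qed
  define T where "T X = L (SOME u. u \<in> U \<and> X = W +> u)" for X
  have T: "T (W +> u) = L u" if "u \<in> U" for u
  proof -
    have "(SOME v. v \<in> U \<and> W +> u = W +> v) \<in> U \<and> W +> u = W +> (SOME v. v \<in> U \<and> W +> u = W +> v)"
      by (rule someI[of _ u]) (use that in simp)
    then show ?thesis unfolding T_def using eq that by metis
  qed
  have "linear_map class_ring (quot_vs V U W) N T"
    by (rule linear_mapI[OF vectorspace_quot_vs N])
       (use U_closed c in \<open>auto simp: quot_vs_simps T L_in add smult\<close>)
  moreover have "bij_betw T (carrier (quot_vs V U W)) (carrier N)"
    unfolding bij_betw_def inj_on_def using onto by (auto simp: quot_vs_simps T eq image_image)
  ultimately show thesis using that T by (auto simp: vs_iso_def)
qed

end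

lemma vs_isoD:
  assumes "T \<in> vs_iso V N"
  shows "vectorspace class_ring V" "vectorspace class_ring N"
    "\<And>v. v \<in> carrier V \<Longrightarrow> T v \<in> carrier N"
    "\<And>v w. v \<in> carrier V \<Longrightarrow> w \<in> carrier V \<Longrightarrow> T (v \<oplus>\<^bsub>V\<^esub> w) = T v \<oplus>\<^bsub>N\<^esub> T w"
    "\<And>c v. v \<in> carrier V \<Longrightarrow> T (c \<odot>\<^bsub>V\<^esub> v) = c \<odot>\<^bsub>N\<^esub> T v"
    "bij_betw T (carrier V) (carrier N)"
  using assms
  by (auto simp: vs_iso_def linear_map_def mod_hom_def mod_hom_axioms_def LinearCombinations.module_hom_def bij_betw_def)

lemma vectorspace_closed:
  assumes "vectorspace (class_ring :: 'k::field ring) V"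
  shows "v \<in> carrier V \<Longrightarrow> w \<in> carrier V \<Longrightarrow> v \<oplus>\<^bsub>V\<^esub> w \<in> carrier V"
    "v \<in> carrier V \<Longrightarrow> c \<odot>\<^bsub>V\<^esub> v \<in> carrier V"
proof -
  interpret vectorspace class_ring V by fact
  show "v \<in> carrier V \<Longrightarrow> w \<in> carrier V \<Longrightarrow> v \<oplus>\<^bsub>V\<^esub> w \<in> carrier V"
    "v \<in> carrier V \<Longrightarrow> c \<odot>\<^bsub>V\<^esub> v \<in> carrier V" by simp_all
qed

lemma vs_iso_inverse:
  assumes T: "T \<in> vs_iso V N"
  shows "inv_into (carrier V) T \<in> vs_iso N V"
proof -
  note D = vs_isoD[OF T]
  let ?I = "inv_into (carrier V) T"
  have I: "?I x \<in> carrier V" "T (?I x) = x" if "x \<in> carrier N" for x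
    using that D(6) by (auto simp: bij_betw_def inv_into_into f_inv_into_f)
  have eq: "?I x = v" if "v \<in> carrier V" "T v = x" for x v
    using that D(6) by (auto simp: bij_betw_def)
  have "linear_map class_ring N V ?I"
    by (rule linear_mapI[OF D(2,1)])
       (auto intro!: eq I vectorspace_closed[OF D(1)] simp: D(4,5) I)
  then show ?thesis
    using bij_betw_inv_into[OF D(6)] by (simp add: vs_iso_def)
qed

lemma vs_iso_comp:
  assumes T: "T \<in> vs_iso V N" and S: "S \<in> vs_iso N M"
  shows "S \<circ> T \<in> vs_iso V M"
proof -
  note T = vs_isoD[OF T] and S = vs_isoD[OF S]
  have "linear_map class_ring V M (S \<circ> T)"
    by (rule linear_mapI[OF T(1) S(2)]) (simp_all add: T(3,4,5) S(3,4,5))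
  then show ?thesis using bij_betw_trans[OF T(6) S(6)] by (simp add: vs_iso_def)
qed

lemma basis_of_vs_iso:
  fixes V :: "('k::field, 'v, 'm) module_scheme" and S :: "'s set"
  assumes T: "T \<in> vs_iso V (free_vs S)"
    and h: "\<And>s. s \<in> S \<Longrightarrow> h s \<in> carrier V \<and> T (h s) = Poly_Mapping.single s 1"
  shows "inj_on h S" and "vectorspace.basis class_ring V (h ` S)"
proof -
  note D = vs_isoD[OF T]
  interpret V: vectorspace class_ring V by (rule D(1))
  show inj: "inj_on h S"
  proof (rule inj_onI)
    fix s t assume "s \<in> S" "t \<in> S" "h s = h t"
    then have "Poly_Mapping.single s (1::'k) = Poly_Mapping.single t 1" using h by metis
    then show "s = t"
      by (metis lookup_single_eq lookup_single_not_eq one_neq_zero)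
  qed
  have T_inj: "v = w" if "T v = T w" "v \<in> carrier V" "w \<in> carrier V" for v w
    using that D(6) by (auto simp: bij_betw_def inj_on_def)
  have T0: "T \<zero>\<^bsub>V\<^esub> = 0"
    using D(4)[of "\<zero>\<^bsub>V\<^esub>" "\<zero>\<^bsub>V\<^esub>"] by simp
  have T_lincomb: "T (V.lincomb a (h ` A)) = (\<Sum>s\<in>A. Poly_Mapping.single s (a (h s)))"
    if "finite A" "A \<subseteq> S" for a A
  proof -
    have "V.lincomb a (h ` A) = (\<Oplus>\<^bsub>V\<^esub>s\<in>A. a (h s) \<odot>\<^bsub>V\<^esub> h s)"
      unfolding V.lincomb_def using that h inj
      by (subst V.add.finprod_reindex) (auto intro: inj_on_subset)
    moreover have "T (\<Oplus>\<^bsub>V\<^esub>s\<in>A. a (h s) \<odot>\<^bsub>V\<^esub> h s) = (\<Sum>s\<in>A. Poly_Mapping.single s (a (h s)))"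
      using that
    proof (induction A rule: finite_induct)
      case empty
      then show ?case by (simp add: T0)
    next
      case (insert x F)
      then have "x \<in> S" "F \<subseteq> S" by auto
      with insert h have "(\<Oplus>\<^bsub>V\<^esub>s\<in>insert x F. a (h s) \<odot>\<^bsub>V\<^esub> h s) =
          a (h x) \<odot>\<^bsub>V\<^esub> h x \<oplus>\<^bsub>V\<^esub> (\<Oplus>\<^bsub>V\<^esub>s\<in>F. a (h s) \<odot>\<^bsub>V\<^esub> h s)"
        by (intro V.M.finsum_insert) (auto simp: Pi_def)
      moreover have "(\<Oplus>\<^bsub>V\<^esub>s\<in>F. a (h s) \<odot>\<^bsub>V\<^esub> h s) \<in> carrier V"
        using \<open>F \<subseteq> S\<close> h by (intro V.M.finsum_closed) auto
      ultimately show ?case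
        using insert h[OF \<open>x \<in> S\<close>] \<open>F \<subseteq> S\<close> by (simp add: D(4,5) map_scale_single)
    qed
    ultimately show ?thesis by simp
  qed
  have sub: "h ` S \<subseteq> carrier V" using h by auto
  have "V.lin_indpt (h ` S)"
  proof
    assume "V.lin_dep (h ` S)"
    then obtain A a v where A: "finite A" "A \<subseteq> h ` S" "V.lincomb a A = \<zero>\<^bsub>V\<^esub>" "v \<in> A" "a v \<noteq> 0"
      by (auto simp: V.lin_dep_def)
    from A(1,2) obtain B where B: "finite B" "B \<subseteq> S" "A = h ` B"
      using finite_subset_image[OF A(1,2)] by auto
    with A obtain s where s: "s \<in> B" "v = h s" by auto
    have "0 = Poly_Mapping.lookup (\<Sum>s\<in>B. Poly_Mapping.single s (a (h s))) s"
      using T_lincomb[OF B(1,2), of a] A B T0 by simp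
    also have "\<dots> = a v"
      using B s by (simp add: lookup_sum lookup_single when_def)
    finally show False using A by simp
  qed
  moreover have "V.span (h ` S) = carrier V"
  proof (intro equalityI subsetI)
    fix v assume v: "v \<in> V.span (h ` S)"
    then show "v \<in> carrier V" using sub V.span_is_subset2 by blast
  next
    fix v assume v: "v \<in> carrier V"
    let ?z = "T v"
    let ?K = "Poly_Mapping.keys ?z"
    let ?a = "\<lambda>u. Poly_Mapping.lookup ?z (inv_into S h u)"
    have K: "?K \<subseteq> S" using D(3)[OF v] by simp
    have inv: "inv_into S h (h s) = s" if "s \<in> ?K" for s
      using that K inj by auto
    have "T (V.lincomb ?a (h ` ?K)) = (\<Sum>s\<in>?K. Poly_Mapping.single s (Poly_Mapping.lookup ?z s))"
      by (simp add: T_lincomb[OF finite_keys K] inv cong: sum.cong)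
    also have "\<dots> = ?z"
      by (rule poly_mapping_eqI) (simp add: lookup_sum lookup_single when_def in_keys_iff)
    finally have "V.lincomb ?a (h ` ?K) = v"
      by (rule T_inj) (use K h v in \<open>auto intro!: V.lincomb_closed\<close>)
    moreover have "finite (h ` ?K)" "h ` ?K \<subseteq> h ` S" using K by auto
    ultimately show "v \<in> V.span (h ` S)"
      unfolding V.span_def by (intro CollectI exI[of _ ?a] exI[of _ "h ` ?K"]) simp
  qed
  ultimately show "V.basis (h ` S)" using sub by (simp add: V.basis_def)
qed

section \<open>Quotient algebras of free algebras\<close>

locale free_quotient = free_ideal K for K :: "('x word \<Rightarrow>\<^sub>0 'k::field) set" +
  assumes K_aug: "K \<subseteq> min_length 1"
begin

abbreviation cls :: "('x word \<Rightarrow>\<^sub>0 'k) \<Rightarrow> ('x word \<Rightarrow>\<^sub>0 'k) set" where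
  "cls p \<equiv> K +>\<^bsub>free_algebra\<^esub> p"

abbreviation (input) Q :: "('k, ('x word \<Rightarrow>\<^sub>0 'k) set) aug_algebra" where
  "Q \<equiv> quot_algebra free_algebra K"

lemma mem_cls_iff: "x \<in> cls p \<longleftrightarrow> x - p \<in> K"
proof -
  have "x = (x - p) + p" by simp
  then show ?thesis by (force simp: a_r_coset_free_algebra)
qed

lemma cls_eq_iff: "cls p = cls q \<longleftrightarrow> p - q \<in> K"
proof
  assume "cls p = cls q"
  then show "p - q \<in> K" using mem_cls_iff[of p p] mem_cls_iff[of p q] zero by simp
next
  assume *: "p - q \<in> K"
  have "x - p \<in> K \<longleftrightarrow> x - q \<in> K" for x
    using add[OF _ *, of "x - p"] diff[OF _ *, of "x - q"] by auto
  then show "cls p = cls q" by (auto simp: mem_cls_iff)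
qed

lemma cls_zero: "cls 0 = K"
  by (simp add: a_r_coset_free_algebra)

lemma cls_eq_K_iff: "cls p = K \<longleftrightarrow> p \<in> K"
  using cls_eq_iff[of p 0] by (simp add: cls_zero)

lemma carrier_Q: "carrier Q = range cls"
  by (auto simp: quot_algebra_def FactRing_def A_RCOSETS_def')

lemma zero_Q: "\<zero>\<^bsub>Q\<^esub> = K"
  by (simp add: quot_algebra_def FactRing_def)

lemma one_Q: "\<one>\<^bsub>Q\<^esub> = cls 1"
  by (simp add: quot_algebra_def FactRing_def)

lemma add_Q: "cls p \<oplus>\<^bsub>Q\<^esub> cls q = cls (p + q)"
proof -
  interpret ideal K "free_algebra :: ('k, 'x word \<Rightarrow>\<^sub>0 'k) aug_algebra" by (rule ideal)
  show ?thesis using a_rcos_sum[of p q] by (simp add: quot_algebra_def FactRing_def)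
qed

lemma mult_Q: "cls p \<otimes>\<^bsub>Q\<^esub> cls q = cls (p * q)"
proof -
  interpret ideal K "free_algebra :: ('k, 'x word \<Rightarrow>\<^sub>0 'k) aug_algebra" by (rule ideal)
  show ?thesis using rcoset_mult_add[of p q] by (simp add: quot_algebra_def FactRing_def)
qed

lemma smult_Q: "c \<odot>\<^bsub>Q\<^esub> cls p = cls (const c * p)"
proof -
  have "j + const c * (j' + p) = (j + const c * j') + const c * p" for j j'
    by (simp add: distrib_left)
  then have "K <+>\<^bsub>free_algebra\<^esub> (\<lambda>x. const c * x) ` cls p \<subseteq> cls (const c * p)"
    using add lmult by (auto simp: set_add_def' a_r_coset_free_algebra)
  moreover have "j + const c * p \<in> K <+>\<^bsub>free_algebra\<^esub> (\<lambda>x. const c * x) ` cls p" if "j \<in> K" for j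
    using that zero by (force simp: set_add_def' a_r_coset_free_algebra)
  ultimately show ?thesis
    by (auto simp: quot_algebra_def a_r_coset_free_algebra)
qed

lemma aug_Q: "aug Q (cls p) = counit p"
proof -
  have "counit (j + p) = counit p" if "j \<in> K" for j
    using that K_aug by (auto simp: lookup_add min_length_1_iff simp del: One_nat_def)
  then have "counit ` cls p = {counit p}"
    using zero by (auto simp: a_r_coset_free_algebra image_iff)
  then show ?thesis by (simp add: quot_algebra_def)
qed

lemmas Q_simps = carrier_Q zero_Q one_Q add_Q mult_Q smult_Q aug_Q

lemma ring_Q: "ring Q"
proof (rule ringI)
  show "abelian_group Q"
  proof (rule abelian_groupI)
    show "\<exists>y\<in>carrier Q. y \<oplus>\<^bsub>Q\<^esub> x = \<zero>\<^bsub>Q\<^esub>" if x: "x \<in> carrier Q" for x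
    proof -
      from x obtain p where "x = cls p" by (auto simp: Q_simps)
      then show ?thesis
        by (intro bexI[of _ "cls (- p)"]) (auto simp: Q_simps cls_zero)
    qed
    show "\<zero>\<^bsub>Q\<^esub> \<in> carrier Q" using cls_zero by (force simp: Q_simps)
    show "\<zero>\<^bsub>Q\<^esub> \<oplus>\<^bsub>Q\<^esub> x = x" if x: "x \<in> carrier Q" for x
    proof -
      from x obtain p where "x = cls p" by (auto simp: Q_simps)
      then show ?thesis using add_Q[of 0 p] by (simp add: cls_zero zero_Q)
    qed
  qed (auto simp: Q_simps add_ac)
  show "Group.monoid Q"
    by (rule monoidI) (auto simp: Q_simps mult.assoc)
qed (auto simp: Q_simps algebra_simps)

lemma sum_Q:
  assumes "finite X"
  shows "finsum Q (\<lambda>x. cls (f x)) X = cls (sum f X)"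
proof -
  interpret ring Q by (rule ring_Q)
  show ?thesis
    using assms
  proof (induction X rule: finite_induct)
    case empty
    show ?case by (simp add: zero_Q cls_zero)
  next
    case (insert x F)
    have "finsum Q (\<lambda>x. cls (f x)) (insert x F) = cls (f x) \<oplus>\<^bsub>Q\<^esub> finsum Q (\<lambda>x. cls (f x)) F"
      using insert by (intro finsum_insert) (auto simp: carrier_Q)
    with insert show ?case by (simp add: add_Q)
  qed
qed

lemma augmented_algebra_Q: "augmented_algebra Q"
proof -
  interpret ring Q by (rule ring_Q)
  have "Module.module (class_ring :: 'k ring) Q"
    by (rule moduleI[OF class_cring.is_cring is_abelian_group])
       (auto simp: Q_simps single_add distrib_right distrib_left mult_single simp flip: mult.assoc)
  moreover have "aug Q \<in> Ring.ring_hom Q (class_ring :: 'k ring)"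
    by (rule ring_hom_memI) (auto simp: Q_simps counit_mult lookup_add)
  moreover have "(const c * p) * q = const c * (p * q)" "p * (const c * q) = const c * (p * q)"
    for c and p q :: "'x word \<Rightarrow>\<^sub>0 'k"
    by (simp_all add: mult.assoc) (metis const_commute mult.assoc)
  ultimately show ?thesis
    by (intro augmented_algebra.intro ring_Q augmented_algebra_axioms.intro)
      (auto simp: Q_simps counit_mult)
qed

lemma vectorspace_Q: "vectorspace class_ring Q"
  using augmented_algebra_Q by (intro vectorspace_classI) (simp add: augmented_algebra_def)

lemma aug_ideal_Q: "aug_ideal Q = cls ` min_length 1"
  by (auto simp: aug_ideal_def a_kernel_def' Q_simps min_length_1_iff simp del: One_nat_def)

text \<open>Taking classes commutes with products of ideals, hence with the powers of the augmentation
  ideal; so the filtration of the quotient algebra can be studied upstairs.\<close>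

lemma ideal_prod_Q: "(cls ` I) \<cdot>\<^bsub>Q\<^esub> (cls ` L) = cls ` (I \<cdot>\<^bsub>free_algebra\<^esub> L)"
proof (intro equalityI subsetI)
  fix x assume "x \<in> (cls ` I) \<cdot>\<^bsub>Q\<^esub> (cls ` L)"
  then show "x \<in> cls ` (I \<cdot>\<^bsub>free_algebra\<^esub> L)"
  proof (induction rule: ideal_prod.induct)
    case (prod i j)
    then show ?case by (auto simp: mult_Q intro: ideal_prod_free_algebra_prod)
  next
    case (sum s t)
    then show ?case by (auto simp: add_Q intro: ideal_prod_free_algebra_sum)
  qed
next
  fix x assume "x \<in> cls ` (I \<cdot>\<^bsub>free_algebra\<^esub> L)"
  then obtain p where p: "p \<in> I \<cdot>\<^bsub>free_algebra\<^esub> L" "x = cls p" by auto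
  from p(1) have "cls p \<in> (cls ` I) \<cdot>\<^bsub>Q\<^esub> (cls ` L)"
  proof (induction rule: ideal_prod.induct)
    case (prod i j)
    then have "cls i \<otimes>\<^bsub>Q\<^esub> cls j \<in> (cls ` I) \<cdot>\<^bsub>Q\<^esub> (cls ` L)"
      by (intro ideal_prod.prod imageI)
    then show ?case by (simp add: mult_Q)
  next
    case (sum s t)
    then have "cls s \<oplus>\<^bsub>Q\<^esub> cls t \<in> (cls ` I) \<cdot>\<^bsub>Q\<^esub> (cls ` L)"
      by (intro ideal_prod.sum)
    then show ?case by (simp add: add_Q)
  qed
  with p show "x \<in> (cls ` I) \<cdot>\<^bsub>Q\<^esub> (cls ` L)" by simp
qed

lemma ideal_power_Q: "ideal_power Q (aug_ideal Q) n = cls ` min_length n"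
proof (induction n)
  case 0
  show ?case by (auto simp: Q_simps)
next
  case (Suc n)
  have "min_length n \<cdot>\<^bsub>free_algebra\<^esub> min_length 1 = (min_length (Suc n) :: ('x word \<Rightarrow>\<^sub>0 'k) set)"
    using ideal_power_free_algebra[of "Suc n"]
    unfolding ideal_power.simps(2) ideal_power_free_algebra unfolding aug_ideal_free_algebra .
  then show ?case unfolding ideal_power.simps Suc unfolding aug_ideal_Q ideal_prod_Q by simp
qed

lemma ideal_Q:
  assumes "ideal I (free_algebra :: ('k, 'x word \<Rightarrow>\<^sub>0 'k) aug_algebra)"
  shows "ideal (cls ` I) Q"
proof -
  interpret I: free_ideal I by (rule free_ideal.intro[OF assms])
  interpret ring Q by (rule ring_Q)
  have inv: "\<ominus>\<^bsub>Q\<^esub> cls p = cls (- p)" for p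
    by (rule minus_equality) (auto simp: Q_simps cls_zero)
  show ?thesis
  proof (rule idealI[OF ring_Q])
    show "subgroup (cls ` I) (add_monoid Q)"
      by (rule add.subgroupI) (use I.zero in \<open>auto simp: Q_simps inv a_inv_def[symmetric] intro: I.add I.uminus\<close>)
  qed (auto simp: Q_simps intro: I.lmult I.rmult)
qed

lemma cls_image_iff:
  "cls p \<in> cls ` I \<longleftrightarrow> (\<exists>q\<in>I. p - q \<in> K)"
  by (auto simp: cls_eq_iff image_iff)

end

section \<open>The para-equivalence, the intersection of powers and its quotient\<close>

interpretation A: free_quotient "ideal_J :: 'k::field P set"
  by (unfold_locales) (rule J_subset_augmentation)

interpretation A0: free_quotient "ideal_J0 :: 'k::field P set"
  using J0_subset_J J_subset_augmentation by unfold_locales blast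

lemma mem_ideal_J0_plus: "(\<exists>q\<in>min_length n. p - q \<in> ideal_J0) \<longleftrightarrow> p \<in> ideal_J0_plus n"
proof
  assume "\<exists>q\<in>min_length n. p - q \<in> ideal_J0"
  then obtain q where "q \<in> min_length n" "p - q \<in> ideal_J0" by blast
  moreover have "p = (p - q) + q" by simp
  ultimately show "p \<in> ideal_J0_plus n" unfolding ideal_J0_plus_def ideal_sum_def by blast
next
  assume "p \<in> ideal_J0_plus n"
  then obtain j q where "j \<in> ideal_J0" "q \<in> min_length n" "p = j + q"
    unfolding ideal_J0_plus_def ideal_sum_def by blast
  then show "\<exists>q\<in>min_length n. p - q \<in> ideal_J0" by (intro bexI[of _ q]) simp_all
qed

lemma augmented_algebra_free_algebra:
  "augmented_algebra (free_algebra :: ('k::field, 'x word \<Rightarrow>\<^sub>0 'k) aug_algebra)"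
proof -
  let ?F = "free_algebra :: ('k, 'x word \<Rightarrow>\<^sub>0 'k) aug_algebra"
  interpret ring ?F by (rule ring_free_algebra)
  have "Module.module (class_ring :: 'k ring) ?F"
    by (rule moduleI[OF class_cring.is_cring is_abelian_group])
       (auto simp: single_add distrib_right distrib_left mult_single simp flip: mult.assoc)
  moreover have "aug ?F \<in> Ring.ring_hom ?F (class_ring :: 'k ring)"
    by (rule ring_hom_memI) (auto simp: counit_mult lookup_add)
  moreover have "(const c * p) * q = const c * (p * q)" "p * (const c * q) = const c * (p * q)"
    for c and p q :: "'x word \<Rightarrow>\<^sub>0 'k"
    by (simp_all add: mult.assoc) (metis const_commute mult.assoc)
  ultimately show ?thesis
    by (intro augmented_algebra.intro ring_free_algebra augmented_algebra_axioms.intro)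
      (auto simp: counit_mult)
qed

lemma canonical_map_eq: "canonical_map p = class_A0 (incl p)"
proof -
  have word: "foldr (\<lambda>g r. class_A0 (gen (Incl g)) \<otimes>\<^bsub>alg_A0\<^esub> r) ws \<one>\<^bsub>alg_A0\<^esub>
      = class_A0 (prod_list (map (\<lambda>g. gen (Incl g)) ws) :: 'a P)" for ws
    by (induction ws) (simp_all add: alg_A0_def class_A0_def A0.Q_simps)
  show ?thesis
    unfolding canonical_map_def free_lift_def word incl_def free.hom_ext_def free.lin_ext_def
    by (simp add: alg_A0_def class_A0_def A0.Q_simps A0.sum_Q)
qed

text \<open>The canonical map followed by reduction modulo the \<open>n\<close>-th power has kernel the \<open>n\<close>-th power by
  \<open>incl_in_J0_plus_iff\<close> and is onto by \<open>incl_rho\<close>; the isomorphism theorem does the rest.\<close>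

lemma para_equivalence_canonical_map:
  "para_equivalence free_algebra alg_A0 (canonical_map :: (gens4 word \<Rightarrow>\<^sub>0 'k::field) \<Rightarrow> 'k P set)"
proof -
  let ?F = "free_algebra :: ('k, gens4 word \<Rightarrow>\<^sub>0 'k) aug_algebra"
  let ?A = "alg_A0 :: ('k, 'k P set) aug_algebra"
  let ?f = "canonical_map :: (gens4 word \<Rightarrow>\<^sub>0 'k) \<Rightarrow> 'k P set"
  have free: "augmented_algebra ?F"
    by (rule augmented_algebra_free_algebra)
  have A: "augmented_algebra ?A"
    unfolding alg_A0_def by (rule A0.augmented_algebra_Q)
  have counit_incl: "counit (incl p) = counit p" for p :: "gens4 word \<Rightarrow>\<^sub>0 'k"
    by (induction p rule: free_algebra_induct)
      (simp_all add: incl_def free.hom_ext_simps lookup_add counit_mult)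
  have hom: "?f \<in> aug_hom ?F ?A"
    unfolding aug_hom_def canonical_map_eq
    by (auto intro!: ring_hom_memI simp: alg_A0_def class_A0_def A0.Q_simps counit_incl)
      (simp_all add: incl_def free.hom_ext_simps)
  have "\<exists>h\<in>ring_iso (?F Quot min_length n) (?A Quot (class_A0 ` min_length n)).
      \<forall>x. h (min_length n +>\<^bsub>?F\<^esub> x) = (class_A0 ` min_length n) +>\<^bsub>?A\<^esub> ?f x" if "n \<ge> 1" for n
  proof -
    let ?I = "class_A0 ` min_length n :: 'k P set set"
    have idl: "ideal ?I ?A"
      unfolding class_A0_def alg_A0_def by (rule A0.ideal_Q[OF ideal_min_length])
    interpret I: ideal ?I ?A by (rule idl)
    interpret F: ring ?F by (rule ring_free_algebra)
    let ?g = "\<lambda>x. ?I +>\<^bsub>?A\<^esub> ?f x"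
    have "?g \<in> Ring.ring_hom ?F (?A Quot ?I)"
    proof -
      have "?f \<in> Ring.ring_hom ?F ?A" using hom by (simp add: aug_hom_def)
      from ring_hom_trans[OF this I.rcos_ring_hom] show ?thesis by (simp add: comp_def)
    qed
    then interpret g: ring_hom_ring ?F "?A Quot ?I" ?g
      by (intro ring_hom_ringI2 F.ring_axioms I.quotient_is_ring)
    have f_carrier: "?f x \<in> carrier ?A" for x
      by (simp add: canonical_map_eq alg_A0_def class_A0_def A0.Q_simps)
    have ker: "a_kernel ?F (?A Quot ?I) ?g = min_length n"
    proof -
      have "?g x = ?I \<longleftrightarrow> ?f x \<in> ?I" for x
        using I.a_rcos_self[OF f_carrier[of x]] I.a_coset_join2[OF f_carrier[of x] I.a_subgroup] by auto
      also have "?f x \<in> ?I \<longleftrightarrow> x \<in> min_length n" for x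
        using that by (simp add: canonical_map_eq class_A0_def A0.cls_image_iff mem_ideal_J0_plus incl_in_J0_plus_iff)
      finally have mem: "?g x = ?I \<longleftrightarrow> x \<in> min_length n" for x .
      have "\<zero>\<^bsub>?A Quot ?I\<^esub> = ?I" by (simp add: FactRing_def)
      then show ?thesis unfolding a_kernel_def' by (simp only: mem free_algebra_simps UNIV_I simp_thms Collect_mem_eq)
    qed
    have surj: "?g ` carrier ?F = carrier (?A Quot ?I)"
    proof (intro equalityI subsetI)
      fix X assume "X \<in> carrier (?A Quot ?I)"
      then obtain p where X: "X = ?I +>\<^bsub>?A\<^esub> class_A0 p"
        by (auto simp: FactRing_def A_RCOSETS_def' alg_A0_def class_A0_def A0.Q_simps)
      from incl_rho[of p n] obtain u where u: "u \<in> min_length n" "p - incl (rho n p) - u \<in> ideal_J0"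
        unfolding mem_ideal_J0_plus[symmetric] by blast
      then have "class_A0 p = class_A0 u \<oplus>\<^bsub>?A\<^esub> ?f (rho n p)"
        by (simp add: canonical_map_eq class_A0_def alg_A0_def A0.add_Q A0.cls_eq_iff algebra_simps)
      with u have "class_A0 p \<in> ?I +>\<^bsub>?A\<^esub> ?f (rho n p)"
        unfolding a_r_coset_def' by blast
      then have "X = ?g (rho n p)"
        unfolding X by (rule I.a_repr_independence'[OF _ f_carrier, symmetric])
      then show "X \<in> ?g ` carrier ?F" unfolding free_algebra_simps by (rule range_eqI)
    next
      fix X assume "X \<in> ?g ` carrier ?F"
      then show "X \<in> carrier (?A Quot ?I)" using g.hom_closed by blast
    qed
    let ?h = "\<lambda>X. the_elem (?g ` X)"
    have iso: "?h \<in> ring_iso (?F Quot min_length n) (?A Quot ?I)"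
      using g.FactRing_iso_set[OF surj] unfolding ker .
    have "?g ` (min_length n +>\<^bsub>?F\<^esub> x) = {?g x}" for x
    proof -
      have "x \<in> min_length n +>\<^bsub>?F\<^esub> x" by (auto simp: a_r_coset_free_algebra image_iff intro: bexI[of _ 0])
      moreover have "?g y = ?g x" if "y \<in> min_length n +>\<^bsub>?F\<^esub> x" for y
        using g.rcos_imp_homeq[of x y] that unfolding ker by simp
      ultimately show ?thesis by blast
    qed
    then show ?thesis by (intro bexI[OF _ iso] allI) (simp only: the_elem_eq)
  qed
  with free A hom show ?thesis
    unfolding para_equivalence_def ideal_power_free_algebra
    by (simp add: alg_A0_def A0.ideal_power_Q class_A0_def)
qed

lemma omega_A0_eq: "omega_A0 = class_A0 ` ideal_J"
proof -
  have "class_A0 p \<in> omega_A0 \<longleftrightarrow> p \<in> ideal_J" for p :: "'a P"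
    unfolding J_eq_Inter[symmetric] omega_A0_def aug_ideal_omega_def alg_A0_def A0.ideal_power_Q class_A0_def
    by (simp add: A0.cls_image_iff mem_ideal_J0_plus del: image_iff)
  moreover have "omega_A0 \<subseteq> (class_A0 ` UNIV :: 'a P set set)"
    unfolding omega_A0_def aug_ideal_omega_def alg_A0_def A0.ideal_power_Q class_A0_def by blast
  ultimately show ?thesis by blast
qed

lemma omega_A0_eq_kernel: "omega_A0 = a_kernel alg_A0 alg_A proj_A"
proof -
  have "proj_A (class_A0 p) = ideal_J +>\<^bsub>free_algebra\<^esub> p" for p :: "'a P"
  proof -
    have mem: "x \<in> ideal_J <+>\<^bsub>free_algebra\<^esub> (ideal_J0 +>\<^bsub>free_algebra\<^esub> p) \<longleftrightarrow> x - p \<in> ideal_J" for x :: "'a P"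
    proof
      assume "x \<in> ideal_J <+>\<^bsub>free_algebra\<^esub> (ideal_J0 +>\<^bsub>free_algebra\<^esub> p)"
      then obtain j k where "j \<in> ideal_J" "k \<in> ideal_J0" "x = j + (k + p)"
        by (auto simp: set_add_def' a_r_coset_free_algebra)
      moreover from this have "x - p = j + k" by simp
      ultimately show "x - p \<in> ideal_J" using J.add J0_subset_J by auto
    next
      assume "x - p \<in> ideal_J"
      moreover have "x = (x - p) + (0 + p)" by simp
      ultimately show "x \<in> ideal_J <+>\<^bsub>free_algebra\<^esub> (ideal_J0 +>\<^bsub>free_algebra\<^esub> p)"
        using J0.zero by (force simp: set_add_def' a_r_coset_free_algebra)
    qed
    show ?thesis
      by (rule Set.set_eqI) (simp only: proj_A_def class_A0_def A.mem_cls_iff mem)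
  qed
  then have proj: "proj_A (class_A0 p) = ideal_J \<longleftrightarrow> p \<in> ideal_J" for p :: "'a P"
    by (simp only: A.cls_eq_K_iff)
  have carrier: "carrier alg_A0 = (range class_A0 :: 'a P set set)"
    unfolding alg_A0_def A0.carrier_Q class_A0_def ..
  have zero: "\<zero>\<^bsub>alg_A\<^esub> = (ideal_J :: 'a P set)"
    unfolding alg_A_def by (rule A.zero_Q)
  have "{X \<in> range class_A0. proj_A X = ideal_J} = class_A0 ` (ideal_J :: 'a P set)"
  proof (intro equalityI subsetI)
    fix X :: "'a P set" assume "X \<in> {X \<in> range class_A0. proj_A X = ideal_J}"
    then obtain p where "X = class_A0 p" "proj_A (class_A0 p) = ideal_J" by blast
    then show "X \<in> class_A0 ` ideal_J" unfolding proj by (intro image_eqI)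
  next
    fix X :: "'a P set" assume "X \<in> class_A0 ` ideal_J"
    then obtain p where p: "X = class_A0 p" "p \<in> ideal_J" by blast
    from p(2) show "X \<in> {X \<in> range class_A0. proj_A X = ideal_J}"
      unfolding p(1) proj[symmetric] by (intro CollectI conjI rangeI)
  qed
  then show ?thesis
    unfolding omega_A0_eq a_kernel_def' carrier zero by (rule sym)
qed

lemma omega_dec_eq: "omega_dec = class_A0 ` decomposables ideal_J"
proof -
  let ?A = "alg_A0 :: ('a, 'a P set) aug_algebra"
  have "(class_A0 ` I) <+>\<^bsub>?A\<^esub> (class_A0 ` L) = class_A0 ` ideal_sum I L" for I L :: "'a P set"
  proof -
    have add: "class_A0 p \<oplus>\<^bsub>?A\<^esub> class_A0 q = class_A0 (p + q)" for p q :: "'a P"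
      by (simp add: alg_A0_def class_A0_def A0.add_Q)
    show ?thesis
    proof (intro equalityI subsetI)
      fix X assume "X \<in> (class_A0 ` I) <+>\<^bsub>?A\<^esub> (class_A0 ` L)"
      then obtain p q where "p \<in> I" "q \<in> L" "X = class_A0 (p + q)"
        unfolding set_add_def' by (elim UN_E imageE) (simp add: add)
      then show "X \<in> class_A0 ` ideal_sum I L"
        unfolding ideal_sum_def by (intro image_eqI[of _ _ "p + q"] CollectI exI conjI) auto
    next
      fix X assume "X \<in> class_A0 ` ideal_sum I L"
      then obtain p q where "p \<in> I" "q \<in> L" "X = class_A0 p \<oplus>\<^bsub>?A\<^esub> class_A0 q"
        unfolding ideal_sum_def by (elim imageE CollectE exE conjE) (simp add: add)
      then show "X \<in> (class_A0 ` I) <+>\<^bsub>?A\<^esub> (class_A0 ` L)"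
        unfolding set_add_def' by (intro UN_I[OF imageI] singletonI) simp_all
    qed
  qed
  then show ?thesis
    unfolding omega_dec_def omega_A0_eq decomposables_def
    by (simp add: alg_A0_def class_A0_def A0.aug_ideal_Q A0.ideal_prod_Q)
qed

text \<open>In \<open>A\<^sub>0\<close> the relators \<open>w\<^sub>0\<close> and \<open>w\<^sub>1\<close> are zero, so their coordinates are forgotten.\<close>

definition trunc :: "(nat \<Rightarrow>\<^sub>0 'k::field) \<Rightarrow> (nat \<Rightarrow>\<^sub>0 'k)" where
  "trunc = free.lin_ext (\<lambda>l. if 2 \<le> l then Poly_Mapping.single l 1 else 0)"

lemma lookup_trunc: "Poly_Mapping.lookup (trunc r) l = (if 2 \<le> l then Poly_Mapping.lookup r l else 0)"
  unfolding trunc_def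
  by (induction r rule: poly_mapping_single_induct)
    (auto simp: free.lin_ext_simps lookup_add lookup_single mult_single when_def)

text \<open>The truncated relator coordinates vanish on \<open>J\<^sub>0\<close> and hence descend to \<open>A\<^sub>0\<close>.  On the image of
  \<open>J\<close> their kernel is the image of \<open>J\<^sub>0 + IJ + JI\<close>, which is that of \<open>IJ + JI\<close>.\<close>

lemma omega_quot_iso:
  obtains T where "T \<in> vs_iso (omega_quot :: ('k::field, 'k P set set) module) (free_vs {2::nat..})"
    and "\<And>l. l \<ge> 2 \<Longrightarrow> T (omega_dec +>\<^bsub>alg_A0\<^esub> class_A0 (rel_w l)) = Poly_Mapping.single l 1"
proof -
  let ?A = "alg_A0 :: ('k, 'k P set) aug_algebra"
  have vs: "vectorspace class_ring ?A" unfolding alg_A0_def by (rule A0.vectorspace_Q)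
  have sub: "submodule class_ring (class_A0 ` I) ?A"
    if "ideal I (free_algebra :: ('k, gens6 word \<Rightarrow>\<^sub>0 'k) aug_algebra)" for I
  proof -
    interpret I: free_ideal I by (rule free_ideal.intro[OF that])
    show ?thesis using vs I.zero A0.cls_zero
      by (auto simp: submodule_def vectorspace_def alg_A0_def class_A0_def A0.Q_simps
          intro: I.add I.lmult) force?
  qed
  interpret D: free_ideal "decomposables ideal_J :: 'k P set"
    by (rule free_ideal.intro[OF ideal_decomposables[OF J.ideal]])
  have D_J: "x \<in> ideal_J" if "x \<in> decomposables ideal_J" for x :: "'k P"
    using that by (induction rule: decomposables_induct) (auto intro: J.add J.lmult J.rmult)
  interpret q: quot_space ?A "class_A0 ` ideal_J" "class_A0 ` decomposables ideal_J"
    by (rule quot_space.intro[OF vs sub[OF J.ideal] sub[OF D.ideal] image_mono]) (rule subsetI, rule D_J)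
  \<comment> \<open>any representative will do, because the truncated coordinates vanish on \<open>J\<^sub>0\<close>\<close>
  define L where "L X = trunc (relator_coord (SOME p. X = class_A0 p))" for X :: "'k P set"
  have L: "L (class_A0 p) = trunc (relator_coord p)" for p
  proof -
    let ?q = "SOME q. class_A0 p = class_A0 q"
    have "class_A0 p = class_A0 ?q" by (rule someI[of _ p]) simp
    then have "p - ?q \<in> ideal_J0" by (simp add: class_A0_def A0.cls_eq_iff)
    then have "Poly_Mapping.lookup (relator_coord (p - ?q)) l = 0" if "l \<ge> 2" for l
      using that by (rule relator_coord_J0)
    moreover have "relator_coord p = relator_coord (p - ?q) + relator_coord ?q"
      by (simp flip: relator_coord_add)
    ultimately show ?thesis unfolding L_def
      by (intro poly_mapping_eqI) (simp add: lookup_trunc lookup_add)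
  qed
  obtain T where T: "T \<in> vs_iso (quot_vs ?A (class_A0 ` ideal_J) (class_A0 ` decomposables ideal_J)) (free_vs {2..})"
    and TL: "\<And>u. u \<in> class_A0 ` ideal_J \<Longrightarrow> T (class_A0 ` decomposables ideal_J +>\<^bsub>?A\<^esub> u) = L u"
  proof (rule q.quot_vs_iso[OF vectorspace_free_vs])
    show "L ` class_A0 ` ideal_J = carrier (free_vs {2..})"
    proof (intro equalityI subsetI)
      fix z :: "nat \<Rightarrow>\<^sub>0 'k" assume "z \<in> carrier (free_vs {2..})"
      then have "trunc z = z"
        by (intro poly_mapping_eqI) (auto simp: lookup_trunc in_keys_iff)
      then have "z = L (class_A0 (w_comb z))" by (simp add: L relator_coord_w_comb)
      then show "z \<in> L ` class_A0 ` ideal_J" using w_comb_in_J by blast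
    qed (auto simp: L in_keys_iff lookup_trunc split: if_splits)
  next
    fix u v :: "'k P set" and c :: 'k
    assume u: "u \<in> class_A0 ` ideal_J"
    then obtain p where p: "p \<in> ideal_J" "u = class_A0 p" by auto
    have cadd: "class_A0 p \<oplus>\<^bsub>?A\<^esub> class_A0 q = class_A0 (p + q)" 
      and csm: "c \<odot>\<^bsub>?A\<^esub> class_A0 q = class_A0 (const c * q)" for p q :: "'k P" and c
      by (simp_all add: class_A0_def alg_A0_def A0.Q_simps)
    { assume "v \<in> class_A0 ` ideal_J"
      with p show "L (u \<oplus>\<^bsub>?A\<^esub> v) = L u \<oplus>\<^bsub>free_vs {2..}\<^esub> L v"
        by (auto simp: cadd L relator_coord_add trunc_def free.lin_ext_add) }
    show "L (c \<odot>\<^bsub>?A\<^esub> u) = c \<odot>\<^bsub>free_vs {2..}\<^esub> L u"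
      by (intro poly_mapping_eqI) (simp add: p csm L relator_coord_const lookup_trunc lookup_map_scale)
    show "L u = \<zero>\<^bsub>free_vs {2..}\<^esub> \<longleftrightarrow> u \<in> class_A0 ` decomposables ideal_J"
    proof
      assume "L u = \<zero>\<^bsub>free_vs {2..}\<^esub>"
      then have "trunc (relator_coord p) = 0" by (simp add: p L)
      then have "Poly_Mapping.lookup (relator_coord p) l = 0" if "l \<ge> 2" for l
        using that lookup_trunc[of "relator_coord p" l] by simp
      then have r: "relator_coord p = Poly_Mapping.single 0 (Poly_Mapping.lookup (relator_coord p) 0)
          + Poly_Mapping.single 1 (Poly_Mapping.lookup (relator_coord p) 1)" (is "_ = ?r")
      proof (intro poly_mapping_eqI)
        fix l :: nat
        assume *: "\<And>l. 2 \<le> l \<Longrightarrow> Poly_Mapping.lookup (relator_coord p) l = 0"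
        consider "l = 0" | "l = 1" | "2 \<le> l" by linarith
        then show "Poly_Mapping.lookup (relator_coord p) l = Poly_Mapping.lookup ?r l"
          using * by cases (simp_all add: lookup_add lookup_single when_def)
      qed
      have "w_comb (relator_coord p) \<in> ideal_J0"
        unfolding arg_cong[OF r, of w_comb] w_comb_add w_comb_single by (intro J0.add J0.lmult rel_w_in_J0)
      then have "u = class_A0 (p - w_comb (relator_coord p))"
        by (simp add: p class_A0_def A0.cls_eq_iff)
      then show "u \<in> class_A0 ` decomposables ideal_J"
        using J_mod_decomposables[OF p(1)] by blast
    next
      assume "u \<in> class_A0 ` decomposables ideal_J"
      then show "L u = \<zero>\<^bsub>free_vs {2..}\<^esub>"
        by (auto simp: L relator_coord_decomposables trunc_def free.lin_ext_zero)
    qed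
  next
    fix T
    assume "T \<in> vs_iso (quot_vs ?A (class_A0 ` ideal_J) (class_A0 ` decomposables ideal_J)) (free_vs {2..})"
      and "\<And>u. u \<in> class_A0 ` ideal_J \<Longrightarrow> T (class_A0 ` decomposables ideal_J +>\<^bsub>?A\<^esub> u) = L u"
    then show thesis by (rule that)
  qed
  show thesis
  proof (rule that[of T])
    show "T \<in> vs_iso omega_quot (free_vs {2..})"
      using T by (simp add: omega_quot_def omega_A0_eq omega_dec_eq)
    fix l :: nat assume "l \<ge> 2"
    then have "trunc (Poly_Mapping.single l 1) = (Poly_Mapping.single l 1 :: nat \<Rightarrow>\<^sub>0 'k)"
      by (intro poly_mapping_eqI) (auto simp: lookup_trunc lookup_single when_def)
    then show "T (omega_dec +>\<^bsub>alg_A0\<^esub> class_A0 (rel_w l)) = Poly_Mapping.single l 1"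
      using TL[of "class_A0 (rel_w l)"] by (simp add: omega_dec_eq rel_w_in_J L relator_coord_rel_w)
  qed
qed

section \<open>Modules over a noncommutative ring and their canonical free covers\<close>

locale left_module = ring B + N: abelian_group N
  for B :: "('b, 'm) ring_scheme" and N :: "('b, 'n, 'l) module_scheme" +
  assumes lm_closed: "b \<in> carrier B \<Longrightarrow> n \<in> carrier N \<Longrightarrow> b \<odot>\<^bsub>N\<^esub> n \<in> carrier N"
    and lm_l_distr: "b \<in> carrier B \<Longrightarrow> c \<in> carrier B \<Longrightarrow> n \<in> carrier N \<Longrightarrow>
      (b \<oplus>\<^bsub>B\<^esub> c) \<odot>\<^bsub>N\<^esub> n = b \<odot>\<^bsub>N\<^esub> n \<oplus>\<^bsub>N\<^esub> c \<odot>\<^bsub>N\<^esub> n"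
    and lm_r_distr: "b \<in> carrier B \<Longrightarrow> n \<in> carrier N \<Longrightarrow> n' \<in> carrier N \<Longrightarrow>
      b \<odot>\<^bsub>N\<^esub> (n \<oplus>\<^bsub>N\<^esub> n') = b \<odot>\<^bsub>N\<^esub> n \<oplus>\<^bsub>N\<^esub> b \<odot>\<^bsub>N\<^esub> n'"
    and lm_assoc: "b \<in> carrier B \<Longrightarrow> c \<in> carrier B \<Longrightarrow> n \<in> carrier N \<Longrightarrow>
      (b \<otimes>\<^bsub>B\<^esub> c) \<odot>\<^bsub>N\<^esub> n = b \<odot>\<^bsub>N\<^esub> (c \<odot>\<^bsub>N\<^esub> n)"
    and lm_one: "n \<in> carrier N \<Longrightarrow> \<one>\<^bsub>B\<^esub> \<odot>\<^bsub>N\<^esub> n = n"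
begin

lemma lm_l_zero: "n \<in> carrier N \<Longrightarrow> \<zero>\<^bsub>B\<^esub> \<odot>\<^bsub>N\<^esub> n = \<zero>\<^bsub>N\<^esub>"
  using lm_l_distr[of "\<zero>\<^bsub>B\<^esub>" "\<zero>\<^bsub>B\<^esub>" n] lm_closed[of "\<zero>\<^bsub>B\<^esub>" n]
  by (metis N.add.r_cancel_one' l_zero zero_closed)

lemma lm_r_zero: "b \<in> carrier B \<Longrightarrow> b \<odot>\<^bsub>N\<^esub> \<zero>\<^bsub>N\<^esub> = \<zero>\<^bsub>N\<^esub>"
  using lm_r_distr[of b "\<zero>\<^bsub>N\<^esub>" "\<zero>\<^bsub>N\<^esub>"] lm_closed[of b "\<zero>\<^bsub>N\<^esub>"]
  by (metis N.add.r_cancel_one' N.l_zero N.zero_closed)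

lemma lm_minus: "n \<in> carrier N \<Longrightarrow> (\<ominus>\<^bsub>B\<^esub> \<one>\<^bsub>B\<^esub>) \<odot>\<^bsub>N\<^esub> n = \<ominus>\<^bsub>N\<^esub> n"
proof -
  assume n: "n \<in> carrier N"
  have "(\<ominus>\<^bsub>B\<^esub> \<one>\<^bsub>B\<^esub>) \<odot>\<^bsub>N\<^esub> n \<oplus>\<^bsub>N\<^esub> n = (\<ominus>\<^bsub>B\<^esub> \<one>\<^bsub>B\<^esub> \<oplus>\<^bsub>B\<^esub> \<one>\<^bsub>B\<^esub>) \<odot>\<^bsub>N\<^esub> n"
    using n by (simp add: lm_l_distr lm_one)
  also have "\<dots> = \<zero>\<^bsub>N\<^esub>" using n by (simp add: l_neg lm_l_zero)
  finally show ?thesis using n by (intro N.minus_equality[symmetric]) (auto simp: lm_closed)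
qed

end

lemma free_lmodule_simps:
  "carrier (free_lmodule B S) = {f. (\<forall>s\<in>S. f s \<in> carrier B) \<and> (\<forall>s. s \<notin> S \<longrightarrow> f s = \<zero>\<^bsub>B\<^esub>) \<and>
     finite {s. f s \<noteq> \<zero>\<^bsub>B\<^esub>}}"
  "\<zero>\<^bsub>free_lmodule B S\<^esub> = (\<lambda>s. \<zero>\<^bsub>B\<^esub>)"
  "f \<oplus>\<^bsub>free_lmodule B S\<^esub> g = (\<lambda>s. f s \<oplus>\<^bsub>B\<^esub> g s)"
  "b \<odot>\<^bsub>free_lmodule B S\<^esub> f = (\<lambda>s. b \<otimes>\<^bsub>B\<^esub> f s)"
  by (simp_all add: free_lmodule_def)

definition unit_fun :: "('b, 'm) ring_scheme \<Rightarrow> 's \<Rightarrow> 's \<Rightarrow> 'b" where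
  "unit_fun B s = (\<lambda>t. if t = s then \<one>\<^bsub>B\<^esub> else \<zero>\<^bsub>B\<^esub>)"

context ring
begin

lemma free_lmodule_value: "f \<in> carrier (free_lmodule R S) \<Longrightarrow> f s \<in> carrier R"
  by (cases "s \<in> S") (auto simp: free_lmodule_simps)

lemma left_module_free_lmodule: "left_module R (free_lmodule R S)"
proof -
  have fin: "finite {s. f s \<oplus> g s \<noteq> \<zero>}" if "finite {s. f s \<noteq> \<zero>}" "finite {s. g s \<noteq> \<zero>}" for f g :: "'s \<Rightarrow> 'a"
    by (rule finite_subset[OF _ finite_UnI[OF that]]) auto
  have fin': "finite {s. b \<otimes> f s \<noteq> \<zero>}" if "finite {s. f s \<noteq> \<zero>}" "b \<in> carrier R" for b and f :: "'s \<Rightarrow> 'a"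
    by (rule finite_subset[OF _ that(1)]) (use that in auto)
  have "abelian_group (free_lmodule R S)"
  proof (rule abelian_groupI)
    fix f g h assume f: "f \<in> carrier (free_lmodule R S)" and g: "g \<in> carrier (free_lmodule R S)"
      and h: "h \<in> carrier (free_lmodule R S)"
    show "f \<oplus>\<^bsub>free_lmodule R S\<^esub> g \<in> carrier (free_lmodule R S)"
      using f g fin by (auto simp: free_lmodule_simps)
    show "f \<oplus>\<^bsub>free_lmodule R S\<^esub> g \<oplus>\<^bsub>free_lmodule R S\<^esub> h = f \<oplus>\<^bsub>free_lmodule R S\<^esub> (g \<oplus>\<^bsub>free_lmodule R S\<^esub> h)"
      using free_lmodule_value[OF f] free_lmodule_value[OF g] free_lmodule_value[OF h]
      by (simp add: free_lmodule_simps a_assoc)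
    show "f \<oplus>\<^bsub>free_lmodule R S\<^esub> g = g \<oplus>\<^bsub>free_lmodule R S\<^esub> f"
      using free_lmodule_value[OF f] free_lmodule_value[OF g] by (simp add: free_lmodule_simps a_comm)
    show "\<zero>\<^bsub>free_lmodule R S\<^esub> \<oplus>\<^bsub>free_lmodule R S\<^esub> f = f"
      using free_lmodule_value[OF f] by (simp add: free_lmodule_simps)
    have "finite {s. \<ominus> f s \<noteq> \<zero>}"
      by (rule finite_subset[of _ "{s. f s \<noteq> \<zero>}"]) (use f in \<open>auto simp: free_lmodule_simps\<close>)
    then show "\<exists>g\<in>carrier (free_lmodule R S). g \<oplus>\<^bsub>free_lmodule R S\<^esub> f = \<zero>\<^bsub>free_lmodule R S\<^esub>"
      using f free_lmodule_value[OF f]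
      by (intro bexI[of _ "\<lambda>s. \<ominus> f s"]) (auto simp: free_lmodule_simps l_neg)
  qed (auto simp: free_lmodule_simps)
  then show ?thesis
    using fin'
    by (intro left_module.intro left_module_axioms.intro ring_axioms)
      (auto simp: free_lmodule_value l_distr r_distr m_assoc free_lmodule_simps(2-4) fun_eq_iff,
       auto simp: free_lmodule_simps)
qed

lemma unit_fun_closed: "s \<in> S \<Longrightarrow> unit_fun R s \<in> carrier (free_lmodule R S)"
  using finite_subset[of "{t. unit_fun R s t \<noteq> \<zero>}" "{s}"]
  by (auto simp: free_lmodule_simps unit_fun_def)

text \<open>Induction over the support.  The set \<open>I\<close> of permitted coefficients allows the induction to stay,
  for instance, within the coefficients of augmentation zero.\<close>

lemma free_lmodule_induct [consumes 3, case_names zero step]: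
  assumes f: "f \<in> carrier (free_lmodule R S)" and I: "\<And>s. f s \<in> I" and I0: "\<zero> \<in> I"
    and zero: "Q (\<lambda>_. \<zero>)"
    and step: "\<And>s b f. s \<in> S \<Longrightarrow> b \<in> carrier R \<Longrightarrow> b \<in> I \<Longrightarrow> f \<in> carrier (free_lmodule R S) \<Longrightarrow>
      (\<And>t. f t \<in> I) \<Longrightarrow> f s = \<zero> \<Longrightarrow> Q f \<Longrightarrow>
      Q (b \<odot>\<^bsub>free_lmodule R S\<^esub> unit_fun R s \<oplus>\<^bsub>free_lmodule R S\<^esub> f)"
  shows "Q f"
proof -
  have "Q f" if "finite A" "{s. f s \<noteq> \<zero>} = A" "f \<in> carrier (free_lmodule R S)" "\<And>s. f s \<in> I" for A f
    using that
  proof (induction A arbitrary: f rule: finite_induct)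
    case empty
    then have "f = (\<lambda>_. \<zero>)" by auto
    with zero show ?case by simp
  next
    case (insert s A)
    let ?g = "f(s := \<zero>)"
    have s: "s \<in> S" using insert.prems(1,2) by (auto simp: free_lmodule_simps)
    have supp: "{t. ?g t \<noteq> \<zero>} = A" using insert.prems(1) insert.hyps(2) by auto
    have g: "?g \<in> carrier (free_lmodule R S)"
      using insert.prems(2) supp insert.hyps(1) by (auto simp: free_lmodule_simps)
    have gI: "?g t \<in> I" for t using insert.prems(3) I0 by simp
    have fs: "f t \<in> carrier R" for t by (rule free_lmodule_value[OF insert.prems(2)])
    have "f = f s \<odot>\<^bsub>free_lmodule R S\<^esub> unit_fun R s \<oplus>\<^bsub>free_lmodule R S\<^esub> ?g"
      using fs by (auto simp: free_lmodule_simps unit_fun_def fun_eq_iff)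
    moreover have "Q (f s \<odot>\<^bsub>free_lmodule R S\<^esub> unit_fun R s \<oplus>\<^bsub>free_lmodule R S\<^esub> ?g)"
      by (rule step[OF s fs insert.prems(3) g gI _ insert.IH[OF supp g gI]]) simp
    ultimately show ?case by simp
  qed
  moreover have "finite {s. f s \<noteq> \<zero>}" using f by (simp add: free_lmodule_simps)
  ultimately show ?thesis using f I by blast
qed

end

context left_module
begin

lemma cover_map_superset:
  assumes "f \<in> carrier (free_cover B N)" "finite A" "A \<subseteq> carrier N" "{n. f n \<noteq> \<zero>\<^bsub>B\<^esub>} \<subseteq> A"
  shows "cover_map B N f = (\<Oplus>\<^bsub>N\<^esub>n\<in>A. f n \<odot>\<^bsub>N\<^esub> n)"
  unfolding cover_map_def
proof (rule N.add.finprod_mono_neutral_cong_left)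
  show "\<And>i. i \<in> A - {n. f n \<noteq> \<zero>\<^bsub>B\<^esub>} \<Longrightarrow> f i \<odot>\<^bsub>N\<^esub> i = \<zero>\<^bsub>N\<^esub>"
    using assms(3) by (auto simp: lm_l_zero)
  show "(\<lambda>n. f n \<odot>\<^bsub>N\<^esub> n) \<in> A \<rightarrow> carrier N"
    using assms(1,3) free_lmodule_value by (auto simp: free_cover_def intro!: lm_closed)
qed (use assms in auto)

lemma free_cover_support:
  assumes "f \<in> carrier (free_cover B N)"
  shows "finite {n. f n \<noteq> \<zero>\<^bsub>B\<^esub>}" "{n. f n \<noteq> \<zero>\<^bsub>B\<^esub>} \<subseteq> carrier N"
  using assms by (auto simp: free_cover_def free_lmodule_simps)

lemma free_cover_value: "f \<in> carrier (free_cover B N) \<Longrightarrow> f n \<in> carrier B"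
  unfolding free_cover_def by (rule free_lmodule_value)

lemma left_module_free_cover: "left_module B (free_cover B N)"
  unfolding free_cover_def by (rule left_module_free_lmodule)

lemma cover_map_closed: "f \<in> carrier (free_cover B N) \<Longrightarrow> cover_map B N f \<in> carrier N"
  unfolding cover_map_def using free_cover_support(2) free_cover_value
  by (intro N.finsum_closed) (auto intro!: lm_closed)

lemma cover_map_add:
  assumes f: "f \<in> carrier (free_cover B N)" and g: "g \<in> carrier (free_cover B N)"
  shows "cover_map B N (f \<oplus>\<^bsub>free_cover B N\<^esub> g) = cover_map B N f \<oplus>\<^bsub>N\<^esub> cover_map B N g"
proof -
  interpret F: left_module B "free_cover B N" by (rule left_module_free_cover)
  let ?A = "{n. f n \<noteq> \<zero>\<^bsub>B\<^esub>} \<union> {n. g n \<noteq> \<zero>\<^bsub>B\<^esub>}"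
  have A: "finite ?A" "?A \<subseteq> carrier N" using free_cover_support f g by auto
  have v: "f n \<in> carrier B" "g n \<in> carrier B" for n using free_cover_value f g by auto
  have fg: "f \<oplus>\<^bsub>free_cover B N\<^esub> g = (\<lambda>n. f n \<oplus>\<^bsub>B\<^esub> g n)"
    by (simp add: free_cover_def free_lmodule_simps)
  have "cover_map B N (f \<oplus>\<^bsub>free_cover B N\<^esub> g) = (\<Oplus>\<^bsub>N\<^esub>n\<in>?A. (f n \<oplus>\<^bsub>B\<^esub> g n) \<odot>\<^bsub>N\<^esub> n)"
    using cover_map_superset[OF F.N.a_closed[OF f g] A] unfolding fg by fastforce
  also have "\<dots> = (\<Oplus>\<^bsub>N\<^esub>n\<in>?A. f n \<odot>\<^bsub>N\<^esub> n \<oplus>\<^bsub>N\<^esub> g n \<odot>\<^bsub>N\<^esub> n)"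
    using A(2) v by (intro N.finsum_cong') (auto simp: lm_l_distr subset_iff intro!: lm_closed)
  also have "\<dots> = (\<Oplus>\<^bsub>N\<^esub>n\<in>?A. f n \<odot>\<^bsub>N\<^esub> n) \<oplus>\<^bsub>N\<^esub> (\<Oplus>\<^bsub>N\<^esub>n\<in>?A. g n \<odot>\<^bsub>N\<^esub> n)"
    using A(2) v by (intro N.finsum_addf) (auto intro!: lm_closed)
  also have "\<dots> = cover_map B N f \<oplus>\<^bsub>N\<^esub> cover_map B N g"
    using cover_map_superset[OF f A] cover_map_superset[OF g A] by auto
  finally show ?thesis .
qed

lemma cover_map_smult:
  assumes f: "f \<in> carrier (free_cover B N)" and b: "b \<in> carrier B"
  shows "cover_map B N (b \<odot>\<^bsub>free_cover B N\<^esub> f) = b \<odot>\<^bsub>N\<^esub> cover_map B N f"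
proof -
  interpret F: left_module B "free_cover B N" by (rule left_module_free_cover)
  let ?A = "{n. f n \<noteq> \<zero>\<^bsub>B\<^esub>}"
  have A: "finite ?A" "?A \<subseteq> carrier N" using free_cover_support f by auto
  have v: "f n \<in> carrier B" for n using free_cover_value f by auto
  have bf: "b \<odot>\<^bsub>free_cover B N\<^esub> f = (\<lambda>n. b \<otimes>\<^bsub>B\<^esub> f n)"
    by (simp add: free_cover_def free_lmodule_simps)
  have "cover_map B N (b \<odot>\<^bsub>free_cover B N\<^esub> f) = (\<Oplus>\<^bsub>N\<^esub>n\<in>?A. (b \<otimes>\<^bsub>B\<^esub> f n) \<odot>\<^bsub>N\<^esub> n)"
    using cover_map_superset[OF F.lm_closed[OF b f] A] b unfolding bf by fastforce
  also have "\<dots> = (\<Oplus>\<^bsub>N\<^esub>n\<in>?A. b \<odot>\<^bsub>N\<^esub> (f n \<odot>\<^bsub>N\<^esub> n))"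
    using A(2) v b by (intro N.finsum_cong') (auto simp: lm_assoc subset_iff intro!: lm_closed)
  also have "\<dots> = b \<odot>\<^bsub>N\<^esub> (\<Oplus>\<^bsub>N\<^esub>n\<in>?A. f n \<odot>\<^bsub>N\<^esub> n)"
    using A
  proof -
    have "(\<Oplus>\<^bsub>N\<^esub>n\<in>X. b \<odot>\<^bsub>N\<^esub> (f n \<odot>\<^bsub>N\<^esub> n)) = b \<odot>\<^bsub>N\<^esub> (\<Oplus>\<^bsub>N\<^esub>n\<in>X. f n \<odot>\<^bsub>N\<^esub> n)"
      if "finite X" "X \<subseteq> carrier N" for X
      using that
    proof (induction X rule: finite_induct)
      case empty
      then show ?case using b by (simp add: lm_r_zero)
    next
      case (insert x X)
      then have x: "x \<in> carrier N" and X: "X \<subseteq> carrier N" by auto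
      have "(\<Oplus>\<^bsub>N\<^esub>n\<in>X. f n \<odot>\<^bsub>N\<^esub> n) \<in> carrier N"
        using X v by (intro N.finsum_closed) (auto intro!: lm_closed)
      then have "b \<odot>\<^bsub>N\<^esub> (f x \<odot>\<^bsub>N\<^esub> x) \<oplus>\<^bsub>N\<^esub> b \<odot>\<^bsub>N\<^esub> (\<Oplus>\<^bsub>N\<^esub>n\<in>X. f n \<odot>\<^bsub>N\<^esub> n)
          = b \<odot>\<^bsub>N\<^esub> (f x \<odot>\<^bsub>N\<^esub> x \<oplus>\<^bsub>N\<^esub> (\<Oplus>\<^bsub>N\<^esub>n\<in>X. f n \<odot>\<^bsub>N\<^esub> n))"
        using lm_r_distr[OF b lm_closed[OF v x]] by simp
      then show ?case
        using insert.hyps insert.IH[OF X] x X v b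
        by (subst (1 2) N.finsum_insert) (auto intro!: lm_closed)
    qed
    with A show ?thesis by blast
  qed
  also have "\<dots> = b \<odot>\<^bsub>N\<^esub> cover_map B N f"
    using cover_map_superset[OF f A] by auto
  finally show ?thesis .
qed

lemma cover_map_zero: "cover_map B N \<zero>\<^bsub>free_cover B N\<^esub> = \<zero>\<^bsub>N\<^esub>"
  by (simp add: cover_map_def free_cover_def free_lmodule_simps)

lemma unit_fun_in_free_cover: "n \<in> carrier N \<Longrightarrow> unit_fun B n \<in> carrier (free_cover B N)"
  unfolding free_cover_def by (rule unit_fun_closed)

lemma cover_map_unit_fun:
  assumes "n \<in> carrier N"
  shows "cover_map B N (unit_fun B n) = n"
proof -
  have "cover_map B N (unit_fun B n) = (\<Oplus>\<^bsub>N\<^esub>m\<in>{n}. unit_fun B n m \<odot>\<^bsub>N\<^esub> m)"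
    by (rule cover_map_superset[OF unit_fun_in_free_cover[OF assms]]) (use assms in \<open>auto simp: unit_fun_def\<close>)
  also have "\<dots> = n" using assms by (simp add: unit_fun_def lm_one)
  finally show ?thesis .
qed

lemma syzygy_simps:
  "carrier (syzygy B N) = {f \<in> carrier (free_cover B N). cover_map B N f = \<zero>\<^bsub>N\<^esub>}"
  "\<zero>\<^bsub>syzygy B N\<^esub> = \<zero>\<^bsub>free_cover B N\<^esub>"
  "f \<oplus>\<^bsub>syzygy B N\<^esub> g = f \<oplus>\<^bsub>free_cover B N\<^esub> g"
  "b \<odot>\<^bsub>syzygy B N\<^esub> f = b \<odot>\<^bsub>free_cover B N\<^esub> f"
  by (simp_all add: syzygy_def)

lemma left_module_syzygy: "left_module B (syzygy B N)"
proof -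
  interpret F: left_module B "free_cover B N" by (rule left_module_free_cover)
  have "abelian_group (syzygy B N)"
  proof (rule abelian_groupI)
    fix f assume f: "f \<in> carrier (syzygy B N)"
    then have "cover_map B N ((\<ominus>\<^bsub>B\<^esub> \<one>\<^bsub>B\<^esub>) \<odot>\<^bsub>free_cover B N\<^esub> f) = \<zero>\<^bsub>N\<^esub>"
      by (simp add: syzygy_simps cover_map_smult lm_r_zero)
    then show "\<exists>g\<in>carrier (syzygy B N). g \<oplus>\<^bsub>syzygy B N\<^esub> f = \<zero>\<^bsub>syzygy B N\<^esub>"
      using f by (intro bexI[of _ "(\<ominus>\<^bsub>B\<^esub> \<one>\<^bsub>B\<^esub>) \<odot>\<^bsub>free_cover B N\<^esub> f"])
        (auto simp: syzygy_simps F.lm_minus F.N.l_neg F.lm_closed)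
  qed (auto simp: syzygy_simps cover_map_add cover_map_zero F.N.a_ac)
  then show ?thesis
    by (intro left_module.intro left_module_axioms.intro ring_axioms)
      (auto simp: syzygy_simps F.lm_closed cover_map_smult lm_r_zero F.lm_l_distr F.lm_r_distr
        F.lm_assoc F.lm_one)
qed

end

section \<open>Tensoring with the ground field\<close>

lemma submodule_carrier:
  assumes "vectorspace (class_ring :: 'k::field ring) V"
  shows "submodule class_ring (carrier V) V"
proof -
  interpret vectorspace class_ring V by fact
  show ?thesis by (intro submodule.intro module_axioms) auto
qed

lemma triv_module_simps [simp]:
  "carrier (triv_module B) = UNIV" "\<zero>\<^bsub>triv_module B\<^esub> = 0"
  "t \<oplus>\<^bsub>triv_module B\<^esub> u = t + u" "b \<odot>\<^bsub>triv_module B\<^esub> t = aug B b * t"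
  by (simp_all add: triv_module_def)

context augmented_algebra
begin

lemma aug_simps:
  "aug B \<one> = 1" "aug B \<zero> = 0" "x \<in> carrier B \<Longrightarrow> y \<in> carrier B \<Longrightarrow> aug B (x \<oplus> y) = aug B x + aug B y"
  "x \<in> carrier B \<Longrightarrow> y \<in> carrier B \<Longrightarrow> aug B (x \<otimes> y) = aug B x * aug B y"
proof -
  have ring: "ring B" by unfold_locales
  show one: "aug B \<one> = 1" using ring_hom_one[OF aug_ring_hom] by simp
  show add: "aug B (x \<oplus> y) = aug B x + aug B y" if "x \<in> carrier B" "y \<in> carrier B" for x y
    using ring_hom_add[OF aug_ring_hom that] by simp
  show "aug B (x \<otimes> y) = aug B x * aug B y" if "x \<in> carrier B" "y \<in> carrier B" for x y
    using ring_hom_mult[OF aug_ring_hom that] by simp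
  have "\<zero> \<oplus> \<zero> = \<zero>" by (simp add: ring.ring_simprules[OF ring])
  then show "aug B \<zero> = 0" using add[of \<zero> \<zero>] ring.ring_simprules(2)[OF ring] by (metis add_cancel_right_right)
qed

lemma left_module_triv: "left_module B (triv_module B)"
proof -
  have ring: "ring B" by unfold_locales
  have "abelian_group (triv_module B)"
    by (rule abelian_groupI) (auto simp: add_ac intro: exI[of _ "- _"])
  then show ?thesis
    by (intro left_module.intro left_module_axioms.intro ring)
      (auto simp: aug_simps algebra_simps)
qed

end

text \<open>Over a field the balanced relations turn every tensor into a pure one \<open>1 \<otimes> n\<close> (see
  \<open>carrier_Tens\<close>); thus the tensor product is the quotient of the module by the augmentation ideal,
  and \<open>pure_tensor\<close> is the quotient map.\<close>

definition pure_tensor ::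
  "('k::field, 'b, 'm) aug_algebra_scheme \<Rightarrow> ('b, 'n, 'j) module_scheme \<Rightarrow> 'n \<Rightarrow> ('k \<times> 'n \<Rightarrow>\<^sub>0 'k) set" where
  "pure_tensor B N n = tensor_rel B (triv_module B) N +>\<^bsub>free_vs (UNIV \<times> carrier N)\<^esub>
     Poly_Mapping.single (1, n) 1"

locale aug_left_module = augmented_algebra B + left_module B N
  for B :: "('k::field, 'b, 'm) aug_algebra_scheme" and N :: "('b, 'n, 'j) module_scheme"
begin

abbreviation Fr :: "('k, 'k \<times> 'n \<Rightarrow>\<^sub>0 'k) module" where
  "Fr \<equiv> free_vs (UNIV \<times> carrier N)"

abbreviation rel :: "('k \<times> 'n \<Rightarrow>\<^sub>0 'k) set" where
  "rel \<equiv> tensor_rel B (triv_module B) N"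

abbreviation Tens :: "('k, ('k \<times> 'n \<Rightarrow>\<^sub>0 'k) set) module" where
  "Tens \<equiv> tensor B (triv_module B) N"

lemma tensor_relators_carrier: "tensor_relators B (triv_module B) N \<subseteq> carrier Fr"
  unfolding tensor_relators_def
  by (auto simp: in_keys_iff lookup_minus lookup_single when_def lm_closed split: if_splits)

lemma submodule_rel: "submodule class_ring rel Fr"
proof -
  interpret vectorspace "class_ring :: 'k ring" Fr by (rule vectorspace_free_vs)
  show ?thesis
    using span_is_submodule[OF tensor_relators_carrier] by (simp add: tensor_rel_def)
qed

lemma relator_in_rel: "z \<in> tensor_relators B (triv_module B) N \<Longrightarrow> z \<in> rel"
proof -
  interpret vectorspace "class_ring :: 'k ring" Fr by (rule vectorspace_free_vs)
  show "z \<in> tensor_relators B (triv_module B) N \<Longrightarrow> z \<in> rel"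
    using in_own_span[OF tensor_relators_carrier] by (auto simp: tensor_rel_def)
qed

lemma rel_least:
  assumes "submodule class_ring M Fr" "tensor_relators B (triv_module B) N \<subseteq> M"
  shows "rel \<subseteq> M"
proof -
  interpret vectorspace "class_ring :: 'k ring" Fr by (rule vectorspace_free_vs)
  show ?thesis
    using span_is_subset[OF assms(2,1)] by (simp add: tensor_rel_def)
qed

lemma quot_space_tensor: "quot_space Fr (carrier Fr) rel"
  using submodule_rel submodule.subset[OF submodule_rel]
  by (intro quot_space.intro vectorspace_free_vs submodule_carrier)

lemma Tens_eq: "Tens = quot_vs Fr (carrier Fr) rel"
  by (simp add: tensor_def)

lemma vectorspace_Tens: "vectorspace class_ring Tens"
  unfolding Tens_eq by (rule quot_space.vectorspace_quot_vs[OF quot_space_tensor])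

lemma coset_eqI:
  assumes "y \<in> carrier Fr" "y - z \<in> rel" "z \<in> carrier Fr"
  shows "rel +>\<^bsub>Fr\<^esub> y = rel +>\<^bsub>Fr\<^esub> z"
proof -
  interpret q: quot_space Fr "carrier Fr" rel by (rule quot_space_tensor)
  have "y \<ominus>\<^bsub>Fr\<^esub> z = y - z"
    using q.minus_eq[OF assms(3)] by (simp add: a_minus_def map_scale_simps)
  with assms show ?thesis by (simp add: q.coset_eq_iff)
qed

lemma single_in_Fr: "n \<in> carrier N \<Longrightarrow> Poly_Mapping.single (m, n) c \<in> carrier Fr"
  by simp

lemma pure_tensor_add:
  assumes "n \<in> carrier N" "n' \<in> carrier N"
  shows "pure_tensor B N (n \<oplus>\<^bsub>N\<^esub> n') = pure_tensor B N n \<oplus>\<^bsub>Tens\<^esub> pure_tensor B N n'"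
proof -
  interpret q: quot_space Fr "carrier Fr" rel by (rule quot_space_tensor)
  let ?s = "\<lambda>n. Poly_Mapping.single (1, n) 1 :: 'k \<times> 'n \<Rightarrow>\<^sub>0 'k"
  have "?s (n \<oplus>\<^bsub>N\<^esub> n') - ?s n - ?s n' \<in> rel"
    using assms by (intro relator_in_rel) (auto simp: tensor_relators_def)
  then have "rel +>\<^bsub>Fr\<^esub> ?s (n \<oplus>\<^bsub>N\<^esub> n') = rel +>\<^bsub>Fr\<^esub> (?s n + ?s n')"
    using assms keys_add[of "?s n" "?s n'"] by (intro coset_eqI) (auto simp: algebra_simps)
  then show ?thesis
    using q.quot_vs_simps(3)[of "?s n" "?s n'"] assms by (simp add: pure_tensor_def Tens_eq)
qed

text \<open>A tensor \<open>m \<otimes> n\<close> is a multiple of \<open>1 \<otimes> n\<close>, because the scalar \<open>m\<close> is the augmentation of a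
  multiple of the unit of the algebra.\<close>

lemma single_coset:
  assumes "n \<in> carrier N"
  shows "rel +>\<^bsub>Fr\<^esub> Poly_Mapping.single (m, n) c = (c * m) \<odot>\<^bsub>Tens\<^esub> pure_tensor B N n"
proof -
  interpret q: quot_space Fr "carrier Fr" rel by (rule quot_space_tensor)
  have r: "Poly_Mapping.single (c * m, n) 1 - Poly_Mapping.single (m, n) c \<in> rel" for c m
  proof (rule relator_in_rel)
    have "aug B (c \<odot>\<^bsub>B\<^esub> \<one>\<^bsub>B\<^esub>) = c" by (simp add: aug_smult aug_simps)
    then show "Poly_Mapping.single (c * m, n) 1 - Poly_Mapping.single (m, n) c \<in> tensor_relators B (triv_module B) N"
      unfolding tensor_relators_def using assms
      by - (rule UnI2, rule CollectI, rule exI[of _ c], rule exI[of _ m], rule exI[of _ n], simp)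
  qed
  have "rel +>\<^bsub>Fr\<^esub> Poly_Mapping.single (m, n) c = rel +>\<^bsub>Fr\<^esub> Poly_Mapping.single (c * m, n) 1"
    using r[of c m] assms by (intro coset_eqI[symmetric]) auto
  also have "\<dots> = rel +>\<^bsub>Fr\<^esub> Poly_Mapping.single (1, n) (c * m)"
    using r[of "c * m" 1] assms by (intro coset_eqI) auto
  also have "\<dots> = (c * m) \<odot>\<^bsub>Tens\<^esub> pure_tensor B N n"
    using q.quot_vs_simps(4)[of "Poly_Mapping.single (1, n) 1" "c * m"] assms
    by (simp add: pure_tensor_def Tens_eq map_scale_single)
  finally show ?thesis .
qed

lemma pure_tensor_smult:
  assumes b: "b \<in> carrier B" and n: "n \<in> carrier N"
  shows "pure_tensor B N (b \<odot>\<^bsub>N\<^esub> n) = aug B b \<odot>\<^bsub>Tens\<^esub> pure_tensor B N n"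
proof -
  have "Poly_Mapping.single (b \<odot>\<^bsub>triv_module B\<^esub> 1, n) 1 - Poly_Mapping.single (1, b \<odot>\<^bsub>N\<^esub> n) 1 \<in> rel"
  proof (rule relator_in_rel)
    show "Poly_Mapping.single (b \<odot>\<^bsub>triv_module B\<^esub> 1, n) 1 - Poly_Mapping.single (1, b \<odot>\<^bsub>N\<^esub> n) 1
        \<in> tensor_relators B (triv_module B) N"
      unfolding tensor_relators_def using b n
      by - (rule UnI1, rule UnI2, rule CollectI, rule exI[of _ b], rule exI[of _ 1], rule exI[of _ n], simp)
  qed
  then have "rel +>\<^bsub>Fr\<^esub> Poly_Mapping.single (aug B b, n) 1 = pure_tensor B N (b \<odot>\<^bsub>N\<^esub> n)"
    unfolding pure_tensor_def using b n by (intro coset_eqI) (auto simp: lm_closed)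
  then show ?thesis using single_coset[OF n, of "aug B b" 1] by simp
qed

lemma pure_tensor_closed: "n \<in> carrier N \<Longrightarrow> pure_tensor B N n \<in> carrier Tens"
  unfolding pure_tensor_def Tens_eq quot_space.quot_vs_simps(1)[OF quot_space_tensor]
  by (intro imageI single_in_Fr)

lemma pure_tensor_zero: "pure_tensor B N \<zero>\<^bsub>N\<^esub> = \<zero>\<^bsub>Tens\<^esub>"
proof -
  interpret T: vectorspace class_ring Tens by (rule vectorspace_Tens)
  have "pure_tensor B N \<zero>\<^bsub>N\<^esub> \<in> carrier Tens"
    by (rule pure_tensor_closed) simp
  then show ?thesis
    using pure_tensor_smult[of "\<zero>\<^bsub>B\<^esub>" "\<zero>\<^bsub>N\<^esub>"] T.smult_l_null by (simp add: lm_l_zero aug_simps)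
qed

lemma carrier_Tens: "carrier Tens = pure_tensor B N ` carrier N"
proof (intro equalityI subsetI)
  interpret q: quot_space Fr "carrier Fr" rel by (rule quot_space_tensor)
  fix X assume "X \<in> carrier Tens"
  then obtain z where z: "Poly_Mapping.keys z \<subseteq> UNIV \<times> carrier N" and X: "X = rel +>\<^bsub>Fr\<^esub> z"
    unfolding Tens_eq q.quot_vs_simps(1) by auto
  from z have "rel +>\<^bsub>Fr\<^esub> z \<in> pure_tensor B N ` carrier N"
  proof (induction rule: poly_mapping_keys_induct)
    case zero
    have "rel +>\<^bsub>Fr\<^esub> 0 = \<zero>\<^bsub>Tens\<^esub>"
      using q.coset_zero unfolding Tens_eq q.quot_vs_simps(2) by simp
    then show ?case unfolding pure_tensor_zero[symmetric] by (rule image_eqI) simp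
  next
    case (single w c)
    then obtain m n where w: "w = (m, n)" "n \<in> carrier N" by auto
    have "aug B ((c * m) \<odot>\<^bsub>B\<^esub> \<one>\<^bsub>B\<^esub>) = c * m" by (simp add: aug_smult aug_simps)
    then have "rel +>\<^bsub>Fr\<^esub> Poly_Mapping.single w c = pure_tensor B N (((c * m) \<odot>\<^bsub>B\<^esub> \<one>\<^bsub>B\<^esub>) \<odot>\<^bsub>N\<^esub> n)"
      using w by (simp add: single_coset pure_tensor_smult)
    then show ?case using w by (auto intro!: imageI lm_closed)
  next
    case (add p q)
    then obtain n n' where n: "n \<in> carrier N" "n' \<in> carrier N"
      "rel +>\<^bsub>Fr\<^esub> p = pure_tensor B N n" "rel +>\<^bsub>Fr\<^esub> q = pure_tensor B N n'" by auto
    have "rel +>\<^bsub>Fr\<^esub> (p + q) = pure_tensor B N (n \<oplus>\<^bsub>N\<^esub> n')"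
      using q.quot_vs_simps(3)[of p q] add.hyps n by (simp add: pure_tensor_add Tens_eq)
    then show ?case using n by auto
  qed
  with X show "X \<in> pure_tensor B N ` carrier N" by simp
next
  fix X assume "X \<in> pure_tensor B N ` carrier N"
  then show "X \<in> carrier Tens"
    using pure_tensor_closed by blast
qed

text \<open>A linear functional that is equivariant for the augmentation extends to the tensor product with
  the ground field, so it separates pure tensors.\<close>

lemma functional_well_defined:
  fixes \<theta> :: "'n \<Rightarrow> nat \<Rightarrow>\<^sub>0 'k"
  assumes add: "\<And>n n'. n \<in> carrier N \<Longrightarrow> n' \<in> carrier N \<Longrightarrow> \<theta> (n \<oplus>\<^bsub>N\<^esub> n') = \<theta> n + \<theta> n'"
    and smult: "\<And>b n. b \<in> carrier B \<Longrightarrow> n \<in> carrier N \<Longrightarrow> \<theta> (b \<odot>\<^bsub>N\<^esub> n) = const (aug B b) * \<theta> n"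
    and n: "n \<in> carrier N" "n' \<in> carrier N" and eq: "pure_tensor B N n = pure_tensor B N n'"
  shows "\<theta> n = \<theta> n'"
proof -
  interpret q: quot_space Fr "carrier Fr" rel by (rule quot_space_tensor)
  define \<Phi> where "\<Phi> = free.lin_ext (\<lambda>(m :: 'k, n). const m * \<theta> n)"
  let ?M = "{z \<in> carrier Fr. \<Phi> z = 0}"
  have "rel \<subseteq> ?M"
  proof (rule rel_least)
    show "submodule class_ring ?M Fr"
      using vectorspace_free_vs[of "UNIV \<times> carrier N"] keys_add keys_map_scale
      by (fastforce simp: submodule_def vectorspace_def \<Phi>_def free.lin_ext_simps)
    have "\<Phi> z = 0" if "z \<in> tensor_relators B (triv_module B) N" for z
    proof -
      have single: "\<Phi> (Poly_Mapping.single (m, n) c) = const (c * m) * \<theta> n" for m n c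
        by (simp add: \<Phi>_def free.lin_ext_single mult_single flip: mult.assoc)
      have const_mult: "const x * (const y * r) = const (x * y) * r" for x y and r :: "nat \<Rightarrow>\<^sub>0 'k"
        by (simp add: mult_single flip: mult.assoc)
      have diff: "\<Phi> (p - q) = \<Phi> p - \<Phi> q" for p q by (simp add: \<Phi>_def free.lin_ext_diff)
      show ?thesis
        using that unfolding tensor_relators_def
        by (elim UnE CollectE exE conjE; hypsubst)
           (simp_all add: diff single add smult const_mult single_add distrib_left distrib_right
             aug_smult aug_simps mult.commute mult_single)
    qed
    then show "tensor_relators B (triv_module B) N \<subseteq> ?M"
      using tensor_relators_carrier by blast
  qed
  moreover have "Poly_Mapping.single (1, n) 1 - Poly_Mapping.single (1, n') 1 \<in> rel"
  proof -
    have c: "Poly_Mapping.single (1, n) 1 \<in> carrier Fr" "Poly_Mapping.single (1, n') 1 \<in> carrier Fr"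
      using n by auto
    have "Poly_Mapping.single (1, n) 1 \<ominus>\<^bsub>Fr\<^esub> Poly_Mapping.single (1, n') 1 \<in> rel"
      using eq q.coset_eq_iff[OF c] by (simp add: pure_tensor_def)
    then show ?thesis using q.minus_eq[OF c(2)] by (simp add: a_minus_def map_scale_simps)
  qed
  ultimately have "\<Phi> (Poly_Mapping.single (1, n) 1 - Poly_Mapping.single (1, n') 1) = 0" by blast
  then show ?thesis by (simp add: \<Phi>_def free.lin_ext_simps)
qed

end

text \<open>The map on generators takes relators to relators, so its effect on a whole coset can be computed on
  one representative.\<close>

lemma tensor_map_pure_tensor:
  fixes B :: "('k::field, 'b, 'm) aug_algebra_scheme" and N :: "('b, 'n, 'j) module_scheme"
    and N' :: "('b, 'p, 'l) module_scheme"
  assumes N: "aug_left_module B N" and N': "aug_left_module B N'"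
    and closed: "\<And>n. n \<in> carrier N \<Longrightarrow> d n \<in> carrier N'"
    and add: "\<And>n n'. n \<in> carrier N \<Longrightarrow> n' \<in> carrier N \<Longrightarrow> d (n \<oplus>\<^bsub>N\<^esub> n') = d n \<oplus>\<^bsub>N'\<^esub> d n'"
    and smult: "\<And>b n. b \<in> carrier B \<Longrightarrow> n \<in> carrier N \<Longrightarrow> d (b \<odot>\<^bsub>N\<^esub> n) = b \<odot>\<^bsub>N'\<^esub> d n"
    and n: "n \<in> carrier N"
  shows "tensor_map B (triv_module B) N' d (pure_tensor B N n) = pure_tensor B N' (d n)"
proof -
  interpret N: aug_left_module B N by fact
  interpret N': aug_left_module B N' by fact
  interpret q': quot_space N'.Fr "carrier N'.Fr" N'.rel by (rule N'.quot_space_tensor)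
  define push where "push z = (\<Sum>(m, n)\<in>Poly_Mapping.keys z.
    Poly_Mapping.single (m, d n) (Poly_Mapping.lookup z (m, n)))" for z :: "'k \<times> 'n \<Rightarrow>\<^sub>0 'k"
  have superset: "push z = (\<Sum>(m, n)\<in>W. Poly_Mapping.single (m, d n) (Poly_Mapping.lookup z (m, n)))"
    if "finite W" "Poly_Mapping.keys z \<subseteq> W" for z W
    unfolding push_def using that by (intro sum.mono_neutral_left) (auto simp: in_keys_iff)
  have push_add: "push (y + z) = push y + push z" for y z
  proof -
    let ?W = "Poly_Mapping.keys y \<union> Poly_Mapping.keys z"
    have "push x = (\<Sum>(m, n)\<in>?W. Poly_Mapping.single (m, d n) (Poly_Mapping.lookup x (m, n)))"
      if "Poly_Mapping.keys x \<subseteq> ?W" for x using that by (intro superset) auto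
    then show ?thesis
      using keys_add[of y z] by (simp add: lookup_add single_add sum.distrib case_prod_unfold)
  qed
  have push_single: "push (Poly_Mapping.single (m, n) c) = Poly_Mapping.single (m, d n) c" for m n c
    by (subst superset[of "{(m, n)}"]) auto
  have push_zero: "push 0 = 0" by (simp add: push_def)
  have push_minus: "push (y - z) = push y - push z" for y z
    using push_add[of "y - z" z] by simp
  have push_scale: "push (Poly_Mapping.map ((*) c) z) = Poly_Mapping.map ((*) c) (push z)" for c z
    by (induction z rule: poly_mapping_single_induct)
      (auto simp: map_scale_simps map_scale_single push_add push_single)
  have push_rel: "push z \<in> N'.rel" if "z \<in> N.rel" for z
  proof -
    let ?M = "{z \<in> carrier N.Fr. push z \<in> N'.rel}"
    have "N.rel \<subseteq> ?M"
    proof (rule N.rel_least)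
      show "submodule class_ring ?M N.Fr"
        using vectorspace_free_vs[of "UNIV \<times> carrier N"] keys_add keys_map_scale N'.submodule_rel
        by (fastforce simp: submodule_def vectorspace_def push_add push_scale push_zero)
      have "push z \<in> tensor_relators B (triv_module B) N'" if "z \<in> tensor_relators B (triv_module B) N" for z
      proof -
        show ?thesis
          using \<open>z \<in> tensor_relators B (triv_module B) N\<close> unfolding tensor_relators_def[of B "triv_module B" N]
        proof (elim UnE CollectE exE conjE; hypsubst)
          fix m m' :: 'k and n assume "n \<in> carrier N"
          then show "push (Poly_Mapping.single (m \<oplus>\<^bsub>triv_module B\<^esub> m', n) 1 - Poly_Mapping.single (m, n) 1
              - Poly_Mapping.single (m', n) 1) \<in> tensor_relators B (triv_module B) N'"
            unfolding tensor_relators_def push_minus push_single using closed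
            by - (rule UnI1, rule UnI1, rule UnI1, rule CollectI, rule exI[of _ m], rule exI[of _ m'],
              rule exI[of _ "d n"], simp)
        next
          fix m :: 'k and n n' assume "n \<in> carrier N" "n' \<in> carrier N"
          then show "push (Poly_Mapping.single (m, n \<oplus>\<^bsub>N\<^esub> n') 1 - Poly_Mapping.single (m, n) 1
              - Poly_Mapping.single (m, n') 1) \<in> tensor_relators B (triv_module B) N'"
            unfolding tensor_relators_def push_minus push_single using closed
            by - (rule UnI1, rule UnI1, rule UnI2, rule CollectI, rule exI[of _ m], rule exI[of _ "d n"],
              rule exI[of _ "d n'"], simp add: add)
        next
          fix b and m :: 'k and n assume "b \<in> carrier B" "n \<in> carrier N"
          then show "push (Poly_Mapping.single (b \<odot>\<^bsub>triv_module B\<^esub> m, n) 1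
              - Poly_Mapping.single (m, b \<odot>\<^bsub>N\<^esub> n) 1) \<in> tensor_relators B (triv_module B) N'"
            unfolding tensor_relators_def push_minus push_single using closed
            by - (rule UnI1, rule UnI2, rule CollectI, rule exI[of _ b], rule exI[of _ m],
              rule exI[of _ "d n"], simp add: smult)
        next
          fix c and m :: 'k and n assume "n \<in> carrier N"
          then show "push (Poly_Mapping.single ((c \<odot>\<^bsub>B\<^esub> \<one>\<^bsub>B\<^esub>) \<odot>\<^bsub>triv_module B\<^esub> m, n) 1
              - Poly_Mapping.single (m, n) c) \<in> tensor_relators B (triv_module B) N'"
            unfolding tensor_relators_def push_minus push_single using closed
            by - (rule UnI2, rule CollectI, rule exI[of _ c], rule exI[of _ m],
              rule exI[of _ "d n"], simp)
        qed
      qed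
      then show "tensor_relators B (triv_module B) N \<subseteq> ?M"
        using N.tensor_relators_carrier N'.relator_in_rel by blast
    qed
    with that show ?thesis by blast
  qed
  have rel_carrier: "N'.rel \<subseteq> carrier N'.Fr" using N'.submodule_rel by (simp add: submodule_def)
  let ?s = "Poly_Mapping.single (1, n) 1 :: 'k \<times> 'n \<Rightarrow>\<^sub>0 'k"
  have zero_rel: "0 \<in> N.rel" "0 \<in> N'.rel"
    using N.submodule_rel N'.submodule_rel by (auto simp: submodule_def)
  have rel_add: "y + z \<in> N'.rel" if "y \<in> N'.rel" "z \<in> N'.rel" for y z
    using N'.submodule_rel that by (auto simp: submodule_def)
  have "N'.rel <+>\<^bsub>N'.Fr\<^esub> (push ` (N.rel +>\<^bsub>N.Fr\<^esub> ?s)) = N'.rel +>\<^bsub>N'.Fr\<^esub> push ?s"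
  proof (intro equalityI subsetI)
    fix x assume "x \<in> N'.rel <+>\<^bsub>N'.Fr\<^esub> (push ` (N.rel +>\<^bsub>N.Fr\<^esub> ?s))"
    then obtain r r' where "r \<in> N'.rel" "r' \<in> N.rel" "x = r + push (r' + ?s)"
      by (auto simp: set_add_def' a_r_coset_def')
    then have "x = (r + push r') + push ?s" "r + push r' \<in> N'.rel"
      using rel_add push_rel by (auto simp: push_add add.assoc)
    then show "x \<in> N'.rel +>\<^bsub>N'.Fr\<^esub> push ?s" by (auto simp: a_r_coset_def')
  next
    fix x assume "x \<in> N'.rel +>\<^bsub>N'.Fr\<^esub> push ?s"
    then obtain r where r: "r \<in> N'.rel" "x = r + push (0 + ?s)"
      by (auto simp: a_r_coset_def')
    have "0 + ?s \<in> N.rel +>\<^bsub>N.Fr\<^esub> ?s" using zero_rel(1) unfolding a_r_coset_def' by auto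
    with r show "x \<in> N'.rel <+>\<^bsub>N'.Fr\<^esub> (push ` (N.rel +>\<^bsub>N.Fr\<^esub> ?s))"
      unfolding set_add_def' by auto
  qed
  then show ?thesis
    unfolding tensor_map_def pure_tensor_def push_def[symmetric] by (simp add: push_single)
qed

section \<open>The second Tor by dimension shifting\<close>

text \<open>The submodule generated by the products of the augmentation ideal with the module, the kernel of
  passing to the tensor product with the ground field.\<close>

inductive_set aug_mult :: "('k::field, 'b, 'm) aug_algebra_scheme \<Rightarrow> ('b, 'n, 'j) module_scheme \<Rightarrow> 'n set"
  for B and N where
    zero: "\<zero>\<^bsub>N\<^esub> \<in> aug_mult B N"
  | add: "b \<in> carrier B \<Longrightarrow> aug B b = 0 \<Longrightarrow> n \<in> carrier N \<Longrightarrow> x \<in> aug_mult B N \<Longrightarrow>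
      b \<odot>\<^bsub>N\<^esub> n \<oplus>\<^bsub>N\<^esub> x \<in> aug_mult B N"

context aug_left_module
begin

lemma aug_mult_carrier: "x \<in> aug_mult B N \<Longrightarrow> x \<in> carrier N"
  by (induction rule: aug_mult.induct) (auto simp: lm_closed)

lemma aug_mult_base: "b \<in> carrier B \<Longrightarrow> aug B b = 0 \<Longrightarrow> n \<in> carrier N \<Longrightarrow> b \<odot>\<^bsub>N\<^esub> n \<in> aug_mult B N"
  using aug_mult.add[OF _ _ _ aug_mult.zero, of b B n N] by (simp add: lm_closed)

lemma aug_mult_add: "x \<in> aug_mult B N \<Longrightarrow> y \<in> aug_mult B N \<Longrightarrow> x \<oplus>\<^bsub>N\<^esub> y \<in> aug_mult B N"
proof (induction rule: aug_mult.induct)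
  case zero
  then show ?case using aug_mult_carrier by simp
next
  case (add b n x)
  then have "b \<odot>\<^bsub>N\<^esub> n \<oplus>\<^bsub>N\<^esub> (x \<oplus>\<^bsub>N\<^esub> y) \<in> aug_mult B N" by (intro aug_mult.add) auto
  then show ?case using add aug_mult_carrier by (simp add: lm_closed N.a_assoc)
qed

lemma pure_tensor_aug_mult: "x \<in> aug_mult B N \<Longrightarrow> pure_tensor B N x = \<zero>\<^bsub>Tens\<^esub>"
proof (induction rule: aug_mult.induct)
  case zero
  show ?case by (rule pure_tensor_zero)
next
  case (add b n x)
  interpret T: vectorspace class_ring Tens by (rule vectorspace_Tens)
  have "0 \<odot>\<^bsub>Tens\<^esub> pure_tensor B N n = \<zero>\<^bsub>Tens\<^esub>"
    using T.smult_l_null[OF pure_tensor_closed[OF add.hyps(3)]] by simp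
  with add show ?case
    by (simp add: pure_tensor_add lm_closed aug_mult_carrier pure_tensor_smult)
qed

lemma scalar_unit: "c \<odot>\<^bsub>B\<^esub> \<one>\<^bsub>B\<^esub> \<in> carrier B" "aug B (c \<odot>\<^bsub>B\<^esub> \<one>\<^bsub>B\<^esub>) = c"
  using aug_smult[of "\<one>\<^bsub>B\<^esub>" c] by (auto simp: aug_simps)

lemma smult_pure_tensor:
  "n \<in> carrier N \<Longrightarrow> c \<odot>\<^bsub>Tens\<^esub> pure_tensor B N n = pure_tensor B N ((c \<odot>\<^bsub>B\<^esub> \<one>\<^bsub>B\<^esub>) \<odot>\<^bsub>N\<^esub> n)"
  using pure_tensor_smult[OF scalar_unit(1)] by (simp add: scalar_unit(2))

lemma submodule_pure_tensor_image:
  assumes G: "G \<subseteq> carrier N" and "\<zero>\<^bsub>N\<^esub> \<in> G"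
    and "\<And>x y. x \<in> G \<Longrightarrow> y \<in> G \<Longrightarrow> x \<oplus>\<^bsub>N\<^esub> y \<in> G"
    and "\<And>b x. b \<in> carrier B \<Longrightarrow> x \<in> G \<Longrightarrow> b \<odot>\<^bsub>N\<^esub> x \<in> G"
  shows "submodule class_ring (pure_tensor B N ` G) Tens"
proof -
  interpret T: vectorspace class_ring Tens by (rule vectorspace_Tens)
  show ?thesis
  proof (rule submodule.intro)
    show "Module.module class_ring Tens" by (rule T.module_axioms)
    show "pure_tensor B N ` G \<subseteq> carrier Tens" using G pure_tensor_closed by blast
    show "\<zero>\<^bsub>Tens\<^esub> \<in> pure_tensor B N ` G" using assms(2) by (simp flip: pure_tensor_zero)
  next
    fix v w assume "v \<in> pure_tensor B N ` G" "w \<in> pure_tensor B N ` G"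
    then obtain x y where xy: "x \<in> G" "y \<in> G" "v = pure_tensor B N x" "w = pure_tensor B N y" by blast
    then have "v \<oplus>\<^bsub>Tens\<^esub> w = pure_tensor B N (x \<oplus>\<^bsub>N\<^esub> y)" using G by (simp add: pure_tensor_add subset_iff)
    then show "v \<oplus>\<^bsub>Tens\<^esub> w \<in> pure_tensor B N ` G" using xy assms(3) by blast
  next
    fix c :: 'k and v assume "v \<in> pure_tensor B N ` G"
    then obtain x where x: "x \<in> G" "v = pure_tensor B N x" by blast
    then have "c \<odot>\<^bsub>Tens\<^esub> v = pure_tensor B N ((c \<odot>\<^bsub>B\<^esub> \<one>\<^bsub>B\<^esub>) \<odot>\<^bsub>N\<^esub> x)"
      using G by (simp add: smult_pure_tensor subset_iff)
    then show "c \<odot>\<^bsub>Tens\<^esub> v \<in> pure_tensor B N ` G" using x(1) assms(4) scalar_unit(1) by blast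
  qed
qed

lemma aug_left_module_free_cover: "aug_left_module B (free_cover B N)"
  by (intro aug_left_module.intro augmented_algebra_axioms left_module_free_cover)

lemma aug_left_module_syzygy: "aug_left_module B (syzygy B N)"
  by (intro aug_left_module.intro augmented_algebra_axioms left_module_syzygy)

lemma aug_mult_free_cover:
  assumes f: "f \<in> carrier (free_cover B N)" and "\<And>n. aug B (f n) = 0"
  shows "f \<in> aug_mult B (free_cover B N)"
proof -
  have ring: "ring B" by unfold_locales
  let ?I = "{b. aug B b = 0}"
  have "f \<in> carrier (free_lmodule B (carrier N))" "\<And>s. f s \<in> ?I" "\<zero>\<^bsub>B\<^esub> \<in> ?I"
    using assms by (auto simp: free_cover_def aug_simps)
  then show ?thesis
    unfolding free_cover_def
  proof (induction rule: ring.free_lmodule_induct[OF ring, consumes 3, case_names zero step])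
    case zero
    show ?case using aug_mult.zero[of "free_lmodule B (carrier N)" B] by (simp add: free_lmodule_simps)
  next
    case (step s b f)
    then show ?case
      using ring.unit_fun_closed[OF ring, of s "carrier N"] by (intro aug_mult.add) auto
  qed
qed

end

text \<open>With \<open>K2\<close> the second syzygy inside the free module \<open>F1\<close>, right exactness turns \<open>Tor\<^sub>2\<close> into
  the kernel of \<open>K2/I K2 \<rightarrow> F1/I F1\<close>, that is, into \<open>(K2 \<inter> I F1)/I K2\<close>.  The set \<open>Z\<close> is
  \<open>K2 \<inter> I F1\<close>, as membership in \<open>I F1\<close> is a condition on each coordinate; hence an equivariant
  functional on \<open>K2\<close> whose restriction to \<open>Z\<close> has kernel \<open>I K2\<close> computes \<open>Tor\<^sub>2\<close>.\<close>

lemma Tor2_iso: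
  fixes B :: "('k::field, 'b, 'm) aug_algebra_scheme" and N :: "('b, 'n, 'j) module_scheme"
    and \<theta> :: "(('n \<Rightarrow> 'b) \<Rightarrow> 'b) \<Rightarrow> (nat \<Rightarrow>\<^sub>0 'k)"
  assumes N: "aug_left_module B N"
  defines "K1 \<equiv> syzygy B N"
  defines "K2 \<equiv> syzygy B K1"
  defines "Z \<equiv> {f \<in> carrier K2. \<forall>n. aug B (f n) = 0}"
  assumes add: "\<And>f g. f \<in> carrier K2 \<Longrightarrow> g \<in> carrier K2 \<Longrightarrow> \<theta> (f \<oplus>\<^bsub>K2\<^esub> g) = \<theta> f + \<theta> g"
    and smult: "\<And>b f. b \<in> carrier B \<Longrightarrow> f \<in> carrier K2 \<Longrightarrow> \<theta> (b \<odot>\<^bsub>K2\<^esub> f) = const (aug B b) * \<theta> f"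
    and onto: "\<theta> ` Z = carrier (free_vs S)"
    and inj: "\<And>f. f \<in> Z \<Longrightarrow> \<theta> f = 0 \<Longrightarrow> f \<in> aug_mult B K2"
  obtains T where "T \<in> vs_iso (Tor2 B (triv_module B) N) (free_vs S)"
proof -
  define K3 where "K3 = syzygy B K2"
  define F1 where "F1 = free_cover B K1"
  define F2 where "F2 = free_cover B K2"
  define F3 where "F3 = free_cover B K3"
  interpret N: aug_left_module B N by (rule N)
  interpret K1: aug_left_module B K1 unfolding K1_def by (rule N.aug_left_module_syzygy)
  interpret K2: aug_left_module B K2 unfolding K2_def by (rule K1.aug_left_module_syzygy)
  interpret K3: aug_left_module B K3 unfolding K3_def by (rule K2.aug_left_module_syzygy)
  interpret F1: aug_left_module B F1 unfolding F1_def by (rule K1.aug_left_module_free_cover)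
  interpret F2: aug_left_module B F2 unfolding F2_def by (rule K2.aug_left_module_free_cover)
  interpret F3: aug_left_module B F3 unfolding F3_def by (rule K3.aug_left_module_free_cover)
  let ?c2 = "cover_map B K2" and ?c3 = "cover_map B K3"
  let ?t1 = "pure_tensor B F1" and ?t2 = "pure_tensor B F2" and ?t3 = "pure_tensor B F3"
  let ?T1 = "tensor B (triv_module B) F1" and ?T2 = "tensor B (triv_module B) F2"
  let ?T3 = "tensor B (triv_module B) F3"
  let ?d2 = "tensor_map B (triv_module B) F1 ?c2" and ?d3 = "tensor_map B (triv_module B) F2 ?c3"
  have K2_simps: "carrier K2 = {f \<in> carrier F1. cover_map B K1 f = \<zero>\<^bsub>K1\<^esub>}" "\<zero>\<^bsub>K2\<^esub> = \<zero>\<^bsub>F1\<^esub>"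
    "f \<oplus>\<^bsub>K2\<^esub> g = f \<oplus>\<^bsub>F1\<^esub> g" "b \<odot>\<^bsub>K2\<^esub> f = b \<odot>\<^bsub>F1\<^esub> f" for f g b
    unfolding K2_def F1_def by (simp_all add: K1.syzygy_simps)
  have K3_simps: "carrier K3 = {f \<in> carrier F2. ?c2 f = \<zero>\<^bsub>K2\<^esub>}" "\<zero>\<^bsub>K3\<^esub> = \<zero>\<^bsub>F2\<^esub>"
    "f \<oplus>\<^bsub>K3\<^esub> g = f \<oplus>\<^bsub>F2\<^esub> g" "b \<odot>\<^bsub>K3\<^esub> f = b \<odot>\<^bsub>F2\<^esub> f" for f g b
    unfolding K3_def F2_def by (simp_all add: K2.syzygy_simps)
  have c2: "?c2 f \<in> carrier K2" "?c2 f \<in> carrier F1" if "f \<in> carrier F2" for f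
    using K2.cover_map_closed that by (auto simp: F2_def K2_simps)
  have c3: "?c3 f \<in> carrier K3" "?c3 f \<in> carrier F2" if "f \<in> carrier F3" for f
    using K3.cover_map_closed that by (auto simp: F3_def K3_simps)
  have c2_add: "?c2 (f \<oplus>\<^bsub>F2\<^esub> g) = ?c2 f \<oplus>\<^bsub>F1\<^esub> ?c2 g" if "f \<in> carrier F2" "g \<in> carrier F2" for f g
    using K2.cover_map_add that by (simp add: F2_def K2_simps)
  have c2_smult: "?c2 (b \<odot>\<^bsub>F2\<^esub> f) = b \<odot>\<^bsub>F1\<^esub> ?c2 f" if "b \<in> carrier B" "f \<in> carrier F2" for b f
    using K2.cover_map_smult that by (simp add: F2_def K2_simps)
  have d2: "?d2 (?t2 f) = ?t1 (?c2 f)" if "f \<in> carrier F2" for f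
    by (rule tensor_map_pure_tensor[OF F2.aug_left_module_axioms F1.aug_left_module_axioms _ _ _ that])
      (auto simp: c2 c2_add c2_smult)
  have d3: "?d3 (?t3 f) = ?t2 (?c3 f)" if "f \<in> carrier F3" for f
    by (rule tensor_map_pure_tensor[OF F3.aug_left_module_axioms F2.aug_left_module_axioms _ _ _ that])
      (auto simp: c3 K3.cover_map_add[folded F3_def] K3.cover_map_smult[folded F3_def] K3_simps)
  let ?U = "{X \<in> carrier ?T2. ?d2 X = \<zero>\<^bsub>?T1\<^esub>}" and ?W = "?d3 ` carrier ?T3"
  \<comment> \<open>membership in \<open>I F1\<close>, tested by the coordinates of the free module\<close>
  have t1_zero_iff: "?t1 f = \<zero>\<^bsub>?T1\<^esub> \<longleftrightarrow> (\<forall>n. aug B (f n) = 0)" if f: "f \<in> carrier F1" for f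
  proof
    assume "\<forall>n. aug B (f n) = 0"
    then show "?t1 f = \<zero>\<^bsub>?T1\<^esub>"
      using K1.aug_mult_free_cover[of f] f by (intro F1.pure_tensor_aug_mult) (simp add: F1_def)
  next
    assume eq: "?t1 f = \<zero>\<^bsub>?T1\<^esub>"
    show "\<forall>n. aug B (f n) = 0"
    proof
      fix n :: "'n \<Rightarrow> 'b"
      let ?\<theta> = "\<lambda>f. const (aug B (f n)) :: nat \<Rightarrow>\<^sub>0 'k"
      have v: "g n \<in> carrier B" if "g \<in> carrier F1" for g
        using K1.free_cover_value that by (simp add: F1_def)
      have "?\<theta> f = ?\<theta> \<zero>\<^bsub>F1\<^esub>"
      proof (rule F1.functional_well_defined[of ?\<theta>])
        show "?t1 f = ?t1 \<zero>\<^bsub>F1\<^esub>" by (simp add: eq F1.pure_tensor_zero)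
        show "\<zero>\<^bsub>F1\<^esub> \<in> carrier F1" by (rule F1.N.zero_closed)
      qed (use v f in \<open>auto simp: F1_def free_cover_def free_lmodule_simps(2-4) N.aug_simps single_add mult_single\<close>)
      then have "Poly_Mapping.lookup (?\<theta> f) 0 = Poly_Mapping.lookup (?\<theta> \<zero>\<^bsub>F1\<^esub>) 0" by simp
      then show "aug B (f n) = 0"
        by (simp add: F1_def free_cover_def free_lmodule_simps N.aug_simps)
    qed
  qed
  have U: "?U = ?t2 ` {f \<in> carrier F2. ?c2 f \<in> Z}"
  proof -
    have image: "{X \<in> h ` A. P X} = h ` {f \<in> A. P (h f)}"
      for h :: "(((('n \<Rightarrow> 'b) \<Rightarrow> 'b) \<Rightarrow> 'b) \<Rightarrow> ('k \<times> ((('n \<Rightarrow> 'b) \<Rightarrow> 'b) \<Rightarrow> 'b) \<Rightarrow>\<^sub>0 'k) set)" and A P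
      by blast
    have "?d2 (?t2 f) = \<zero>\<^bsub>?T1\<^esub> \<longleftrightarrow> ?c2 f \<in> Z" if "f \<in> carrier F2" for f
      unfolding d2[OF that] t1_zero_iff[OF c2(2)[OF that]] using c2(1)[OF that] by (simp add: Z_def)
    then have "{f \<in> carrier F2. ?d2 (?t2 f) = \<zero>\<^bsub>?T1\<^esub>} = {f \<in> carrier F2. ?c2 f \<in> Z}" by blast
    then show ?thesis unfolding F2.carrier_Tens image by (rule arg_cong)
  qed
  have W: "?W = ?t2 ` carrier K3"
  proof -
    have "?c3 ` carrier F3 = carrier K3"
    proof (intro equalityI subsetI)
      fix f assume "f \<in> carrier K3"
      then show "f \<in> ?c3 ` carrier F3"
        unfolding F3_def
        by (intro image_eqI[of f ?c3 "unit_fun B f"])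
          (simp_all add: K3.cover_map_unit_fun K3.unit_fun_in_free_cover)
    qed (use c3 in auto)
    then have "?t2 ` carrier K3 = (\<lambda>f. ?t2 (?c3 f)) ` carrier F3" by (simp flip: image_image)
    also have "\<dots> = ?W" unfolding F3.carrier_Tens image_image by (intro image_cong) (auto simp: d3)
    finally show ?thesis by simp
  qed
  have Z_add: "f \<oplus>\<^bsub>F1\<^esub> g \<in> Z" if "f \<in> Z" "g \<in> Z" for f g
  proof -
    have "f \<oplus>\<^bsub>K2\<^esub> g \<in> carrier K2" using that by (intro K2.N.a_closed) (auto simp: Z_def)
    moreover have "f n \<in> carrier B" "g n \<in> carrier B" for n
      using K1.free_cover_value that by (auto simp: F1_def Z_def K2_simps)
    ultimately show ?thesis
      using that by (auto simp: Z_def K2_simps(3) F1_def free_cover_def free_lmodule_simps(3) N.aug_simps)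
  qed
  have Z_smult: "b \<odot>\<^bsub>F1\<^esub> f \<in> Z" if "b \<in> carrier B" "f \<in> Z" for b f
  proof -
    have "b \<odot>\<^bsub>K2\<^esub> f \<in> carrier K2" using that by (intro K2.lm_closed) (auto simp: Z_def)
    moreover have "f n \<in> carrier B" for n
      using K1.free_cover_value that by (auto simp: F1_def Z_def K2_simps)
    ultimately show ?thesis
      using that by (auto simp: Z_def K2_simps(4) F1_def free_cover_def free_lmodule_simps(4) N.aug_simps)
  qed
  have Z_zero: "\<zero>\<^bsub>K2\<^esub> \<in> Z"
    using K2.N.zero_closed by (auto simp: Z_def K2_simps(2) F1_def free_cover_def free_lmodule_simps(2) N.aug_simps)
  have sub_U: "submodule class_ring ?U ?T2"
    unfolding U
  proof (rule F2.submodule_pure_tensor_image)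
    show "\<zero>\<^bsub>F2\<^esub> \<in> {f \<in> carrier F2. ?c2 f \<in> Z}"
      using Z_zero K2.cover_map_zero F2.N.zero_closed by (simp add: F2_def)
  qed (auto simp: c2_add c2_smult Z_add Z_smult F2.lm_closed)
  have sub_W: "submodule class_ring ?W ?T2"
    unfolding W
  proof (rule F2.submodule_pure_tensor_image)
    show "\<zero>\<^bsub>F2\<^esub> \<in> carrier K3" using K3.N.zero_closed by (simp add: K3_simps(2))
    show "x \<oplus>\<^bsub>F2\<^esub> y \<in> carrier K3" if "x \<in> carrier K3" "y \<in> carrier K3" for x y
      using K3.N.a_closed[OF that] by (simp add: K3_simps(3))
    show "b \<odot>\<^bsub>F2\<^esub> x \<in> carrier K3" if "b \<in> carrier B" "x \<in> carrier K3" for b x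
      using K3.lm_closed[OF that] by (simp add: K3_simps(4))
  qed (auto simp: K3_simps(1))
  have W_U: "?W \<subseteq> ?U"
    unfolding U W using Z_zero by (intro image_mono) (auto simp: K3_simps(1))
  interpret q: quot_space ?T2 ?U ?W
    by (rule quot_space.intro[OF F2.vectorspace_Tens sub_U sub_W W_U])
  define L where "L X = \<theta> (?c2 (SOME f. f \<in> carrier F2 \<and> X = ?t2 f))" for X
  have L: "L (?t2 f) = \<theta> (?c2 f)" if "f \<in> carrier F2" for f
  proof -
    let ?g = "SOME g. g \<in> carrier F2 \<and> ?t2 f = ?t2 g"
    have g: "?g \<in> carrier F2 \<and> ?t2 f = ?t2 ?g" by (rule someI[of _ f]) (use that in simp)
    show ?thesis
      unfolding L_def
      by (rule sym, rule F2.functional_well_defined[of "\<lambda>f. \<theta> (?c2 f)"])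
        (use g that add smult c2 in \<open>auto simp: c2_add c2_smult K2_simps(3,4)[symmetric]\<close>)
  qed
  show thesis
  proof (rule q.quot_vs_iso[OF vectorspace_free_vs, of L S])
    show "L ` ?U = carrier (free_vs S)"
    proof -
      have "L ` ?U = \<theta> ` ?c2 ` {f \<in> carrier F2. ?c2 f \<in> Z}"
        unfolding U image_image by (intro image_cong) (auto simp: L)
      also have "?c2 ` {f \<in> carrier F2. ?c2 f \<in> Z} = Z"
      proof (intro equalityI subsetI)
        fix f assume f: "f \<in> Z"
        then have "f \<in> carrier K2" by (simp add: Z_def)
        then have "f = ?c2 (unit_fun B f)" "unit_fun B f \<in> carrier F2"
          unfolding F2_def using K2.cover_map_unit_fun K2.unit_fun_in_free_cover by auto
        with f show "f \<in> ?c2 ` {f \<in> carrier F2. ?c2 f \<in> Z}" by auto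
      qed auto
      finally show ?thesis by (simp only: onto)
    qed
  next
    fix X Y :: "('k \<times> ((('n \<Rightarrow> 'b) \<Rightarrow> 'b) \<Rightarrow> 'b) \<Rightarrow>\<^sub>0 'k) set" and c :: 'k
    assume "X \<in> ?U"
    then obtain f where f: "f \<in> carrier F2" "?c2 f \<in> Z" "X = ?t2 f" unfolding U by blast
    have fK2: "?c2 f \<in> carrier K2" using f by (simp add: Z_def)
    { assume "Y \<in> ?U"
      then obtain g where g: "g \<in> carrier F2" "?c2 g \<in> Z" "Y = ?t2 g" unfolding U by blast
      then show "L (X \<oplus>\<^bsub>?T2\<^esub> Y) = L X \<oplus>\<^bsub>free_vs S\<^esub> L Y"
        using f fK2 c2 add by (simp add: L c2_add K2_simps(3)[symmetric] flip: F2.pure_tensor_add) }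
    show "L (c \<odot>\<^bsub>?T2\<^esub> X) = c \<odot>\<^bsub>free_vs S\<^esub> L X"
      using f fK2 N.scalar_unit[of c] smult
      by (simp add: F2.smult_pure_tensor L c2_smult K2_simps(4)[symmetric] F2.lm_closed mult_map_scale_conv_mult)
    show "L X = \<zero>\<^bsub>free_vs S\<^esub> \<longleftrightarrow> X \<in> ?W"
    proof
      assume "L X = \<zero>\<^bsub>free_vs S\<^esub>"
      then have "\<theta> (?c2 f) = 0" using f by (simp add: L)
      then have "?c2 f \<in> aug_mult B K2" using inj f by blast
      \<comment> \<open>lift an element of \<open>I K2\<close> to \<open>I F2\<close>, which does not contribute to the tensor product\<close>
      moreover have "\<exists>g\<in>carrier F2. ?c2 g = x \<and> g \<in> aug_mult B F2" if "x \<in> aug_mult B K2" for x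
        using that
      proof (induction rule: aug_mult.induct)
        case zero
        show ?case
          using K2.cover_map_zero aug_mult.zero[of F2 B] F2.N.zero_closed by (auto simp: F2_def)
      next
        case (add b n x)
        then obtain g where g: "g \<in> carrier F2" "?c2 g = x" "g \<in> aug_mult B F2" by blast
        have u: "unit_fun B n \<in> carrier F2" "?c2 (unit_fun B n) = n"
          unfolding F2_def using K2.unit_fun_in_free_cover K2.cover_map_unit_fun add.hyps by auto
        let ?g = "b \<odot>\<^bsub>F2\<^esub> unit_fun B n \<oplus>\<^bsub>F2\<^esub> g"
        have "?g \<in> aug_mult B F2" by (intro aug_mult.add add.hyps u g)
        moreover have "?c2 ?g = b \<odot>\<^bsub>K2\<^esub> n \<oplus>\<^bsub>K2\<^esub> x"
          using add.hyps u g by (simp add: c2_add c2_smult F2.lm_closed K2_simps(3,4))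
        ultimately show ?case using F2.aug_mult_carrier by blast
      qed
      ultimately obtain g where g: "g \<in> carrier F2" "?c2 g = ?c2 f" "g \<in> aug_mult B F2" by blast
      let ?h = "f \<ominus>\<^bsub>F2\<^esub> g"
      have h: "?h \<in> carrier F2" "f = ?h \<oplus>\<^bsub>F2\<^esub> g"
        using f(1) g(1) by (auto simp: a_minus_def F2.N.a_assoc F2.N.l_neg)
      have "?c2 f = ?c2 ?h \<oplus>\<^bsub>F1\<^esub> ?c2 f"
        using c2_add[OF h(1) g(1)] g(2) h(2) by simp
      then have "?c2 ?h = \<zero>\<^bsub>F1\<^esub>"
        using F1.N.add.r_cancel_one'[OF c2(2)[OF f(1)] c2(2)[OF h(1)]] by simp
      then have "?h \<in> carrier K3" using h(1) by (simp add: K3_simps(1) K2_simps(2))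
      moreover have "?t2 f = ?t2 ?h"
      proof -
        interpret T2: vectorspace class_ring ?T2 by (rule F2.vectorspace_Tens)
        have "?t2 f = ?t2 (?h \<oplus>\<^bsub>F2\<^esub> g)" using h(2) by simp
        also have "\<dots> = ?t2 ?h \<oplus>\<^bsub>?T2\<^esub> \<zero>\<^bsub>?T2\<^esub>"
          using F2.pure_tensor_add[OF h(1) g(1)] F2.pure_tensor_aug_mult[OF g(3)] by simp
        finally show ?thesis using F2.pure_tensor_closed[OF h(1)] by simp
      qed
      ultimately show "X \<in> ?W" unfolding W f(3) by blast
    next
      assume "X \<in> ?W"
      then obtain g where "g \<in> carrier K3" "X = ?t2 g" unfolding W by blast
      then have "L X = \<theta> \<zero>\<^bsub>K2\<^esub>" by (simp add: L K3_simps)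
      also have "\<theta> \<zero>\<^bsub>K2\<^esub> = 0" 
        using add[OF K2.N.zero_closed K2.N.zero_closed] K2.N.l_zero[OF K2.N.zero_closed]
        by (simp only: add_cancel_right_right)
      finally show "L X = \<zero>\<^bsub>free_vs S\<^esub>" by simp
    qed
  next
    fix T assume "T \<in> vs_iso (quot_vs ?T2 ?U ?W) (free_vs S)"
    then show thesis
      using that by (simp add: Tor2_def Let_def K1_def K2_def K3_def F1_def F2_def F3_def)
  qed
qed

section \<open>The Hopf formula\<close>

context free_quotient
begin

text \<open>\<open>F0\<close> and \<open>F1\<close> are the terms of the canonical resolution of the ground field in degrees 0 and 1,
  and \<open>K1\<close>, \<open>K2\<close> are the kernels.  \<open>F0\<close> is free on the elements \<open>t\<close> of the field, including
  \<open>t = 0\<close>.\<close>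

abbreviation (input) triv :: "(('x word \<Rightarrow>\<^sub>0 'k) set, 'k) module" where "triv \<equiv> triv_module Q"
abbreviation (input) F0 :: "(('x word \<Rightarrow>\<^sub>0 'k) set, 'k \<Rightarrow> ('x word \<Rightarrow>\<^sub>0 'k) set) module" where
  "F0 \<equiv> free_cover Q triv"
abbreviation (input) K1 :: "(('x word \<Rightarrow>\<^sub>0 'k) set, 'k \<Rightarrow> ('x word \<Rightarrow>\<^sub>0 'k) set) module" where
  "K1 \<equiv> syzygy Q triv"
abbreviation (input) F1 ::
  "(('x word \<Rightarrow>\<^sub>0 'k) set, ('k \<Rightarrow> ('x word \<Rightarrow>\<^sub>0 'k) set) \<Rightarrow> ('x word \<Rightarrow>\<^sub>0 'k) set) module" where
  "F1 \<equiv> free_cover Q K1"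
abbreviation (input) K2 ::
  "(('x word \<Rightarrow>\<^sub>0 'k) set, ('k \<Rightarrow> ('x word \<Rightarrow>\<^sub>0 'k) set) \<Rightarrow> ('x word \<Rightarrow>\<^sub>0 'k) set) module" where
  "K2 \<equiv> syzygy Q K1"

lemma aug_left_module_triv: "aug_left_module Q triv"
  by (intro aug_left_module.intro augmented_algebra_Q augmented_algebra.left_module_triv)

lemma aug_left_module_K1: "aug_left_module Q K1"
  by (rule aug_left_module.aug_left_module_syzygy[OF aug_left_module_triv])

lemma aug_left_module_K2: "aug_left_module Q K2"
  by (rule aug_left_module.aug_left_module_syzygy[OF aug_left_module_K1])

lemma left_module_F0: "left_module Q F0"
  by (rule left_module.left_module_free_cover[OF augmented_algebra.left_module_triv[OF augmented_algebra_Q]])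

lemma left_module_K1: "left_module Q K1"
  using aug_left_module_K1 by (simp add: aug_left_module_def)

lemma left_module_F1: "left_module Q F1"
  by (rule left_module.left_module_free_cover[OF left_module_K1])

text \<open>Representatives in the free algebra.  The representative of zero is zero so that finite supports are
  preserved.\<close>

definition rep :: "('x word \<Rightarrow>\<^sub>0 'k) set \<Rightarrow> ('x word \<Rightarrow>\<^sub>0 'k)" where
  "rep b = (if b = K then 0 else SOME p. b = cls p)"

lemma rep_K [simp]: "rep K = 0"
  by (simp add: rep_def)

lemma cls_rep: "b \<in> carrier Q \<Longrightarrow> cls (rep b) = b"
proof (cases "b = K")
  case False
  assume "b \<in> carrier Q"
  then obtain p where "b = cls p" by (auto simp: carrier_Q)
  then have "b = cls (SOME p. b = cls p)" by (rule someI)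
  with False show ?thesis by (simp add: rep_def)
qed (simp add: cls_zero)

lemma rep_cls: "rep (cls p) - p \<in> K"
proof -
  have "cls (rep (cls p)) = cls p"
    by (rule cls_rep) (simp add: carrier_Q)
  then show ?thesis by (simp only: cls_eq_iff)
qed

lemma counit_rep: "b \<in> carrier Q \<Longrightarrow> counit (rep b) = aug Q b"
  using aug_Q[of "rep b"] by (simp add: cls_rep)

lemma rep_add: "b \<in> carrier Q \<Longrightarrow> c \<in> carrier Q \<Longrightarrow> rep (b \<oplus>\<^bsub>Q\<^esub> c) - rep b - rep c \<in> K"
proof -
  assume "b \<in> carrier Q" "c \<in> carrier Q"
  then have "b \<oplus>\<^bsub>Q\<^esub> c = cls (rep b + rep c)" using add_Q[of "rep b" "rep c"] by (simp add: cls_rep)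
  then show ?thesis using rep_cls[of "rep b + rep c"] by (simp add: diff_diff_eq)
qed

lemma rep_mult: "b \<in> carrier Q \<Longrightarrow> c \<in> carrier Q \<Longrightarrow> rep (b \<otimes>\<^bsub>Q\<^esub> c) - rep b * rep c \<in> K"
proof -
  assume "b \<in> carrier Q" "c \<in> carrier Q"
  then have "b \<otimes>\<^bsub>Q\<^esub> c = cls (rep b * rep c)" using mult_Q[of "rep b" "rep c"] by (simp add: cls_rep)
  then show ?thesis using rep_cls[of "rep b * rep c"] by simp
qed

lemma K_Q_simps:
  "K \<in> carrier Q" "x \<in> carrier Q \<Longrightarrow> K \<oplus>\<^bsub>Q\<^esub> x = x" "x \<in> carrier Q \<Longrightarrow> x \<oplus>\<^bsub>Q\<^esub> K = x"
  "x \<in> carrier Q \<Longrightarrow> x \<otimes>\<^bsub>Q\<^esub> K = K" "x \<in> carrier Q \<Longrightarrow> K \<otimes>\<^bsub>Q\<^esub> x = K"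
proof -
  interpret ring Q by (rule ring_Q)
  show "K \<in> carrier Q" "x \<in> carrier Q \<Longrightarrow> K \<oplus>\<^bsub>Q\<^esub> x = x" "x \<in> carrier Q \<Longrightarrow> x \<oplus>\<^bsub>Q\<^esub> K = x"
    "x \<in> carrier Q \<Longrightarrow> x \<otimes>\<^bsub>Q\<^esub> K = K" "x \<in> carrier Q \<Longrightarrow> K \<otimes>\<^bsub>Q\<^esub> x = K"
    using zero_closed l_zero[of x] r_zero[of x] r_null[of x] l_null[of x] unfolding zero_Q by auto
qed

text \<open>The linear combination of the \<open>w i\<close> with coefficients \<open>f i\<close>, lifted to the free algebra; it is linear
  in \<open>f\<close> modulo \<open>K w\<^sub>i\<close>.\<close>

definition comb :: "('i \<Rightarrow> ('x word \<Rightarrow>\<^sub>0 'k)) \<Rightarrow> ('i \<Rightarrow> ('x word \<Rightarrow>\<^sub>0 'k) set) \<Rightarrow> ('x word \<Rightarrow>\<^sub>0 'k)" where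
  "comb w f = (\<Sum>i\<in>{i. f i \<noteq> K}. rep (f i) * w i)"

lemma comb_superset: "finite A \<Longrightarrow> {i. f i \<noteq> K} \<subseteq> A \<Longrightarrow> comb w f = (\<Sum>i\<in>A. rep (f i) * w i)"
  unfolding comb_def by (intro sum.mono_neutral_left) auto

lemma free_lmodule_Q:
  assumes "f \<in> carrier (free_lmodule Q S)"
  shows "f i \<in> carrier Q" "finite {i. f i \<noteq> K}" "{i. f i \<noteq> K} \<subseteq> S"
  using assms ring.free_lmodule_value[OF ring_Q assms] by (auto simp: free_lmodule_simps zero_Q)

lemma comb_zero: "comb w (\<lambda>_. K) = 0"
  by (simp add: comb_def)

context
  fixes M :: "('x word \<Rightarrow>\<^sub>0 'k) set" and w :: "'i \<Rightarrow> ('x word \<Rightarrow>\<^sub>0 'k)" and S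
  assumes M: "free_ideal M" and w: "\<And>i k. i \<in> S \<Longrightarrow> k \<in> K \<Longrightarrow> k * w i \<in> M"
begin

lemma comb_add:
  assumes f: "f \<in> carrier (free_lmodule Q S)" and g: "g \<in> carrier (free_lmodule Q S)"
  shows "comb w (f \<oplus>\<^bsub>free_lmodule Q S\<^esub> g) - (comb w f + comb w g) \<in> M"
proof -
  interpret M: free_ideal M by (rule M)
  interpret ring Q by (rule ring_Q)
  note f = free_lmodule_Q[OF f] and g = free_lmodule_Q[OF g]
  let ?A = "{i. f i \<noteq> K} \<union> {i. g i \<noteq> K}"
  have A: "finite ?A" "?A \<subseteq> S" using f g by auto
  have KK: "K \<oplus>\<^bsub>Q\<^esub> K = K" by (simp add: K_Q_simps)
  have "comb w (f \<oplus>\<^bsub>free_lmodule Q S\<^esub> g) = (\<Sum>i\<in>?A. rep (f i \<oplus>\<^bsub>Q\<^esub> g i) * w i)"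
    unfolding free_lmodule_simps using A KK by (intro comb_superset) auto
  moreover have "comb w f = (\<Sum>i\<in>?A. rep (f i) * w i)" "comb w g = (\<Sum>i\<in>?A. rep (g i) * w i)"
    using A by (auto intro: comb_superset)
  ultimately have "comb w (f \<oplus>\<^bsub>free_lmodule Q S\<^esub> g) - (comb w f + comb w g) =
      (\<Sum>i\<in>?A. (rep (f i \<oplus>\<^bsub>Q\<^esub> g i) - rep (f i) - rep (g i)) * w i)"
    by (simp add: sum_subtractf sum.distrib algebra_simps)
  also have "\<dots> \<in> M" using A f g by (intro M.sum w rep_add) auto
  finally show ?thesis .
qed

lemma comb_smult:
  assumes f: "f \<in> carrier (free_lmodule Q S)" and b: "b \<in> carrier Q"
  shows "comb w (b \<odot>\<^bsub>free_lmodule Q S\<^esub> f) - rep b * comb w f \<in> M"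
proof -
  interpret M: free_ideal M by (rule M)
  interpret ring Q by (rule ring_Q)
  note f = free_lmodule_Q[OF f]
  let ?A = "{i. f i \<noteq> K}"
  have "b \<otimes>\<^bsub>Q\<^esub> K = K" using b by (simp add: K_Q_simps)
  then have "comb w (b \<odot>\<^bsub>free_lmodule Q S\<^esub> f) = (\<Sum>i\<in>?A. rep (b \<otimes>\<^bsub>Q\<^esub> f i) * w i)"
    unfolding free_lmodule_simps using f by (intro comb_superset) auto
  then have "comb w (b \<odot>\<^bsub>free_lmodule Q S\<^esub> f) - rep b * comb w f =
      (\<Sum>i\<in>?A. (rep (b \<otimes>\<^bsub>Q\<^esub> f i) - rep b * rep (f i)) * w i)"
    by (simp add: comb_def sum_subtractf sum_distrib_left left_diff_distrib mult.assoc)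
  also have "\<dots> \<in> M" using f b by (intro M.sum w rep_mult) auto
  finally show ?thesis .
qed

end

lemma comb_step:
  assumes b: "b \<in> carrier Q" and f: "f \<in> carrier (free_lmodule Q S)" and fs: "f s = K"
  shows "comb w (b \<odot>\<^bsub>free_lmodule Q S\<^esub> unit_fun Q s \<oplus>\<^bsub>free_lmodule Q S\<^esub> f) = rep b * w s + comb w f"
proof -
  interpret ring Q by (rule ring_Q)
  note f' = free_lmodule_Q[OF f]
  have eq: "b \<odot>\<^bsub>free_lmodule Q S\<^esub> unit_fun Q s \<oplus>\<^bsub>free_lmodule Q S\<^esub> f = f(s := b)"
  proof
    fix t
    show "(b \<odot>\<^bsub>free_lmodule Q S\<^esub> unit_fun Q s \<oplus>\<^bsub>free_lmodule Q S\<^esub> f) t = (f(s := b)) t"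
      using b f'(1)[of t] fs by (cases "t = s") (simp_all add: free_lmodule_simps unit_fun_def zero_Q K_Q_simps)
  qed
  let ?A = "{i. f i \<noteq> K}"
  have "comb w (f(s := b)) = (\<Sum>i\<in>insert s ?A. rep ((f(s := b)) i) * w i)"
    using f' by (intro comb_superset) auto
  also have "\<dots> = rep b * w s + (\<Sum>i\<in>?A. rep ((f(s := b)) i) * w i)"
    using f' fs by (subst sum.insert) auto
  also have "(\<Sum>i\<in>?A. rep ((f(s := b)) i) * w i) = comb w f"
    unfolding comb_def using fs by (intro sum.cong) auto
  finally show ?thesis unfolding eq .
qed

lemma comb_unit:
  assumes b: "b \<in> carrier Q"
  shows "comb w (b \<odot>\<^bsub>free_lmodule Q S\<^esub> unit_fun Q s) = rep b * w s"
proof -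
  interpret ring Q by (rule ring_Q)
  have "b \<odot>\<^bsub>free_lmodule Q S\<^esub> unit_fun Q s = (\<lambda>_. K)(s := b)"
  proof
    fix t
    show "(b \<odot>\<^bsub>free_lmodule Q S\<^esub> unit_fun Q s) t = ((\<lambda>_. K)(s := b)) t"
      using b by (cases "t = s") (simp_all add: free_lmodule_simps unit_fun_def zero_Q K_Q_simps)
  qed
  moreover have "comb w ((\<lambda>_. K)(s := b)) = (\<Sum>i\<in>{s}. rep (((\<lambda>_. K)(s := b)) i) * w i)"
    by (rule comb_superset) auto
  ultimately show ?thesis by simp
qed

text \<open>\<open>F0\<close> maps to the algebra by sending the basis element at \<open>t\<close> to the scalar \<open>t\<close>, which
  lifts the identity of the ground field; \<open>aug_rep\<close> is this map, lifted to the free algebra.  It takes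
  the first syzygies into the augmentation ideal.\<close>

definition aug_rep :: "('k \<Rightarrow> ('x word \<Rightarrow>\<^sub>0 'k) set) \<Rightarrow> ('x word \<Rightarrow>\<^sub>0 'k)" where
  "aug_rep = comb const"

text \<open>For \<open>f = \<Sum> b\<^sub>n [n]\<close> in \<open>F1\<close> this is \<open>\<Sum> b\<^sub>n v\<^sub>n\<close>, where \<open>v\<^sub>n\<close> is \<open>aug_rep n\<close>.  On the
  second syzygies it takes values in \<open>K\<close>, and modulo \<open>IK + KI\<close> it is a well-defined linear map:
  this is the Hopf map.\<close>

definition total_rep :: "(('k \<Rightarrow> ('x word \<Rightarrow>\<^sub>0 'k) set) \<Rightarrow> ('x word \<Rightarrow>\<^sub>0 'k) set) \<Rightarrow> ('x word \<Rightarrow>\<^sub>0 'k)" where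
  "total_rep = comb aug_rep"

lemma F0_eq: "F0 = free_lmodule Q UNIV"
  by (simp add: free_cover_def)

lemma F1_eq: "F1 = free_lmodule Q (carrier K1)"
  by (simp add: free_cover_def)

lemma K1_simps:
  "carrier K1 = {n \<in> carrier F0. cover_map Q triv n = 0}" "\<zero>\<^bsub>K1\<^esub> = \<zero>\<^bsub>F0\<^esub>"
  "n \<oplus>\<^bsub>K1\<^esub> n' = n \<oplus>\<^bsub>F0\<^esub> n'" "b \<odot>\<^bsub>K1\<^esub> n = b \<odot>\<^bsub>F0\<^esub> n"
  using left_module.syzygy_simps[OF augmented_algebra.left_module_triv[OF augmented_algebra_Q]] by auto

lemmas K2_simps = left_module.syzygy_simps[OF left_module_K1]

lemma free_ideal_K: "free_ideal K" by unfold_locales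

lemma free_ideal_decomposables: "free_ideal (decomposables K)"
  by (rule free_ideal.intro[OF ideal_decomposables[OF ideal]])

lemma cover_triv: "n \<in> carrier F0 \<Longrightarrow> cover_map Q triv n = counit (aug_rep n)"
proof -
  interpret T: left_module Q triv by (rule augmented_algebra.left_module_triv[OF augmented_algebra_Q])
  interpret F0: left_module Q F0 by (rule left_module_F0)
  have "n \<in> carrier (free_lmodule Q UNIV) \<Longrightarrow> cover_map Q triv n = counit (aug_rep n)"
  proof (induction rule: T.free_lmodule_induct[where I = UNIV, consumes 1, case_names _ _ zero step])
    case zero
    show ?case using T.cover_map_zero
      by (simp add: F0_eq free_lmodule_simps zero_Q aug_rep_def comb_zero)
  next
    case (step s b f)
    have u: "unit_fun Q s \<in> carrier F0" using T.unit_fun_in_free_cover[of s] by simp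
    have "cover_map Q triv (b \<odot>\<^bsub>F0\<^esub> unit_fun Q s \<oplus>\<^bsub>F0\<^esub> f) = aug Q b * s + counit (aug_rep f)"
      using step u T.cover_map_unit_fun[of s] unfolding F0_eq[symmetric]
      by (simp add: T.cover_map_add T.cover_map_smult F0.lm_closed)
    also have "\<dots> = counit (aug_rep (b \<odot>\<^bsub>F0\<^esub> unit_fun Q s \<oplus>\<^bsub>F0\<^esub> f))"
      using step unfolding aug_rep_def F0_eq
      by (simp add: comb_step zero_Q lookup_add counit_mult counit_rep)
    finally show ?case by (simp add: F0_eq)
  qed auto
  then show "n \<in> carrier F0 \<Longrightarrow> cover_map Q triv n = counit (aug_rep n)" by (simp add: F0_eq)
qed

lemma aug_rep_K1: "n \<in> carrier K1 \<Longrightarrow> aug_rep n \<in> min_length 1"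
proof -
  assume "n \<in> carrier K1"
  then have "n \<in> carrier F0" "cover_map Q triv n = 0" unfolding K1_simps by blast+
  then show ?thesis using cover_triv[of n] by (simp add: min_length_1_iff del: One_nat_def)
qed

lemma aug_rep_add:
  assumes "n \<in> carrier F0" "n' \<in> carrier F0"
  shows "aug_rep (n \<oplus>\<^bsub>F0\<^esub> n') - (aug_rep n + aug_rep n') \<in> K"
  using comb_add[where w = const and S = UNIV and f = n and g = n', OF free_ideal_K rmult] assms
  unfolding aug_rep_def F0_eq by simp

lemma aug_rep_smult:
  assumes "n \<in> carrier F0" "b \<in> carrier Q"
  shows "aug_rep (b \<odot>\<^bsub>F0\<^esub> n) - rep b * aug_rep n \<in> K"
  using comb_smult[where w = const and S = UNIV and f = n and b = b, OF free_ideal_K rmult] assms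
  unfolding aug_rep_def F0_eq by simp

lemma total_rep_add:
  assumes "f \<in> carrier F1" "g \<in> carrier F1"
  shows "total_rep (f \<oplus>\<^bsub>F1\<^esub> g) - (total_rep f + total_rep g) \<in> decomposables K"
  using comb_add[where w = aug_rep and S = "carrier K1" and f = f and g = g, OF free_ideal_decomposables
    decomposablesI(2)[OF ideal aug_rep_K1]] assms
  unfolding total_rep_def F1_eq by simp

lemma total_rep_smult:
  assumes "f \<in> carrier F1" "b \<in> carrier Q"
  shows "total_rep (b \<odot>\<^bsub>F1\<^esub> f) - rep b * total_rep f \<in> decomposables K"
  using comb_smult[where w = aug_rep and S = "carrier K1" and f = f and b = b, OF free_ideal_decomposables
    decomposablesI(2)[OF ideal aug_rep_K1]] assms
  unfolding total_rep_def F1_eq by simp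

lemma total_rep_cover:
  assumes "f \<in> carrier F1"
  shows "aug_rep (cover_map Q K1 f) - total_rep f \<in> K"
proof -
  note zero_in_K = zero
  interpret K1: left_module Q K1 by (rule left_module_K1)
  interpret F1: left_module Q F1 by (rule left_module_F1)
  interpret F0: left_module Q F0 by (rule left_module_F0)
  have "f \<in> carrier (free_lmodule Q (carrier K1)) \<Longrightarrow> aug_rep (cover_map Q K1 f) - total_rep f \<in> K"
  proof (induction rule: K1.free_lmodule_induct[where I = UNIV, consumes 1, case_names _ _ zero step])
    case zero
    have "cover_map Q K1 (\<lambda>_. \<zero>\<^bsub>Q\<^esub>) = (\<lambda>_. K)"
      using K1.cover_map_zero by (simp add: F1_eq F0_eq K1_simps free_lmodule_simps(2) zero_Q)
    then show ?case by (simp add: total_rep_def aug_rep_def comb_zero zero_in_K zero_Q)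
  next
    case (step n b f)
    have u: "unit_fun Q n \<in> carrier F1" using K1.unit_fun_in_free_cover step by simp
    have n: "n \<in> carrier F0" and c: "cover_map Q K1 f \<in> carrier F0"
      using step K1.cover_map_closed[of f] unfolding F1_eq by (auto simp: K1_simps)
    have "cover_map Q K1 (b \<odot>\<^bsub>F1\<^esub> unit_fun Q n \<oplus>\<^bsub>F1\<^esub> f) = b \<odot>\<^bsub>F0\<^esub> n \<oplus>\<^bsub>F0\<^esub> cover_map Q K1 f"
      using step u K1.cover_map_unit_fun unfolding F1_eq[symmetric]
      by (simp add: K1.cover_map_add K1.cover_map_smult F1.lm_closed K1_simps)
    moreover have "aug_rep (b \<odot>\<^bsub>F0\<^esub> n \<oplus>\<^bsub>F0\<^esub> cover_map Q K1 f)
        - (aug_rep (b \<odot>\<^bsub>F0\<^esub> n) + aug_rep (cover_map Q K1 f)) \<in> K"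
      using step n c by (intro aug_rep_add F0.lm_closed)
    moreover have "aug_rep (b \<odot>\<^bsub>F0\<^esub> n) - rep b * aug_rep n \<in> K"
      using step n by (intro aug_rep_smult)
    moreover have "total_rep (b \<odot>\<^bsub>F1\<^esub> unit_fun Q n \<oplus>\<^bsub>F1\<^esub> f) = rep b * aug_rep n + total_rep f"
      using step unfolding total_rep_def F1_eq by (simp add: comb_step zero_Q)
    moreover have "x - (y + z) \<in> K \<Longrightarrow> y - r \<in> K \<Longrightarrow> z - t \<in> K \<Longrightarrow> x - (r + t) \<in> K" for x y z r t
      using add[OF add[of "x - (y + z)" "y - r"], of "z - t"] by (simp add: algebra_simps)
    ultimately show ?case using step unfolding F1_eq by simp
  qed auto
  with assms show ?thesis by (simp add: F1_eq)
qed

text \<open>The basis element at \<open>1\<close> spans a copy of the algebra in \<open>F0\<close>, and multiplying it by an element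
  of the augmentation ideal gives a first syzygy.\<close>

definition gen_cycle :: "'x \<Rightarrow> 'k \<Rightarrow> ('x word \<Rightarrow>\<^sub>0 'k) set" where
  "gen_cycle g = cls (gen g) \<odot>\<^bsub>F0\<^esub> unit_fun Q 1"

lemma unit_F0: "unit_fun Q t \<in> carrier F0"
  unfolding F0_eq by (rule ring.unit_fun_closed[OF ring_Q]) simp

lemma cls_carrier: "cls p \<in> carrier Q"
  by (simp add: carrier_Q)

lemma cover_triv_unit: "cover_map Q triv (unit_fun Q t) = t"
proof -
  interpret T: left_module Q triv by (rule augmented_algebra.left_module_triv[OF augmented_algebra_Q])
  show ?thesis by (rule T.cover_map_unit_fun) simp
qed

lemma cover_triv_smult:
  "b \<in> carrier Q \<Longrightarrow> n \<in> carrier F0 \<Longrightarrow> cover_map Q triv (b \<odot>\<^bsub>F0\<^esub> n) = aug Q b * cover_map Q triv n"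
proof -
  interpret T: left_module Q triv by (rule augmented_algebra.left_module_triv[OF augmented_algebra_Q])
  show "b \<in> carrier Q \<Longrightarrow> n \<in> carrier F0 \<Longrightarrow> cover_map Q triv (b \<odot>\<^bsub>F0\<^esub> n) = aug Q b * cover_map Q triv n"
    using T.cover_map_smult[of n b] by simp
qed

lemma cover_triv_add:
  "n \<in> carrier F0 \<Longrightarrow> n' \<in> carrier F0 \<Longrightarrow>
    cover_map Q triv (n \<oplus>\<^bsub>F0\<^esub> n') = cover_map Q triv n + cover_map Q triv n'"
proof -
  interpret T: left_module Q triv by (rule augmented_algebra.left_module_triv[OF augmented_algebra_Q])
  show "n \<in> carrier F0 \<Longrightarrow> n' \<in> carrier F0 \<Longrightarrow>
    cover_map Q triv (n \<oplus>\<^bsub>F0\<^esub> n') = cover_map Q triv n + cover_map Q triv n'"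
    using T.cover_map_add[of n n'] by simp
qed

lemma gen_cycle_K1: "gen_cycle g \<in> carrier K1"
proof -
  interpret F0: left_module Q F0 by (rule left_module_F0)
  have "gen_cycle g \<in> carrier F0"
    unfolding gen_cycle_def by (intro F0.lm_closed cls_carrier unit_F0)
  moreover have "cover_map Q triv (gen_cycle g) = 0"
    unfolding gen_cycle_def cover_triv_smult[OF cls_carrier unit_F0] by (simp add: aug_Q)
  ultimately show ?thesis unfolding K1_simps by blast
qed

text \<open>The augmentation ideal of a free algebra is the free left module on the generators; \<open>fox\<close> extracts
  the coefficient of a generator, the left Fox derivative, which cuts off the last letter.
  Generators with the same \<open>gen_cycle\<close> are collected.\<close>

definition fox :: "('k \<Rightarrow> ('x word \<Rightarrow>\<^sub>0 'k) set) \<Rightarrow> ('x word \<Rightarrow>\<^sub>0 'k) \<Rightarrow> ('x word \<Rightarrow>\<^sub>0 'k)" where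
  "fox n = free.lin_ext (\<lambda>w. if letters w \<noteq> [] \<and> gen_cycle (last (letters w)) = n
     then Poly_Mapping.single (Word (butlast (letters w))) 1 else 0)"

lemma fox_add: "fox n (p + q) = fox n p + fox n q"
  by (simp add: fox_def free.lin_ext_add)

lemma fox_mult_gen: "fox n (q * gen g) = (if gen_cycle g = n then q else 0)"
proof (induction q rule: poly_mapping_single_induct)
  case (single w c)
  have "Poly_Mapping.single w c * gen g = Poly_Mapping.single (Word (letters w @ [g])) c"
    by (simp add: gen_def mult_single plus_word_def)
  then show ?case by (simp add: fox_def free.lin_ext_single mult_single)
next
  case (add p q)
  then show ?case by (simp add: distrib_right fox_add)
qed

lemma single_snoc:
  assumes "Suc n \<le> length (letters w)"
  obtains X g where "X \<in> min_length n" "Poly_Mapping.single w (c::'k) = X * gen g"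
proof -
  obtain ws g where ws: "letters w = ws @ [g]" using assms by (metis Suc_le_length_iff rev_exhaust list.distinct(1))
  then have w: "w = Word (ws @ [g])" by (cases w) simp
  have "Poly_Mapping.single (Word ws) c \<in> min_length n"
    using assms ws by (auto simp: min_length_def)
  then show thesis using that unfolding w single_Word_snoc by blast
qed

lemma min_length_snoc_induct [consumes 1, case_names snoc add]:
  assumes "p \<in> min_length (Suc n)"
    and "\<And>X g. X \<in> min_length n \<Longrightarrow> R (X * gen g)"
    and "\<And>p q. p \<in> min_length (Suc n) \<Longrightarrow> q \<in> min_length (Suc n) \<Longrightarrow> R p \<Longrightarrow> R q \<Longrightarrow> R (p + q)"
  shows "R (p :: 'x word \<Rightarrow>\<^sub>0 'k)"
proof -
  from assms(1) have "R p \<and> p \<in> min_length (Suc n)"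
  proof (induction rule: min_length_induct)
    case (single w c)
    then obtain X g where "X \<in> min_length n" "Poly_Mapping.single w c = X * gen g"
      by (rule single_snoc)
    moreover have "Poly_Mapping.single w c \<in> min_length (Suc n)"
      using single by (simp add: min_length_def)
    ultimately show ?case using assms(2) by simp
  next
    case (add p q)
    then show ?case using assms(3) min_length_add by blast
  qed
  then show ?thesis ..
qed

lemma fox_lmult: "p \<in> min_length 1 \<Longrightarrow> fox n (q * p) = q * fox n p"
  unfolding One_nat_def
proof (induction rule: min_length_snoc_induct)
  case (snoc X g)
  then show ?case by (simp add: fox_mult_gen flip: mult.assoc)
qed (simp add: fox_add distrib_left)

lemma fox_min_length: "p \<in> min_length 2 \<Longrightarrow> fox n p \<in> min_length 1"
  unfolding numeral_2_eq_2 One_nat_def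
proof (induction rule: min_length_snoc_induct)
  case (snoc X g)
  then show ?case by (simp add: fox_mult_gen)
qed (simp add: fox_add min_length_add)

text \<open>The map from the augmentation ideal to \<open>F1\<close> that sends each generator to the basis element at its
  \<open>gen_cycle\<close>.\<close>

definition fox_lift :: "('x word \<Rightarrow>\<^sub>0 'k) \<Rightarrow> ('k \<Rightarrow> ('x word \<Rightarrow>\<^sub>0 'k) set) \<Rightarrow> ('x word \<Rightarrow>\<^sub>0 'k) set" where
  "fox_lift p = (\<lambda>n. cls (fox n p))"

lemma fox_lift_add: "fox_lift (p + q) = fox_lift p \<oplus>\<^bsub>F1\<^esub> fox_lift q"
  unfolding fox_lift_def F1_eq free_lmodule_simps fox_add add_Q ..

lemma fox_lift_lmult: "p \<in> min_length 1 \<Longrightarrow> fox_lift (q * p) = cls q \<odot>\<^bsub>F1\<^esub> fox_lift p"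
  unfolding fox_lift_def F1_eq free_lmodule_simps by (simp add: fox_lmult mult_Q)

lemma fox_lift_gen: "fox_lift (X * gen g) = cls X \<odot>\<^bsub>F1\<^esub> unit_fun Q (gen_cycle g)"
proof
  fix n
  show "fox_lift (X * gen g) n = (cls X \<odot>\<^bsub>F1\<^esub> unit_fun Q (gen_cycle g)) n"
    by (cases "gen_cycle g = n")
      (auto simp: fox_lift_def F1_eq free_lmodule_simps fox_mult_gen unit_fun_def one_Q mult_Q zero_Q
        cls_zero K_Q_simps cls_carrier)
qed

lemma fox_lift_closed: "p \<in> min_length 1 \<Longrightarrow> fox_lift p \<in> carrier F1"
  unfolding One_nat_def
proof (induction rule: min_length_snoc_induct)
  interpret K1: left_module Q K1 by (rule left_module_K1)
  interpret F1: left_module Q F1 by (rule left_module_F1)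
  {
    case (snoc X g)
    show ?case unfolding fox_lift_gen
      by (intro F1.lm_closed cls_carrier K1.unit_fun_in_free_cover gen_cycle_K1)
  next
    case (add p q)
    show ?case unfolding fox_lift_add by (rule F1.N.a_closed[OF add.IH])
  }
qed

lemma cover_fox_lift: "p \<in> min_length 1 \<Longrightarrow> cover_map Q K1 (fox_lift p) = cls p \<odot>\<^bsub>F0\<^esub> unit_fun Q 1"
  unfolding One_nat_def
proof (induction rule: min_length_snoc_induct)
  interpret F0: left_module Q F0 by (rule left_module_F0)
  interpret K1: left_module Q K1 by (rule left_module_K1)
  interpret F1: left_module Q F1 by (rule left_module_F1)
  {
    case (snoc X g)
    have "cover_map Q K1 (fox_lift (X * gen g)) = cls X \<odot>\<^bsub>K1\<^esub> gen_cycle g"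
      unfolding fox_lift_gen K1.cover_map_smult[OF K1.unit_fun_in_free_cover[OF gen_cycle_K1] cls_carrier]
        K1.cover_map_unit_fun[OF gen_cycle_K1] ..
    also have "\<dots> = cls X \<odot>\<^bsub>F0\<^esub> (cls (gen g) \<odot>\<^bsub>F0\<^esub> unit_fun Q 1)"
      by (simp only: K1_simps gen_cycle_def)
    also have "\<dots> = cls (X * gen g) \<odot>\<^bsub>F0\<^esub> unit_fun Q 1"
      unfolding F0.lm_assoc[OF cls_carrier cls_carrier unit_F0, symmetric] mult_Q ..
    finally show ?case .
  next
    case (add p q)
    have c: "fox_lift p \<in> carrier F1" "fox_lift q \<in> carrier F1"
      using add.hyps fox_lift_closed by (simp_all add: One_nat_def[symmetric] del: One_nat_def)
    show ?case
      unfolding fox_lift_add K1.cover_map_add[OF c] add.IH K1_simps add_Q[symmetric]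
      by (rule F0.lm_l_distr[OF cls_carrier cls_carrier unit_F0, symmetric])
  }
qed

lemma fox_lift_cycle:
  assumes "j \<in> K" shows "fox_lift j \<in> carrier K2"
proof -
  interpret F0: left_module Q F0 by (rule left_module_F0)
  have j: "j \<in> min_length 1" using assms K_aug by blast
  have "cls j = \<zero>\<^bsub>Q\<^esub>" using assms unfolding zero_Q cls_eq_K_iff .
  then have "cover_map Q K1 (fox_lift j) = \<zero>\<^bsub>K1\<^esub>"
    unfolding cover_fox_lift[OF j] K1_simps by (simp only: F0.lm_l_zero[OF unit_F0])
  then show ?thesis unfolding K2_simps using fox_lift_closed[OF j] by blast
qed

lemma fox_lift_decomposable: "p \<in> decomposables K \<Longrightarrow> fox_lift p \<in> aug_mult Q K2"
proof (induction rule: decomposables_induct)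
  interpret K2: aug_left_module Q K2 by (rule aug_left_module_K2)
  interpret F1: left_module Q F1 by (rule left_module_F1)
  {
    case (lmult p j)
    have "j \<in> min_length 1" using lmult K_aug by blast
    then have "fox_lift (p * j) = cls p \<odot>\<^bsub>K2\<^esub> fox_lift j"
      unfolding K2_simps by (rule fox_lift_lmult)
    moreover have "aug Q (cls p) = 0"
      using lmult by (simp add: aug_Q min_length_1_iff del: One_nat_def)
    ultimately show ?case
      using K2.aug_mult_base[OF cls_carrier] fox_lift_cycle lmult by simp
  next
    case (rmult p j)
    have "cls j = \<zero>\<^bsub>Q\<^esub>" using rmult unfolding zero_Q cls_eq_K_iff by blast
    then have "fox_lift (j * p) = \<zero>\<^bsub>K2\<^esub>"
      unfolding fox_lift_lmult[OF rmult(1)] K2_simps by (simp only: F1.lm_l_zero[OF fox_lift_closed[OF rmult(1)]])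
    then show ?case by (simp only: aug_mult.zero)
  next
    case (add p q)
    then show ?case using K2.aug_mult_add[OF add] unfolding fox_lift_add K2_simps by blast
  }
qed

text \<open>So \<open>fox_lift\<close> is a section of the Hopf map.  The classes of \<open>X\<close> and of \<open>gen g\<close> are represented up
  to elements of \<open>K\<close>; the two errors lie in \<open>KI\<close> and in \<open>IK\<close>, the latter because \<open>X\<close> itself has
  augmentation zero.\<close>

lemma total_rep_fox_lift: "p \<in> min_length 2 \<Longrightarrow> total_rep (fox_lift p) - p \<in> decomposables K"
  unfolding numeral_2_eq_2
proof (induction rule: min_length_snoc_induct)
  interpret D: free_ideal "decomposables K" by (rule free_ideal_decomposables)
  {
    case (snoc X g)
    have X: "X \<in> min_length 1" using snoc by simp
    let ?u = "aug_rep (gen_cycle g)"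
    have S: "total_rep (fox_lift (X * gen g)) = rep (cls X) * ?u"
      unfolding fox_lift_gen total_rep_def F1_eq by (rule comb_unit[OF cls_carrier])
    have u: "?u = rep (cls (gen g))"
      unfolding aug_rep_def gen_cycle_def F0_eq comb_unit[OF cls_carrier] by simp
    have "(rep (cls X) - X) * ?u \<in> decomposables K"
      by (rule decomposablesI(2)[OF ideal aug_rep_K1[OF gen_cycle_K1] rep_cls])
    moreover have "X * (?u - gen g) \<in> decomposables K"
      unfolding u by (rule decomposablesI(1)[OF ideal X rep_cls])
    moreover have "rep (cls X) * ?u - X * gen g = (rep (cls X) - X) * ?u + X * (?u - gen g)"
      by (simp add: algebra_simps)
    ultimately show ?case unfolding S using D.add by simp
  next
    case (add p q)
    have c: "fox_lift p \<in> carrier F1" "fox_lift q \<in> carrier F1"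
      using add.hyps by (auto intro!: fox_lift_closed elim: min_length_mono)
    have "(total_rep (fox_lift p \<oplus>\<^bsub>F1\<^esub> fox_lift q) - (total_rep (fox_lift p) + total_rep (fox_lift q)))
      + (total_rep (fox_lift p) - p) + (total_rep (fox_lift q) - q) \<in> decomposables K"
      using total_rep_add[OF c] add.IH by (intro D.add)
    then show ?case unfolding fox_lift_add by (simp add: algebra_simps)
  }
qed

text \<open>\<open>F0\<close> is the direct sum of the copy of the algebra at \<open>1\<close> and the free module on the elements
  \<open>[t] - t [1]\<close> with \<open>t \<noteq> 1\<close>, which are syzygies.  For \<open>t = 1\<close> the element is zero.\<close>

definition shift_cycle :: "'k \<Rightarrow> 'k \<Rightarrow> ('x word \<Rightarrow>\<^sub>0 'k) set" where
  "shift_cycle t = unit_fun Q t \<oplus>\<^bsub>F0\<^esub> cls (const (- t)) \<odot>\<^bsub>F0\<^esub> unit_fun Q 1"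

lemma shift_cycle_K1: "shift_cycle t \<in> carrier K1"
proof -
  interpret F0: left_module Q F0 by (rule left_module_F0)
  have c: "cls (const (- t)) \<odot>\<^bsub>F0\<^esub> unit_fun Q 1 \<in> carrier F0"
    by (intro F0.lm_closed cls_carrier unit_F0)
  have "cover_map Q triv (shift_cycle t) = 0"
    unfolding shift_cycle_def cover_triv_add[OF unit_F0 c] cover_triv_smult[OF cls_carrier unit_F0] cover_triv_unit
    by (simp add: aug_Q)
  moreover have "shift_cycle t \<in> carrier F0" unfolding shift_cycle_def by (intro F0.N.a_closed unit_F0 c)
  ultimately show ?thesis unfolding K1_simps by blast
qed

lemma inj_shift_cycle: "inj shift_cycle"
proof (rule injI)
  fix s t assume eq: "shift_cycle s = shift_cycle t"
  have one: "cls 1 \<noteq> K"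
  proof
    assume "cls 1 = K"
    then have "1 \<in> K" by (simp only: cls_eq_K_iff)
    then have "(1 :: 'x word \<Rightarrow>\<^sub>0 'k) \<in> min_length 1" by (rule subsetD[OF K_aug])
    then show False by (simp add: min_length_1_iff del: One_nat_def)
  qed
  have val: "shift_cycle r r' = (if r' = r then cls 1 else K)" if "r' \<noteq> 1" for r r'
    using that by (simp add: shift_cycle_def F0_eq free_lmodule_simps unit_fun_def zero_Q one_Q K_Q_simps cls_carrier)
  show "s = t"
  proof (rule ccontr)
    assume "s \<noteq> t"
    show False
    proof (cases "s = 1")
      case False
      then show False using val[of s s] val[of s t] \<open>s \<noteq> t\<close> eq one by simp
    next
      case True
      then have "t \<noteq> 1" using \<open>s \<noteq> t\<close> by simp
      then show False using val[of t s] val[of t t] \<open>s \<noteq> t\<close> eq one by simp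
    qed
  qed
qed

text \<open>This sends the basis element at \<open>t\<close> in \<open>F0\<close> to the basis element of \<open>F1\<close> at \<open>[t] - t [1]\<close>; it is
  well defined because these syzygies are distinct for different \<open>t\<close>.\<close>

definition shift_lift :: "('k \<Rightarrow> ('x word \<Rightarrow>\<^sub>0 'k) set) \<Rightarrow> ('k \<Rightarrow> ('x word \<Rightarrow>\<^sub>0 'k) set) \<Rightarrow> ('x word \<Rightarrow>\<^sub>0 'k) set" where
  "shift_lift n = (\<lambda>m. if m \<in> range shift_cycle then n (inv_into UNIV shift_cycle m) else K)"

lemma shift_lift_closed:
  assumes "n \<in> carrier F0"
  shows "shift_lift n \<in> carrier F1"
proof -
  note n = free_lmodule_Q[OF assms[unfolded F0_eq]]
  have "{m. shift_lift n m \<noteq> K} \<subseteq> shift_cycle ` {t. n t \<noteq> K}"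
    by (auto simp: shift_lift_def inj_shift_cycle split: if_splits)
  then have "finite {m. shift_lift n m \<noteq> K}" using n(2) finite_surj by blast
  moreover have "shift_lift n m \<in> carrier Q" for m
    using n(1) K_Q_simps(1) unfolding shift_lift_def by simp
  moreover have "shift_lift n m = K" if "m \<notin> carrier K1" for m
    using that shift_cycle_K1 unfolding shift_lift_def by auto
  ultimately show ?thesis unfolding F1_eq free_lmodule_simps zero_Q by blast
qed

lemma shift_lift_add:
  "shift_lift (n \<oplus>\<^bsub>F0\<^esub> n') = shift_lift n \<oplus>\<^bsub>F1\<^esub> shift_lift n'"
  unfolding shift_lift_def F0_eq F1_eq free_lmodule_simps by (rule ext) (simp add: K_Q_simps)

lemma shift_lift_smult:
  "b \<in> carrier Q \<Longrightarrow> shift_lift (b \<odot>\<^bsub>F0\<^esub> n) = b \<odot>\<^bsub>F1\<^esub> shift_lift n"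
  unfolding shift_lift_def F0_eq F1_eq free_lmodule_simps by (rule ext) (simp add: K_Q_simps)

lemma shift_lift_unit: "shift_lift (unit_fun Q t) = unit_fun Q (shift_cycle t)"
proof
  fix m
  show "shift_lift (unit_fun Q t) m = unit_fun Q (shift_cycle t) m"
  proof (cases "m \<in> range shift_cycle")
    case True
    then obtain s where m: "m = shift_cycle s" by blast
    then show ?thesis
      by (simp add: shift_lift_def unit_fun_def inv_f_f[OF inj_shift_cycle] inj_eq[OF inj_shift_cycle])
  next
    case False
    then have "m \<noteq> shift_cycle t" by blast
    with False show ?thesis by (simp only: shift_lift_def unit_fun_def zero_Q if_False)
  qed
qed

text \<open>Every \<open>n = \<Sum> b\<^sub>t [t]\<close> equals \<open>\<Sum> b\<^sub>t ([t] - t [1]) + (\<Sum> b\<^sub>t t) [1]\<close>.\<close>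

lemma cover_shift_lift:
  assumes "n \<in> carrier F0"
  shows "cover_map Q K1 (shift_lift n) \<oplus>\<^bsub>F0\<^esub> cls (aug_rep n) \<odot>\<^bsub>F0\<^esub> unit_fun Q 1 = n"
proof -
  interpret F0: left_module Q F0 by (rule left_module_F0)
  interpret K1: left_module Q K1 by (rule left_module_K1)
  interpret F1: left_module Q F1 by (rule left_module_F1)
  let ?e = "unit_fun Q (1::'k)"
  have "n \<in> carrier (free_lmodule Q UNIV) \<Longrightarrow>
    cover_map Q K1 (shift_lift n) \<oplus>\<^bsub>F0\<^esub> cls (aug_rep n) \<odot>\<^bsub>F0\<^esub> ?e = n"
  proof (induction rule: ring.free_lmodule_induct[OF ring_Q, where I = UNIV, consumes 1, case_names _ _ zero step])
    case zero
    have z: "(\<lambda>_. \<zero>\<^bsub>Q\<^esub>) = \<zero>\<^bsub>F0\<^esub>" by (simp add: F0_eq free_lmodule_simps)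
    have "shift_lift (\<lambda>_. \<zero>\<^bsub>Q\<^esub>) = \<zero>\<^bsub>F1\<^esub>"
      by (auto simp: shift_lift_def F1_eq free_lmodule_simps zero_Q)
    then have "cover_map Q K1 (shift_lift (\<lambda>_. \<zero>\<^bsub>Q\<^esub>)) = \<zero>\<^bsub>F0\<^esub>"
      by (simp only: K1.cover_map_zero K1_simps(2))
    moreover have "cls (aug_rep (\<lambda>_. \<zero>\<^bsub>Q\<^esub>)) = \<zero>\<^bsub>Q\<^esub>"
      by (simp only: aug_rep_def zero_Q comb_zero cls_zero)
    ultimately show ?case
      by (simp only: F0.lm_l_zero[OF unit_F0] F0.N.l_zero[OF F0.N.zero_closed] z)
  next
    case (step t b n)
    have n: "n \<in> carrier F0" and b: "b \<in> carrier Q" using step by (simp_all add: F0_eq)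
    have IH: "cover_map Q K1 (shift_lift n) \<oplus>\<^bsub>F0\<^esub> cls (aug_rep n) \<odot>\<^bsub>F0\<^esub> ?e = n" by (rule step.IH)
    have sl: "shift_lift n \<in> carrier F1" by (rule shift_lift_closed[OF n])
    have u: "unit_fun Q (shift_cycle t) \<in> carrier F1"
      by (rule K1.unit_fun_in_free_cover[OF shift_cycle_K1])
    have f1: "cover_map Q K1 (shift_lift (b \<odot>\<^bsub>F0\<^esub> unit_fun Q t \<oplus>\<^bsub>F0\<^esub> n))
        = b \<odot>\<^bsub>F0\<^esub> shift_cycle t \<oplus>\<^bsub>F0\<^esub> cover_map Q K1 (shift_lift n)"
      unfolding shift_lift_add shift_lift_smult[OF b] shift_lift_unit
        K1.cover_map_add[OF F1.lm_closed[OF b u] sl] K1.cover_map_smult[OF u b]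
        K1.cover_map_unit_fun[OF shift_cycle_K1] K1_simps(3,4) ..
    have f2: "cls (aug_rep (b \<odot>\<^bsub>F0\<^esub> unit_fun Q t \<oplus>\<^bsub>F0\<^esub> n)) = b \<otimes>\<^bsub>Q\<^esub> cls (const t) \<oplus>\<^bsub>Q\<^esub> cls (aug_rep n)"
    proof -
      have "aug_rep (b \<odot>\<^bsub>F0\<^esub> unit_fun Q t \<oplus>\<^bsub>F0\<^esub> n) = rep b * const t + aug_rep n"
        using step unfolding aug_rep_def F0_eq by (intro comb_step) (simp_all add: zero_Q)
      then show ?thesis by (simp only: add_Q[symmetric] mult_Q[symmetric] cls_rep[OF b])
    qed
    have f3: "b \<odot>\<^bsub>F0\<^esub> shift_cycle t \<oplus>\<^bsub>F0\<^esub> (b \<otimes>\<^bsub>Q\<^esub> cls (const t)) \<odot>\<^bsub>F0\<^esub> ?e = b \<odot>\<^bsub>F0\<^esub> unit_fun Q t"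
    proof -
      have c: "cls p \<odot>\<^bsub>F0\<^esub> ?e \<in> carrier F0" for p by (intro F0.lm_closed cls_carrier unit_F0)
      have "shift_cycle t \<oplus>\<^bsub>F0\<^esub> cls (const t) \<odot>\<^bsub>F0\<^esub> ?e
          = unit_fun Q t \<oplus>\<^bsub>F0\<^esub> (cls (const (- t)) \<oplus>\<^bsub>Q\<^esub> cls (const t)) \<odot>\<^bsub>F0\<^esub> ?e"
        unfolding shift_cycle_def F0.lm_l_distr[OF cls_carrier cls_carrier unit_F0]
        by (rule F0.N.a_assoc[OF unit_F0 c c])
      also have "cls (const (- t)) \<oplus>\<^bsub>Q\<^esub> cls (const t) = \<zero>\<^bsub>Q\<^esub>"
        unfolding add_Q zero_Q by (simp add: cls_zero flip: single_add)
      finally have "shift_cycle t \<oplus>\<^bsub>F0\<^esub> cls (const t) \<odot>\<^bsub>F0\<^esub> ?e = unit_fun Q t"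
        by (simp only: F0.lm_l_zero[OF unit_F0] F0.N.r_zero[OF unit_F0])
      moreover have "shift_cycle t \<in> carrier F0" using shift_cycle_K1 unfolding K1_simps by blast
      ultimately show ?thesis
        unfolding F0.lm_assoc[OF b cls_carrier unit_F0] by (metis F0.lm_r_distr b c)
    qed
    have f4: "(b \<otimes>\<^bsub>Q\<^esub> cls (const t) \<oplus>\<^bsub>Q\<^esub> cls (aug_rep n)) \<odot>\<^bsub>F0\<^esub> ?e
        = (b \<otimes>\<^bsub>Q\<^esub> cls (const t)) \<odot>\<^bsub>F0\<^esub> ?e \<oplus>\<^bsub>F0\<^esub> cls (aug_rep n) \<odot>\<^bsub>F0\<^esub> ?e"
      using b by (intro F0.lm_l_distr cls_carrier unit_F0 ring.ring_simprules(5)[OF ring_Q])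
    have swap: "(x \<oplus>\<^bsub>F0\<^esub> y) \<oplus>\<^bsub>F0\<^esub> (z \<oplus>\<^bsub>F0\<^esub> w) = (x \<oplus>\<^bsub>F0\<^esub> z) \<oplus>\<^bsub>F0\<^esub> (y \<oplus>\<^bsub>F0\<^esub> w)"
      if "x \<in> carrier F0" "y \<in> carrier F0" "z \<in> carrier F0" "w \<in> carrier F0" for x y z w
      using that by (simp add: F0.N.a_ac)
    have cA: "b \<odot>\<^bsub>F0\<^esub> shift_cycle t \<in> carrier F0"
      using shift_cycle_K1[of t] b unfolding K1_simps by (intro F0.lm_closed) blast+
    have cC: "cover_map Q K1 (shift_lift n) \<in> carrier F0"
      using K1.cover_map_closed[OF sl] unfolding K1_simps by blast
    have cX: "(b \<otimes>\<^bsub>Q\<^esub> cls (const t)) \<odot>\<^bsub>F0\<^esub> ?e \<in> carrier F0"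
      using b by (intro F0.lm_closed cls_carrier unit_F0 ring.ring_simprules(5)[OF ring_Q])
    have cY: "cls (aug_rep n) \<odot>\<^bsub>F0\<^esub> ?e \<in> carrier F0"
      by (intro F0.lm_closed cls_carrier unit_F0)
    show ?case
      unfolding F0_eq[symmetric] f1 f2 f4 swap[OF cA cC cX cY] f3 IH ..
  qed auto
  with assms show ?thesis by (simp add: F0_eq)
qed

text \<open>For a first syzygy the decomposition of \<open>cover_shift_lift\<close> is lifted to \<open>F1\<close> by \<open>shift_lift\<close> and
  \<open>fox_lift\<close>; the lift and the basis element at \<open>n\<close> have the same image \<open>n\<close>, so they differ by a
  second syzygy.\<close>

lemma unit_minus_lifts_cycle:
  assumes n: "n \<in> carrier K1"
  obtains h where "h \<in> carrier K2"
    and "unit_fun Q n = h \<oplus>\<^bsub>F1\<^esub> (fox_lift (aug_rep n) \<oplus>\<^bsub>F1\<^esub> shift_lift n)"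
proof -
  interpret F0: left_module Q F0 by (rule left_module_F0)
  interpret K1: left_module Q K1 by (rule left_module_K1)
  interpret F1: left_module Q F1 by (rule left_module_F1)
  have n0: "n \<in> carrier F0" using n unfolding K1_simps by blast
  have a: "fox_lift (aug_rep n) \<in> carrier F1" by (rule fox_lift_closed[OF aug_rep_K1[OF n]])
  have b: "shift_lift n \<in> carrier F1" by (rule shift_lift_closed[OF n0])
  have u: "unit_fun Q n \<in> carrier F1" by (rule K1.unit_fun_in_free_cover[OF n])
  let ?r = "fox_lift (aug_rep n) \<oplus>\<^bsub>F1\<^esub> shift_lift n"
  have r: "?r \<in> carrier F1" by (rule F1.N.a_closed[OF a b])
  have "cover_map Q K1 ?r = cls (aug_rep n) \<odot>\<^bsub>F0\<^esub> unit_fun Q 1 \<oplus>\<^bsub>F0\<^esub> cover_map Q K1 (shift_lift n)"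
    unfolding K1.cover_map_add[OF a b] cover_fox_lift[OF aug_rep_K1[OF n]] K1_simps ..
  also have "\<dots> = cover_map Q K1 (shift_lift n) \<oplus>\<^bsub>F0\<^esub> cls (aug_rep n) \<odot>\<^bsub>F0\<^esub> unit_fun Q 1"
    using K1.cover_map_closed[OF b] unfolding K1_simps
    by (intro F0.N.a_comm F0.lm_closed cls_carrier unit_F0) blast
  also have "\<dots> = n" by (rule cover_shift_lift[OF n0])
  finally have cr: "cover_map Q K1 ?r = n" .
  let ?h = "unit_fun Q n \<ominus>\<^bsub>F1\<^esub> ?r"
  have h: "?h \<in> carrier F1" "unit_fun Q n = ?h \<oplus>\<^bsub>F1\<^esub> ?r"
    using u r by (auto simp: a_minus_def F1.N.a_assoc F1.N.l_neg)
  have "n = cover_map Q K1 ?h \<oplus>\<^bsub>K1\<^esub> n"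
    using K1.cover_map_add[OF h(1) r] unfolding cr h(2)[symmetric] K1.cover_map_unit_fun[OF n] .
  then have "cover_map Q K1 ?h = \<zero>\<^bsub>K1\<^esub>"
    using K1.N.add.r_cancel_one'[OF n K1.cover_map_closed[OF h(1)]] by simp
  with h(1) have "?h \<in> carrier K2" unfolding K2_simps by blast
  then show thesis using h(2) by (rule that)
qed

text \<open>This is the homotopy that makes the Hopf map injective: summing \<open>unit_minus_lifts_cycle\<close> with
  coefficients of augmentation zero, the second syzygies contribute an element of \<open>I K2\<close>, and the
  remaining two terms are functions of \<open>total_rep f\<close> and of the boundary of \<open>f\<close>.\<close>

lemma decompose_augmented:
  assumes f: "f \<in> carrier F1" and I: "\<And>n. aug Q (f n) = 0"
  shows "\<exists>x\<in>aug_mult Q K2.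
    f = x \<oplus>\<^bsub>F1\<^esub> (fox_lift (total_rep f) \<oplus>\<^bsub>F1\<^esub> shift_lift (cover_map Q K1 f))"
proof -
  interpret F0: left_module Q F0 by (rule left_module_F0)
  interpret K1: left_module Q K1 by (rule left_module_K1)
  interpret F1: left_module Q F1 by (rule left_module_F1)
  interpret K2: aug_left_module Q K2 by (rule aug_left_module_K2)
  have total: "total_rep f \<in> min_length 1" if "f \<in> carrier F1" for f
  proof -
    interpret m: free_ideal "min_length 1" by (rule free_ideal.intro[OF ideal_min_length])
    show ?thesis
      unfolding total_rep_def comb_def
      using free_lmodule_Q(3)[OF that[unfolded F1_eq]] by (intro m.sum m.lmult aug_rep_K1) blast
  qed
  have aug0: "aug Q \<zero>\<^bsub>Q\<^esub> = 0" by (rule augmented_algebra.aug_simps(2)[OF augmented_algebra_Q])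
  have "f \<in> carrier (free_lmodule Q (carrier K1))" "\<And>n. f n \<in> {b. aug Q b = 0}" "\<zero>\<^bsub>Q\<^esub> \<in> {b. aug Q b = 0}"
    using f I aug0 by (simp_all add: F1_eq)
  then show ?thesis
  proof (induction rule: ring.free_lmodule_induct[OF ring_Q, consumes 3, case_names zero step])
    case zero
    have "total_rep (\<lambda>_. \<zero>\<^bsub>Q\<^esub>) = 0" by (simp only: total_rep_def zero_Q comb_zero)
    moreover have "fox_lift 0 = \<zero>\<^bsub>F1\<^esub>"
      by (simp add: cls_zero F1_eq free_lmodule_simps zero_Q fox_lift_def fox_def free.lin_ext_zero)
    moreover have "(\<lambda>_. \<zero>\<^bsub>Q\<^esub>) = \<zero>\<^bsub>F1\<^esub>" by (simp only: F1_eq free_lmodule_simps)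
    moreover have "shift_lift \<zero>\<^bsub>F0\<^esub> = \<zero>\<^bsub>F1\<^esub>"
      by (rule ext) (simp add: shift_lift_def F0_eq F1_eq free_lmodule_simps zero_Q)
    moreover have "\<zero>\<^bsub>F1\<^esub> \<in> aug_mult Q K2" using aug_mult.zero[of K2 Q] unfolding K2_simps .
    ultimately show ?case
      by (intro bexI[of _ "\<zero>\<^bsub>F1\<^esub>"])
        (simp_all only: K1.cover_map_zero K1_simps(2) F1.N.l_zero F1.N.zero_closed)
  next
    case (step n b f)
    have f: "f \<in> carrier F1" and b: "b \<in> carrier Q" "aug Q b = 0" and n: "n \<in> carrier K1"
      using step by (simp_all add: F1_eq)
    obtain x where x: "x \<in> aug_mult Q K2"
      and fx: "f = x \<oplus>\<^bsub>F1\<^esub> (fox_lift (total_rep f) \<oplus>\<^bsub>F1\<^esub> shift_lift (cover_map Q K1 f))"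
      using step.IH by blast
    obtain h where h: "h \<in> carrier K2"
      and un: "unit_fun Q n = h \<oplus>\<^bsub>F1\<^esub> (fox_lift (aug_rep n) \<oplus>\<^bsub>F1\<^esub> shift_lift n)"
      by (rule unit_minus_lifts_cycle[OF n])
    have h1: "h \<in> carrier F1" and x1: "x \<in> carrier F1"
      using h K2.aug_mult_carrier[OF x] unfolding K2_simps by blast+
    have u: "unit_fun Q n \<in> carrier F1" by (rule K1.unit_fun_in_free_cover[OF n])
    have n0: "n \<in> carrier F0" and c0: "cover_map Q K1 f \<in> carrier F0"
      using n K1.cover_map_closed[OF f] unfolding K1_simps by blast+
    let ?a = "fox_lift (aug_rep n)" and ?s = "shift_lift n"
    let ?a' = "fox_lift (total_rep f)" and ?s' = "shift_lift (cover_map Q K1 f)"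
    have a: "?a \<in> carrier F1" "?a' \<in> carrier F1"
      using fox_lift_closed[OF aug_rep_K1[OF n]] fox_lift_closed[OF total[OF f]] by auto
    have s: "?s \<in> carrier F1" "?s' \<in> carrier F1"
      using shift_lift_closed[OF n0] shift_lift_closed[OF c0] by auto
    let ?f = "b \<odot>\<^bsub>F1\<^esub> unit_fun Q n \<oplus>\<^bsub>F1\<^esub> f"
    have "total_rep ?f = rep b * aug_rep n + total_rep f"
      using step unfolding total_rep_def F1_eq by (intro comb_step) (simp_all add: zero_Q)
    then have fox: "fox_lift (total_rep ?f) = b \<odot>\<^bsub>F1\<^esub> ?a \<oplus>\<^bsub>F1\<^esub> ?a'"
      by (simp only: fox_lift_add fox_lift_lmult[OF aug_rep_K1[OF n]] cls_rep[OF b(1)])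
    have shift: "shift_lift (cover_map Q K1 ?f) = b \<odot>\<^bsub>F1\<^esub> ?s \<oplus>\<^bsub>F1\<^esub> ?s'"
      unfolding K1.cover_map_add[OF F1.lm_closed[OF b(1) u] f] K1.cover_map_smult[OF u b(1)]
        K1.cover_map_unit_fun[OF n] K1_simps shift_lift_add shift_lift_smult[OF b(1)] ..
    have "b \<odot>\<^bsub>F1\<^esub> unit_fun Q n = b \<odot>\<^bsub>F1\<^esub> h \<oplus>\<^bsub>F1\<^esub> (b \<odot>\<^bsub>F1\<^esub> ?a \<oplus>\<^bsub>F1\<^esub> b \<odot>\<^bsub>F1\<^esub> ?s)"
      unfolding un F1.lm_r_distr[OF b(1) h1 F1.N.a_closed[OF a(1) s(1)]] F1.lm_r_distr[OF b(1) a(1) s(1)] ..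
    then have f_eq: "?f = (b \<odot>\<^bsub>F1\<^esub> h \<oplus>\<^bsub>F1\<^esub> (b \<odot>\<^bsub>F1\<^esub> ?a \<oplus>\<^bsub>F1\<^esub> b \<odot>\<^bsub>F1\<^esub> ?s)) \<oplus>\<^bsub>F1\<^esub> (x \<oplus>\<^bsub>F1\<^esub> (?a' \<oplus>\<^bsub>F1\<^esub> ?s'))"
      by (rule arg_cong2[OF _ fx])
    have "(y \<oplus>\<^bsub>F1\<^esub> (p \<oplus>\<^bsub>F1\<^esub> q)) \<oplus>\<^bsub>F1\<^esub> (x \<oplus>\<^bsub>F1\<^esub> (r \<oplus>\<^bsub>F1\<^esub> t))
        = (y \<oplus>\<^bsub>F1\<^esub> x) \<oplus>\<^bsub>F1\<^esub> ((p \<oplus>\<^bsub>F1\<^esub> r) \<oplus>\<^bsub>F1\<^esub> (q \<oplus>\<^bsub>F1\<^esub> t))"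
      if "y \<in> carrier F1" "p \<in> carrier F1" "q \<in> carrier F1" "r \<in> carrier F1" "t \<in> carrier F1" for y p q r t
      using that x1 by (simp add: F1.N.a_ac)
    note swap = this[OF F1.lm_closed[OF b(1) h1] F1.lm_closed[OF b(1) a(1)] F1.lm_closed[OF b(1) s(1)] a(2) s(2)]
    have eq: "?f = (b \<odot>\<^bsub>F1\<^esub> h \<oplus>\<^bsub>F1\<^esub> x) \<oplus>\<^bsub>F1\<^esub>
        (fox_lift (total_rep ?f) \<oplus>\<^bsub>F1\<^esub> shift_lift (cover_map Q K1 ?f))"
      unfolding fox shift by (rule trans[OF f_eq swap])
    have mem: "b \<odot>\<^bsub>F1\<^esub> h \<oplus>\<^bsub>F1\<^esub> x \<in> aug_mult Q K2"
      using aug_mult.add[OF b h x] unfolding K2_simps .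
    show ?case unfolding F1_eq[symmetric] by (rule bexI[OF _ mem]) (rule eq)
  qed
qed

text \<open>The Hopf formula \<open>H\<^sub>2(P/K) = (K \<inter> I\<^sup>2)/(IK + KI)\<close>, where the quotient is given in coordinates by a
  functional \<open>L\<close>.  The Hopf map takes a second syzygy with coefficients in \<open>I\<close> to \<open>K \<inter> I\<^sup>2\<close>; it is onto
  because \<open>fox_lift\<close> is a section, and if its value is decomposable then \<open>decompose_augmented\<close>,
  whose last term vanishes on a syzygy, shows that the syzygy lies in \<open>I K2\<close>.\<close>

lemma H2_iso_of_functional:
  fixes L :: "('x word \<Rightarrow>\<^sub>0 'k) \<Rightarrow> (nat \<Rightarrow>\<^sub>0 'k)"
  assumes L_add: "\<And>p q. L (p + q) = L p + L q"
    and L_lmult: "\<And>p j. j \<in> K \<Longrightarrow> L (p * j) = const (counit p) * L j"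
    and L_rmult: "\<And>p j. j \<in> K \<Longrightarrow> L (j * p) = const (counit p) * L j"
    and kernel: "\<And>j. j \<in> K \<Longrightarrow> L j = 0 \<Longrightarrow> j \<in> decomposables K"
    and image: "L ` (K \<inter> min_length 2) = {z. Poly_Mapping.keys z \<subseteq> S}"
  obtains T where "T \<in> vs_iso (H2 Q) (free_vs S)"
proof -
  interpret K1: left_module Q K1 by (rule left_module_K1)
  interpret K2: aug_left_module Q K2 by (rule aug_left_module_K2)
  interpret F1: left_module Q F1 by (rule left_module_F1)
  define \<theta> where "\<theta> f = L (total_rep f)" for f
  have L_zero: "L 0 = 0" using L_add[of 0 0] by (simp only: add_0_left add_cancel_right_right)
  have L_dec: "L x = 0" if "x \<in> decomposables K" for x
    using that
  proof (induction rule: decomposables_induct)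
    case (lmult p j)
    then show ?case by (simp add: L_lmult min_length_1_iff del: One_nat_def)
  next
    case (rmult p j)
    then show ?case by (simp add: L_rmult min_length_1_iff del: One_nat_def)
  qed (simp add: L_add)
  have L_cong: "L x = L y" if "x - y \<in> decomposables K" for x y
    using L_add[of "x - y" y] L_dec[OF that] by simp
  have K2F1: "f \<in> carrier F1" and cycle: "cover_map Q K1 f = \<zero>\<^bsub>K1\<^esub>" if "f \<in> carrier K2" for f
    using that unfolding K2_simps by blast+
  have aug_rep_zero: "aug_rep \<zero>\<^bsub>K1\<^esub> = 0"
    unfolding K1_simps(2) F0_eq free_lmodule_simps aug_rep_def zero_Q by (rule comb_zero)
  have total_K: "total_rep f \<in> K" if "f \<in> carrier K2" for f
    using uminus[OF total_rep_cover[OF K2F1[OF that]]] unfolding cycle[OF that] aug_rep_zero by simp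
  have theta_add: "\<theta> (f \<oplus>\<^bsub>K2\<^esub> g) = \<theta> f + \<theta> g" if "f \<in> carrier K2" "g \<in> carrier K2" for f g
    unfolding \<theta>_def K2_simps L_cong[OF total_rep_add[OF K2F1[OF that(1)] K2F1[OF that(2)]]] L_add ..
  have theta_smult: "\<theta> (b \<odot>\<^bsub>K2\<^esub> f) = const (aug Q b) * \<theta> f" if "b \<in> carrier Q" "f \<in> carrier K2" for b f
    unfolding \<theta>_def K2_simps L_cong[OF total_rep_smult[OF K2F1[OF that(2)] that(1)]]
      L_lmult[OF total_K[OF that(2)]] counit_rep[OF that(1)] ..
  let ?Z = "{f \<in> carrier K2. \<forall>n. aug Q (f n) = 0}"
  have onto: "\<theta> ` ?Z = carrier (free_vs S)"
  proof -
    have "\<theta> f \<in> L ` (K \<inter> min_length 2)" if f: "f \<in> ?Z" for f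
    proof -
      interpret m: free_ideal "min_length 2" by (rule free_ideal.intro[OF ideal_min_length])
      have F: "f \<in> carrier F1" using f K2F1 by blast
      have "rep (f n) * aug_rep n \<in> min_length 2" if "n \<in> {n. f n \<noteq> K}" for n
      proof -
        have "n \<in> carrier K1" using that free_lmodule_Q(3)[OF F[unfolded F1_eq]] by blast
        moreover have "rep (f n) \<in> min_length 1"
          using counit_rep[OF free_lmodule_Q(1)[OF F[unfolded F1_eq]], of n] f
          by (simp add: min_length_1_iff del: One_nat_def)
        ultimately show ?thesis
          using min_length_mult[OF _ aug_rep_K1, of "rep (f n)" 1 n] by (simp add: numeral_2_eq_2)
      qed
      then have "total_rep f \<in> min_length 2"
        unfolding total_rep_def comb_def by (rule m.sum)
      moreover have "total_rep f \<in> K" using f total_K by blast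
      ultimately show ?thesis unfolding \<theta>_def by blast
    qed
    moreover have "L j \<in> \<theta> ` ?Z" if j: "j \<in> K" "j \<in> min_length 2" for j
    proof -
      have "fox_lift j \<in> carrier K2" by (rule fox_lift_cycle[OF j(1)])
      moreover have "aug Q (fox_lift j n) = 0" for n
        using fox_min_length[OF j(2)] by (simp add: fox_lift_def aug_Q min_length_1_iff del: One_nat_def)
      moreover have "\<theta> (fox_lift j) = L j"
        unfolding \<theta>_def by (rule L_cong[OF total_rep_fox_lift[OF j(2)]])
      ultimately show ?thesis by (intro image_eqI[of "L j" \<theta> "fox_lift j"]) simp_all
    qed
    ultimately have "\<theta> ` ?Z = L ` (K \<inter> min_length 2)" by blast
    then show ?thesis unfolding image by simp
  qed
  have inj: "f \<in> aug_mult Q K2" if "f \<in> ?Z" "\<theta> f = 0" for f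
  proof -
    have f: "f \<in> carrier K2" "f \<in> carrier F1" "\<And>n. aug Q (f n) = 0"
      using that(1) K2F1 by blast+
    obtain x where x: "x \<in> aug_mult Q K2"
      and fx: "f = x \<oplus>\<^bsub>F1\<^esub> (fox_lift (total_rep f) \<oplus>\<^bsub>F1\<^esub> shift_lift (cover_map Q K1 f))"
      using decompose_augmented[OF f(2,3)] by blast
    have "total_rep f \<in> decomposables K"
      using kernel[OF total_K[OF f(1)]] that(2) by (simp add: \<theta>_def)
    then have y: "fox_lift (total_rep f) \<in> aug_mult Q K2" by (rule fox_lift_decomposable)
    have "shift_lift (cover_map Q K1 f) = \<zero>\<^bsub>F1\<^esub>"
      unfolding cycle[OF f(1)]
      by (rule ext) (simp add: shift_lift_def K1_simps F0_eq F1_eq free_lmodule_simps zero_Q)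
    moreover have "fox_lift (total_rep f) \<in> carrier F1" using K2.aug_mult_carrier[OF y] K2F1 by blast
    ultimately have "f = x \<oplus>\<^bsub>K2\<^esub> fox_lift (total_rep f)"
      using fx unfolding K2_simps by (simp only: F1.N.r_zero)
    with K2.aug_mult_add[OF x y] show ?thesis by (simp only:)
  qed
  show thesis
    unfolding H2_def
    by (rule Tor2_iso[OF aug_left_module_triv theta_add theta_smult onto inj]) (use that in \<open>simp_all add: H2_def\<close>)
qed

end

theorem theorem2:
  shows "para_equivalence free_algebra alg_A0
           (canonical_map :: (gens4 word \<Rightarrow>\<^sub>0 'k::field) \<Rightarrow> 'k P set)
    \<and> (omega_A0 :: 'k P set set) = a_kernel alg_A0 alg_A proj_A
    \<and> (\<exists>S. S \<in> vs_iso (omega_quot :: ('k, 'k P set set) module) (free_vs {2::nat..}))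
    \<and> (\<forall>l\<ge>2. class_A0 (rel_w l :: 'k P) \<in> omega_A0)
    \<and> (\<exists>T \<in> vs_iso (H2 (alg_A :: ('k, 'k P set) aug_algebra)) omega_quot.
         \<exists>h. (\<forall>l\<ge>2. h l \<in> carrier (H2 alg_A) \<and>
                    T (h l) = omega_dec +>\<^bsub>alg_A0\<^esub> class_A0 (rel_w l)) \<and>
             inj_on h {2..} \<and>
             vectorspace.basis class_ring (H2 alg_A) (h ` {2..}))"
proof (intro conjI)
  obtain S where S: "S \<in> vs_iso (omega_quot :: ('k, 'k P set set) module) (free_vs {2::nat..})"
    and S_w: "\<And>l. l \<ge> 2 \<Longrightarrow> S (omega_dec +>\<^bsub>alg_A0\<^esub> class_A0 (rel_w l)) = Poly_Mapping.single l 1"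
    using omega_quot_iso by metis
  show "\<exists>S. S \<in> vs_iso (omega_quot :: ('k, 'k P set set) module) (free_vs {2::nat..})"
    using S by blast
  have kernel: "j \<in> decomposables ideal_J" if "j \<in> ideal_J" "relator_coord j = 0" for j :: "'k P"
    using J_mod_decomposables[OF that(1)] unfolding that(2) w_comb_def free.lin_ext_zero by simp
  obtain R where R: "R \<in> vs_iso (H2 (alg_A :: ('k, 'k P set) aug_algebra)) (free_vs {2::nat..})"
    using A.H2_iso_of_functional[OF relator_coord_add relator_coord_lmult relator_coord_rmult kernel relator_coord_image_J_I2]
    unfolding alg_A_def by blast
  let ?V = "H2 (alg_A :: ('k, 'k P set) aug_algebra)"
  let ?S' = "inv_into (carrier (omega_quot :: ('k, 'k P set set) module)) S"
  let ?R' = "inv_into (carrier ?V) R"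
  \<comment> \<open>both sides have coordinates in the space with basis \<open>{2..}\<close>; match them there\<close>
  define T where "T = ?S' \<circ> R"
  define h where "h l = ?R' (Poly_Mapping.single l 1)" for l :: nat
  have T: "T \<in> vs_iso ?V omega_quot"
    unfolding T_def by (rule vs_iso_comp[OF R vs_iso_inverse[OF S]])
  have bij: "bij_betw R (carrier ?V) {z. Poly_Mapping.keys z \<subseteq> {2..}}"
    "bij_betw S (carrier omega_quot) {z. Poly_Mapping.keys z \<subseteq> {2..}}"
    using vs_isoD(6)[OF R] vs_isoD(6)[OF S] by simp_all
  have h: "h l \<in> carrier ?V \<and> R (h l) = Poly_Mapping.single l 1" if "l \<in> {2..}" for l
  proof -
    have "Poly_Mapping.single l (1::'k) \<in> R ` carrier ?V"
      using bij(1) that by (simp add: bij_betw_def)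
    then show ?thesis unfolding h_def by (simp add: inv_into_into f_inv_into_f)
  qed
  have "T (h l) = omega_dec +>\<^bsub>alg_A0\<^esub> class_A0 (rel_w l)" if "l \<ge> 2" for l
  proof -
    have "omega_dec +>\<^bsub>alg_A0\<^esub> class_A0 (rel_w l) \<in> carrier (omega_quot :: ('k, 'k P set set) module)"
      using rel_w_in_J[of l] by (auto simp: omega_quot_def quot_vs_def omega_A0_eq)
    moreover have "S (omega_dec +>\<^bsub>alg_A0\<^esub> class_A0 (rel_w l)) = R (h l)"
      using S_w h that by simp
    ultimately show ?thesis
      using bij(2) unfolding T_def by (metis bij_betw_inv_into_left comp_apply)
  qed
  then show "\<exists>T \<in> vs_iso ?V omega_quot.
         \<exists>h. (\<forall>l\<ge>2. h l \<in> carrier ?V \<and>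
                    T (h l) = omega_dec +>\<^bsub>alg_A0\<^esub> class_A0 (rel_w l)) \<and>
             inj_on h {2..} \<and>
             vectorspace.basis class_ring ?V (h ` {2..})"
    using T h basis_of_vs_iso[OF R h] by (intro bexI[OF _ T] exI[of _ h]) auto
  show "omega_A0 = a_kernel alg_A0 alg_A (proj_A :: 'k P set \<Rightarrow> _)" by (rule omega_A0_eq_kernel)
  show "\<forall>l\<ge>2. class_A0 (rel_w l :: 'k P) \<in> omega_A0"
    by (auto simp: omega_A0_eq intro: rel_w_in_J)
  show "para_equivalence free_algebra alg_A0 (canonical_map :: (gens4 word \<Rightarrow>\<^sub>0 'k) \<Rightarrow> 'k P set)"
    by (rule para_equivalence_canonical_map)
qed

end
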